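(* Let $Y$ be a separable Hilbert space and let $B:D(B)\to Y$ be a positive self-adjoint operator with dense domain $D(B)\subset Y$. The operator $A=-\partial_{xx}^2+B$, with domain $D(A)=H^2(\mathbb{R},Y)\cap L^2(\mathbb{R},D(B))$, is a well-defined self-adjoint operator from $D(A)$ into $L^2(\mathbb{R},Y)$. In particular, it generates an analytic semigroup $e^{-At}=e^{-(-\partial_{xx}^2+B)t}$ on $L^2(\mathbb{R},Y)$.
   Context: Positive means $\langle Bu|u\rangle_Y\ge 0$ for all $u\in D(B)$; $D(B)$ carries its graph norm. $L^2(\mathbb{R},Y)$ is the Bochner space of (strongly measurable) square-integrable functions with values in $Y$, and $H^2(\mathbb{R},Y)$ is the space of $u\in L^2(\mathbb{R},Y)$ whose weak derivatives of order $\le 2$ (tested against real-valued functions of $\mathcal{C}^\infty_c(\mathbb{R},\mathbb{R})$) belong to $L^2(\mathbb{R},Y)$. $(Bu)(x)=B(u(x))$. If $Y$ is real, spectral notions are understood after complexification. *)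

theory Defs
  imports "HOL-Analysis.Analysis"
begin

section \<open>Complex inner product spaces\<close>

text \<open>A complex inner product space is a real one (with the real part as real inner product, hence
  the same norm) with a compatible complex structure.  The complex inner product is linear in its
  first argument.\<close>

class complex_inner = real_inner +
  fixes scaleC :: "complex \<Rightarrow> 'a \<Rightarrow> 'a"  (infixr \<open>*\<^sub>C\<close> 75)
    and cinner :: "'a \<Rightarrow> 'a \<Rightarrow> complex"
  assumes scaleC_add_right: "c *\<^sub>C (x + y) = c *\<^sub>C x + c *\<^sub>C y"
    and scaleC_add_left: "(c + d) *\<^sub>C x = c *\<^sub>C x + d *\<^sub>C x"
    and scaleC_scaleC: "c *\<^sub>C d *\<^sub>C x = (c * d) *\<^sub>C x"
    and scaleC_of_real: "complex_of_real r *\<^sub>C x = r *\<^sub>R x"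
    and cinner_commute: "cinner x y = cnj (cinner y x)"
    and cinner_add_left: "cinner (x + y) z = cinner x z + cinner y z"
    and cinner_scaleC_left: "cinner (c *\<^sub>C x) y = c * cinner x y"
    and Re_cinner: "Re (cinner x y) = inner x y"

lemma scaleC_eq: "c *\<^sub>C x = Re c *\<^sub>R x + Im c *\<^sub>R (\<i> *\<^sub>C (x :: 'a :: complex_inner))"
proof -
  have "c *\<^sub>C x = (complex_of_real (Re c) + complex_of_real (Im c) * \<i>) *\<^sub>C x"
    by (subst mult.commute) (simp only: complex_eq[symmetric])
  also have "\<dots> = Re c *\<^sub>R x + Im c *\<^sub>R (\<i> *\<^sub>C x)"
    by (simp only: scaleC_add_left scaleC_of_real scaleC_scaleC[symmetric])
  finally show ?thesis .
qed

lemma cinner_scaleC_right: "cinner x (c *\<^sub>C y) = cnj c * cinner x (y :: 'a :: complex_inner)"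
  by (metis cinner_commute cinner_scaleC_left complex_cnj_mult)

lemma norm_ii_scaleC [simp]: "norm (\<i> *\<^sub>C (x :: 'a :: complex_inner)) = norm x"
proof -
  have "cinner (\<i> *\<^sub>C x) (\<i> *\<^sub>C x) = cinner x x"
    by (simp add: cinner_scaleC_left cinner_scaleC_right)
  then show ?thesis
    by (metis Re_cinner norm_eq_sqrt_inner)
qed

lemma bounded_linear_ii_scaleC: "bounded_linear (\<lambda>x :: 'a :: complex_inner. \<i> *\<^sub>C x)"
proof (rule bounded_linear_intro[where K = 1])
  fix r and x :: 'a
  show "\<i> *\<^sub>C (r *\<^sub>R x) = r *\<^sub>R \<i> *\<^sub>C x"
    by (simp add: scaleC_of_real[symmetric] scaleC_scaleC mult.commute)
qed (simp_all add: scaleC_add_right)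

lemma cinner_eq: "cinner x y = Complex (inner x y) (inner x (\<i> *\<^sub>C (y :: 'a :: complex_inner)))"
proof -
  have "inner x (\<i> *\<^sub>C y) = Im (cinner x y)"
    by (simp add: Re_cinner[symmetric] cinner_scaleC_right)
  then show ?thesis
    by (simp add: complex_eq_iff Re_cinner)
qed


section \<open>Unbounded self-adjoint operators\<close>

text \<open>An operator is given by its domain \<open>D\<close> and a function \<open>A\<close> whose values outside \<open>D\<close> are
  irrelevant.  The scalar multiplication \<open>sc\<close> and the inner product \<open>ip\<close> are parameters, to be
  instantiated with \<open>scaleR\<close>, \<open>inner\<close> or with \<open>scaleC\<close>, \<open>cinner\<close>.\<close>

definition linear_operator :: "('k::comm_ring_1 \<Rightarrow> 'h::ab_group_add \<Rightarrow> 'h) \<Rightarrow> 'h set \<Rightarrow> ('h \<Rightarrow> 'h) \<Rightarrow> bool"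
  where "linear_operator sc D A \<longleftrightarrow> module.subspace sc D \<and>
    (\<forall>x\<in>D. \<forall>y\<in>D. A (x + y) = A x + A y) \<and> (\<forall>c. \<forall>x\<in>D. A (sc c x) = sc c (A x))"

definition operator_graph :: "'h set \<Rightarrow> ('h \<Rightarrow> 'h) \<Rightarrow> ('h \<times> 'h) set"
  where "operator_graph D A = {(x, A x) | x. x \<in> D}"

definition adjoint_graph :: "('h \<Rightarrow> 'h \<Rightarrow> 'k) \<Rightarrow> 'h set \<Rightarrow> ('h \<Rightarrow> 'h) \<Rightarrow> ('h \<times> 'h) set"
  where "adjoint_graph ip D A = {(y, z). \<forall>x\<in>D. ip (A x) y = ip x z}"

definition self_adjoint ::
    "('k::comm_ring_1 \<Rightarrow> 'h::real_normed_vector \<Rightarrow> 'h) \<Rightarrow> ('h \<Rightarrow> 'h \<Rightarrow> 'k) \<Rightarrow> 'h set \<Rightarrow> ('h \<Rightarrow> 'h) \<Rightarrow> bool"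
  where "self_adjoint sc ip D A \<longleftrightarrow>
    linear_operator sc D A \<and> closure D = UNIV \<and> adjoint_graph ip D A = operator_graph D A"

definition positive_operator :: "('h \<Rightarrow> 'h \<Rightarrow> 'k::real_algebra_1) \<Rightarrow> 'h set \<Rightarrow> ('h \<Rightarrow> 'h) \<Rightarrow> bool"
  where "positive_operator ip D A \<longleftrightarrow> (\<forall>x\<in>D. ip (A x) x \<in> \<real>\<^sub>\<ge>\<^sub>0)"


section \<open>The Bochner space of square-integrable functions on the line\<close>

text \<open>In a separable space, strong measurability is Borel measurability.\<close>

definition square_integrable :: "(real \<Rightarrow> 'a::{real_inner,banach,second_countable_topology}) \<Rightarrow> bool"
  where "square_integrable f \<longleftrightarrow>
    f \<in> borel_measurable lborel \<and> integrable lborel (\<lambda>x. (norm (f x))\<^sup>2)"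

lemma square_integrable_zero [simp]: "square_integrable (\<lambda>x. 0)"
  by (simp add: square_integrable_def)

lemma square_integrable_add:
  assumes "square_integrable f" "square_integrable g"
  shows "square_integrable (\<lambda>x. f x + g x)"
proof -
  have [measurable]: "f \<in> borel_measurable lborel" "g \<in> borel_measurable lborel"
    using assms by (auto simp: square_integrable_def)
  have "integrable lborel (\<lambda>x. (norm (f x + g x))\<^sup>2)"
  proof (rule Bochner_Integration.integrable_bound)
    show "integrable lborel (\<lambda>x. 2 * (norm (f x))\<^sup>2 + 2 * (norm (g x))\<^sup>2)"
      using assms by (auto simp: square_integrable_def)
    have "(norm (f x + g x))\<^sup>2 \<le> 2 * (norm (f x))\<^sup>2 + 2 * (norm (g x))\<^sup>2" for x
    proof -
      have "(norm (f x + g x))\<^sup>2 \<le> (norm (f x) + norm (g x))\<^sup>2"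
        by (intro power_mono norm_triangle_ineq) auto
      also have "\<dots> \<le> 2 * (norm (f x))\<^sup>2 + 2 * (norm (g x))\<^sup>2"
        using sum_squares_bound[of "norm (f x)" "norm (g x)"] by (simp add: power2_sum)
      finally show ?thesis .
    qed
    then show "AE x in lborel. norm ((norm (f x + g x))\<^sup>2)
        \<le> norm (2 * (norm (f x))\<^sup>2 + 2 * (norm (g x))\<^sup>2)"
      by simp
  qed measurable
  then show ?thesis
    by (simp add: square_integrable_def)
qed

lemma square_integrable_bounded_linear:
  assumes "bounded_linear T" "square_integrable f"
  shows "square_integrable (\<lambda>x. T (f x))"
proof -
  have [measurable]: "f \<in> borel_measurable lborel"
    using assms by (auto simp: square_integrable_def)
  have [measurable]: "T \<in> borel_measurable borel"
    by (intro borel_measurable_continuous_onI linear_continuous_on assms)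
  obtain K where K: "norm (T y) \<le> norm y * K" for y
    using bounded_linear.bounded[OF assms(1)] by blast
  have "integrable lborel (\<lambda>x. (norm (T (f x)))\<^sup>2)"
  proof (rule Bochner_Integration.integrable_bound)
    show "integrable lborel (\<lambda>x. (norm (f x))\<^sup>2 * K\<^sup>2)"
      using assms by (auto simp: square_integrable_def)
    have "(norm (T (f x)))\<^sup>2 \<le> (norm (f x))\<^sup>2 * K\<^sup>2" for x
      using power_mono[OF K, of "f x" 2] by (simp add: power_mult_distrib)
    then show "AE x in lborel. norm ((norm (T (f x)))\<^sup>2) \<le> norm ((norm (f x))\<^sup>2 * K\<^sup>2)"
      by simp
  qed measurable
  then show ?thesis
    by (simp add: square_integrable_def)
qed

lemma square_integrable_scaleR: "square_integrable f \<Longrightarrow> square_integrable (\<lambda>x. r *\<^sub>R f x)"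
  by (rule square_integrable_bounded_linear[OF bounded_linear_scaleR_right])

lemma square_integrable_uminus: "square_integrable f \<Longrightarrow> square_integrable (\<lambda>x. - f x)"
  using square_integrable_scaleR[of f "- 1"] by simp

lemma square_integrable_diff:
  "square_integrable f \<Longrightarrow> square_integrable g \<Longrightarrow> square_integrable (\<lambda>x. f x - g x)"
  using square_integrable_add[OF _ square_integrable_uminus, of f g] by simp

lemma square_integrable_scaleC:
  fixes f :: "real \<Rightarrow> 'a::{complex_inner,banach,second_countable_topology}"
  assumes "square_integrable f"
  shows "square_integrable (\<lambda>x. c *\<^sub>C f x)"
  by (subst scaleC_eq) (intro square_integrable_add square_integrable_scaleR
      square_integrable_bounded_linear[OF bounded_linear_ii_scaleC] assms)

lemma integrable_inner:
  assumes "square_integrable f" "square_integrable g"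
  shows "integrable lborel (\<lambda>x. inner (f x) (g x))"
proof (rule Bochner_Integration.integrable_bound)
  have [measurable]: "f \<in> borel_measurable lborel" "g \<in> borel_measurable lborel"
    using assms by (auto simp: square_integrable_def)
  show "integrable lborel (\<lambda>x. (norm (f x))\<^sup>2 + (norm (g x))\<^sup>2)"
    using assms by (auto simp: square_integrable_def)
  show "(\<lambda>x. inner (f x) (g x)) \<in> borel_measurable lborel"
    by measurable
  have "\<bar>inner (f x) (g x)\<bar> \<le> (norm (f x))\<^sup>2 + (norm (g x))\<^sup>2" for x
  proof -
    have "\<bar>inner (f x) (g x)\<bar> \<le> norm (f x) * norm (g x)"
      by (rule Cauchy_Schwarz_ineq2)
    also have "\<dots> \<le> 2 * norm (f x) * norm (g x)"
      by simp
    also have "\<dots> \<le> (norm (f x))\<^sup>2 + (norm (g x))\<^sup>2"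
      by (rule sum_squares_bound)
    finally show ?thesis .
  qed
  then show "AE x in lborel. norm (inner (f x) (g x)) \<le> norm ((norm (f x))\<^sup>2 + (norm (g x))\<^sup>2)"
    by simp
qed

lemma integrable_cinner:
  fixes f g :: "real \<Rightarrow> 'a::{complex_inner,banach,second_countable_topology}"
  assumes "square_integrable f" "square_integrable g"
  shows "integrable lborel (\<lambda>x. cinner (f x) (g x))"
proof -
  have "integrable lborel (\<lambda>x. of_real (inner (f x) (g x)) + \<i> * of_real (inner (f x) (\<i> *\<^sub>C g x)))"
    by (intro Bochner_Integration.integrable_add integrable_mult_right integrable_of_real
        integrable_inner square_integrable_scaleC assms)
  then show ?thesis
    by (simp only: cinner_eq Complex_eq)
qed

definition L2_eq :: "(real \<Rightarrow> 'a::{real_inner,banach,second_countable_topology}) \<Rightarrow> (real \<Rightarrow> 'a) \<Rightarrow> bool"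
  where "L2_eq f g \<longleftrightarrow> square_integrable f \<and> square_integrable g \<and> (AE x in lborel. f x = g x)"

quotient_type (overloaded) 'a L2 =
  "real \<Rightarrow> 'a::{real_inner,banach,second_countable_topology}" / partial: L2_eq
proof (rule part_equivpI)
  show "\<exists>f. L2_eq f (f :: real \<Rightarrow> 'a)"
    by (rule exI[of _ "\<lambda>x. 0"]) (simp add: L2_eq_def)
  show "symp (L2_eq :: (real \<Rightarrow> 'a) \<Rightarrow> _)"
    by (auto simp: symp_def L2_eq_def)
  show "transp (L2_eq :: (real \<Rightarrow> 'a) \<Rightarrow> _)"
    by (auto simp: transp_def L2_eq_def)
qed

instantiation L2 :: ("{real_inner,banach,second_countable_topology}") real_inner
begin

lift_definition zero_L2 :: "'a L2" is "\<lambda>x. 0"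
  by (simp add: L2_eq_def)

lift_definition plus_L2 :: "'a L2 \<Rightarrow> 'a L2 \<Rightarrow> 'a L2" is "\<lambda>f g x. f x + g x"
  by (auto simp: L2_eq_def intro: square_integrable_add)

lift_definition minus_L2 :: "'a L2 \<Rightarrow> 'a L2 \<Rightarrow> 'a L2" is "\<lambda>f g x. f x - g x"
  by (auto simp: L2_eq_def intro: square_integrable_diff)

lift_definition uminus_L2 :: "'a L2 \<Rightarrow> 'a L2" is "\<lambda>f x. - f x"
  by (auto simp: L2_eq_def intro: square_integrable_uminus)

lift_definition scaleR_L2 :: "real \<Rightarrow> 'a L2 \<Rightarrow> 'a L2" is "\<lambda>r f x. r *\<^sub>R f x"
  by (auto simp: L2_eq_def intro: square_integrable_scaleR)

lift_definition inner_L2 :: "'a L2 \<Rightarrow> 'a L2 \<Rightarrow> real" is "\<lambda>f g. \<integral>x. inner (f x) (g x) \<partial>lborel"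
proof -
  fix f f' g g' :: "real \<Rightarrow> 'a"
  assume "L2_eq f f'" "L2_eq g g'"
  then have [measurable]: "f \<in> borel_measurable lborel" "f' \<in> borel_measurable lborel"
      "g \<in> borel_measurable lborel" "g' \<in> borel_measurable lborel"
    and "AE x in lborel. f x = f' x" "AE x in lborel. g x = g' x"
    by (auto simp: L2_eq_def square_integrable_def)
  then show "(\<integral>x. inner (f x) (g x) \<partial>lborel) = (\<integral>x. inner (f' x) (g' x) \<partial>lborel)"
    by (intro integral_cong_AE) auto
qed

definition norm_L2 :: "'a L2 \<Rightarrow> real" where "norm_L2 u = sqrt (inner u u)"
definition sgn_L2 :: "'a L2 \<Rightarrow> 'a L2" where "sgn_L2 u = inverse (norm u) *\<^sub>R u"
definition dist_L2 :: "'a L2 \<Rightarrow> 'a L2 \<Rightarrow> real" where "dist_L2 u v = norm (u - v)"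
definition uniformity_L2 :: "('a L2 \<times> 'a L2) filter"
  where "uniformity_L2 = (INF e\<in>{0<..}. principal {(u, v). dist u v < e})"
definition open_L2 :: "'a L2 set \<Rightarrow> bool"
  where "open_L2 U \<longleftrightarrow> (\<forall>u\<in>U. eventually (\<lambda>(u', v). u' = u \<longrightarrow> v \<in> U) uniformity)"

instance
proof
  fix u v w :: "'a L2" and r s :: real and U :: "'a L2 set"
  show "u + v + w = u + (v + w)"
    by transfer (auto simp: L2_eq_def add.assoc intro!: square_integrable_add)
  show "u + v = v + u"
    by transfer (auto simp: L2_eq_def add.commute intro!: square_integrable_add)
  show "0 + u = u"
    by transfer (auto simp: L2_eq_def)
  show "- u + u = 0"
    by transfer (auto simp: L2_eq_def)
  show "u - v = u + - v"
    by transfer (auto simp: L2_eq_def intro!: square_integrable_diff)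
  show "r *\<^sub>R (u + v) = r *\<^sub>R u + r *\<^sub>R v"
    by transfer (auto simp: L2_eq_def scaleR_add_right
        intro!: square_integrable_add square_integrable_scaleR)
  show "(r + s) *\<^sub>R u = r *\<^sub>R u + s *\<^sub>R u"
    by transfer (auto simp: L2_eq_def scaleR_add_left
        intro!: square_integrable_add square_integrable_scaleR)
  show "r *\<^sub>R s *\<^sub>R u = (r * s) *\<^sub>R u"
    by transfer (auto simp: L2_eq_def intro!: square_integrable_scaleR)
  show "1 *\<^sub>R u = u"
    by transfer (auto simp: L2_eq_def)
  show "sgn u = inverse (norm u) *\<^sub>R u" "dist u v = norm (u - v)"
    "(uniformity :: ('a L2 \<times> 'a L2) filter) = (INF e\<in>{0<..}. principal {(u, v). dist u v < e})"
    "open U \<longleftrightarrow> (\<forall>u\<in>U. eventually (\<lambda>(u', v). u' = u \<longrightarrow> v \<in> U) uniformity)"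
    "norm u = sqrt (inner u u)"
    by (simp_all add: sgn_L2_def dist_L2_def uniformity_L2_def open_L2_def norm_L2_def)
  show "inner u v = inner v u"
    by transfer (simp add: inner_commute)
  show "inner (u + v) w = inner u w + inner v w"
    by transfer (simp add: L2_eq_def inner_add_left integrable_inner)
  show "inner (r *\<^sub>R u) v = r * inner u v"
    by transfer simp
  show "0 \<le> inner u u"
    by transfer simp
  show "inner u u = 0 \<longleftrightarrow> u = 0"
  proof transfer
    fix f :: "real \<Rightarrow> 'a"
    assume "L2_eq f f"
    then have f: "square_integrable f"
      by (simp add: L2_eq_def)
    have "(\<integral>x. inner (f x) (f x) \<partial>lborel) = 0 \<longleftrightarrow> (AE x in lborel. inner (f x) (f x) = 0)"
      by (rule integral_nonneg_eq_0_iff_AE) (auto intro: integrable_inner f)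
    then show "(\<integral>x. inner (f x) (f x) \<partial>lborel) = 0 \<longleftrightarrow> L2_eq f (\<lambda>x. 0)"
      by (simp add: L2_eq_def f)
  qed
qed

end

instantiation L2 :: ("{complex_inner,banach,second_countable_topology}") complex_inner
begin

lift_definition scaleC_L2 :: "complex \<Rightarrow> 'a L2 \<Rightarrow> 'a L2" is "\<lambda>c f x. c *\<^sub>C f x"
  by (auto simp: L2_eq_def intro: square_integrable_scaleC)

lift_definition cinner_L2 :: "'a L2 \<Rightarrow> 'a L2 \<Rightarrow> complex" is "\<lambda>f g. \<integral>x. cinner (f x) (g x) \<partial>lborel"
proof -
  fix f f' g g' :: "real \<Rightarrow> 'a"
  assume "L2_eq f f'" "L2_eq g g'"
  then have "(\<lambda>x. cinner (f x) (g x)) \<in> borel_measurable lborel"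
      "(\<lambda>x. cinner (f' x) (g' x)) \<in> borel_measurable lborel"
    and "AE x in lborel. f x = f' x" "AE x in lborel. g x = g' x"
    by (simp_all only: L2_eq_def borel_measurable_integrable[OF integrable_cinner])
  then show "(\<integral>x. cinner (f x) (g x) \<partial>lborel) = (\<integral>x. cinner (f' x) (g' x) \<partial>lborel)"
    by (intro integral_cong_AE) auto
qed

instance
proof
  fix u v w :: "'a L2" and c d :: complex and r :: real
  show "c *\<^sub>C (u + v) = c *\<^sub>C u + c *\<^sub>C v"
    by transfer (auto simp: L2_eq_def scaleC_add_right
        intro!: square_integrable_add square_integrable_scaleC)
  show "(c + d) *\<^sub>C u = c *\<^sub>C u + d *\<^sub>C u"
    by transfer (auto simp: L2_eq_def scaleC_add_left
        intro!: square_integrable_add square_integrable_scaleC)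
  show "c *\<^sub>C d *\<^sub>C u = (c * d) *\<^sub>C u"
    by transfer (auto simp: L2_eq_def scaleC_scaleC intro!: square_integrable_scaleC)
  show "complex_of_real r *\<^sub>C u = r *\<^sub>R u"
    by transfer (auto simp: L2_eq_def scaleC_of_real intro!: square_integrable_scaleR)
  show "cinner u v = cnj (cinner v u)"
  proof transfer
    fix f g :: "real \<Rightarrow> 'a"
    have "(\<integral>x. cinner (f x) (g x) \<partial>lborel) = (\<integral>x. cnj (cinner (g x) (f x)) \<partial>lborel)"
      by (simp add: cinner_commute[symmetric])
    then show "(\<integral>x. cinner (f x) (g x) \<partial>lborel) = cnj (\<integral>x. cinner (g x) (f x) \<partial>lborel)"
      by simp
  qed
  show "cinner (u + v) w = cinner u w + cinner v w"
    by transfer (simp add: L2_eq_def cinner_add_left integrable_cinner)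
  show "cinner (c *\<^sub>C u) v = c * cinner u v"
    by transfer (simp add: cinner_scaleC_left)
  show "Re (cinner u v) = inner u v"
    by transfer (simp add: L2_eq_def integrable_cinner integral_Re[symmetric] Re_cinner)
qed

end


section \<open>The operator\<close>

definition test_function :: "(real \<Rightarrow> real) \<Rightarrow> bool"
  where "test_function \<phi> \<longleftrightarrow>
    (\<forall>n x. (deriv ^^ n) \<phi> field_differentiable (at x)) \<and> compact (closure {x. \<phi> x \<noteq> 0})"

lift_definition weak_derivative ::
    "nat \<Rightarrow> 'a::{real_inner,banach,second_countable_topology} L2 \<Rightarrow> 'a L2 \<Rightarrow> bool"
  is "\<lambda>n u v. \<forall>\<phi>. test_function \<phi> \<longrightarrow>
    (\<integral>x. (deriv ^^ n) \<phi> x *\<^sub>R u x \<partial>lborel) = (- 1) ^ n *\<^sub>R (\<integral>x. \<phi> x *\<^sub>R v x \<partial>lborel)"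
proof -
  fix n and u u' v v' :: "real \<Rightarrow> 'a"
  assume uv: "L2_eq u u'" "L2_eq v v'"
  have [measurable]: "(deriv ^^ k) \<phi> \<in> borel_measurable lborel" if "test_function \<phi>" for k \<phi>
    using that unfolding test_function_def
    by (auto intro!: borel_measurable_continuous_onI continuous_at_imp_continuous_on
        field_differentiable_imp_continuous_at)
  have *: "(\<integral>x. (deriv ^^ k) \<phi> x *\<^sub>R w x \<partial>lborel) = (\<integral>x. (deriv ^^ k) \<phi> x *\<^sub>R w' x \<partial>lborel)"
    if "test_function \<phi>" "L2_eq w w'" for k \<phi> and w w' :: "real \<Rightarrow> 'a"
  proof -
    have [measurable]: "w \<in> borel_measurable lborel" "w' \<in> borel_measurable lborel"
      and "AE x in lborel. w x = w' x"
      using that by (auto simp: L2_eq_def square_integrable_def)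
    then show ?thesis
      using that(1) by (intro integral_cong_AE) auto
  qed
  show "(\<forall>\<phi>. test_function \<phi> \<longrightarrow>
      (\<integral>x. (deriv ^^ n) \<phi> x *\<^sub>R u x \<partial>lborel) = (- 1) ^ n *\<^sub>R (\<integral>x. \<phi> x *\<^sub>R v x \<partial>lborel)) \<longleftrightarrow>
    (\<forall>\<phi>. test_function \<phi> \<longrightarrow>
      (\<integral>x. (deriv ^^ n) \<phi> x *\<^sub>R u' x \<partial>lborel) = (- 1) ^ n *\<^sub>R (\<integral>x. \<phi> x *\<^sub>R v' x \<partial>lborel))"
    using *[OF _ uv(1), of _ n] *[OF _ uv(2), of _ 0] by simp
qed

definition H2 :: "'a::{real_inner,banach,second_countable_topology} L2 set"
  where "H2 = {u. (\<exists>v. weak_derivative 1 u v) \<and> (\<exists>w. weak_derivative 2 u w)}"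

definition graph_norm :: "('a::real_inner \<Rightarrow> 'a) \<Rightarrow> 'a \<Rightarrow> real"
  where "graph_norm B y = sqrt ((norm y)\<^sup>2 + (norm (B y))\<^sup>2)"

text \<open>Strong measurability into \<open>D\<close> with its graph norm: pointwise limit, in the graph norm, of
  \<open>D\<close>-valued simple functions.\<close>

definition graph_strongly_measurable :: "'a::real_inner set \<Rightarrow> ('a \<Rightarrow> 'a) \<Rightarrow> (real \<Rightarrow> 'a) \<Rightarrow> bool"
  where "graph_strongly_measurable D B f \<longleftrightarrow> (\<forall>x. f x \<in> D) \<and>
    (\<exists>s. (\<forall>n. simple_function lborel (s n) \<and> range (s n) \<subseteq> D) \<and>
         (\<forall>x. (\<lambda>n. graph_norm B (s n x - f x)) \<longlonglongrightarrow> 0))"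

text \<open>The subspace of classes with a representative that is strongly measurable and
  square-integrable as a map into \<open>D\<close> with its graph norm.\<close>

lift_definition in_L2_domain ::
    "'a::{real_inner,banach,second_countable_topology} set \<Rightarrow> ('a \<Rightarrow> 'a) \<Rightarrow> 'a L2 \<Rightarrow> bool"
  is "\<lambda>D B u. \<exists>f. (AE x in lborel. f x = u x) \<and> graph_strongly_measurable D B f \<and>
    integrable lborel (\<lambda>x. (graph_norm B (f x))\<^sup>2)"
proof -
  fix D and B :: "'a \<Rightarrow> 'a" and u v :: "real \<Rightarrow> 'a"
  assume "L2_eq u v"
  then have "AE x in lborel. u x = v x"
    by (simp add: L2_eq_def)
  then have "(AE x in lborel. f x = u x) \<longleftrightarrow> (AE x in lborel. f x = v x)" for f
    by (auto elim: eventually_elim2)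
  then show "(\<exists>f. (AE x in lborel. f x = u x) \<and> graph_strongly_measurable D B f \<and>
      integrable lborel (\<lambda>x. (graph_norm B (f x))\<^sup>2)) \<longleftrightarrow>
    (\<exists>f. (AE x in lborel. f x = v x) \<and> graph_strongly_measurable D B f \<and>
      integrable lborel (\<lambda>x. (graph_norm B (f x))\<^sup>2))"
    by simp
qed

lift_definition pointwise_image ::
    "'a::{real_inner,banach,second_countable_topology} set \<Rightarrow> ('a \<Rightarrow> 'a) \<Rightarrow> 'a L2 \<Rightarrow> 'a L2 \<Rightarrow> bool"
  is "\<lambda>D B u w. AE x in lborel. u x \<in> D \<and> w x = B (u x)"
proof -
  fix D and B :: "'a \<Rightarrow> 'a" and u u' w w' :: "real \<Rightarrow> 'a"
  assume "L2_eq u u'" "L2_eq w w'"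
  then have "AE x in lborel. u x = u' x \<and> w x = w' x"
    by (simp add: L2_eq_def)
  then show "(AE x in lborel. u x \<in> D \<and> w x = B (u x)) \<longleftrightarrow>
      (AE x in lborel. u' x \<in> D \<and> w' x = B (u' x))"
    by (auto elim: eventually_elim2)
qed

definition A_domain ::
    "'a::{real_inner,banach,second_countable_topology} set \<Rightarrow> ('a \<Rightarrow> 'a) \<Rightarrow> 'a L2 set"
  where "A_domain D B = H2 \<inter> {u. in_L2_domain D B u}"

text \<open>The two terms of \<open>A u\<close> make sense for \<open>u\<close> in the domain: each description below determines
  exactly one element of the Bochner space.\<close>

definition A_well_defined ::
    "'a::{real_inner,banach,second_countable_topology} set \<Rightarrow> ('a \<Rightarrow> 'a) \<Rightarrow> bool"
  where "A_well_defined D B \<longleftrightarrow>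
    (\<forall>u\<in>A_domain D B. (\<exists>!v. weak_derivative 2 u v) \<and> (\<exists>!w. pointwise_image D B u w))"

definition A_operator ::
    "'a::{real_inner,banach,second_countable_topology} set \<Rightarrow> ('a \<Rightarrow> 'a) \<Rightarrow> 'a L2 \<Rightarrow> 'a L2"
  where "A_operator D B u = - (THE v. weak_derivative 2 u v) + (THE w. pointwise_image D B u w)"


section \<open>Analytic semigroups\<close>

definition is_generator ::
    "(real \<Rightarrow> 'h \<Rightarrow> 'h) \<Rightarrow> 'h::real_normed_vector set \<Rightarrow> ('h \<Rightarrow> 'h) \<Rightarrow> bool"
  where "is_generator S D G \<longleftrightarrow>
    (\<forall>x y. ((\<lambda>t. (S t x - x) /\<^sub>R t) \<longlongrightarrow> y) (at_right 0) \<longleftrightarrow> x \<in> D \<and> y = G x)"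

definition C0_semigroup :: "(real \<Rightarrow> 'h \<Rightarrow> 'h::real_normed_vector) \<Rightarrow> bool"
  where "C0_semigroup S \<longleftrightarrow> (\<forall>t\<ge>0. bounded_linear (S t)) \<and> S 0 = id \<and>
    (\<forall>s\<ge>0. \<forall>t\<ge>0. S (s + t) = S s \<circ> S t) \<and> (\<forall>x. ((\<lambda>t. S t x) \<longlongrightarrow> x) (at_right 0))"

definition sector :: "real \<Rightarrow> complex set"
  where "sector \<delta> = {z. z \<noteq> 0 \<and> \<bar>Arg z\<bar> < \<delta>}"

definition bounded_clinear :: "(complex \<Rightarrow> 'h \<Rightarrow> 'h) \<Rightarrow> ('h::real_normed_vector \<Rightarrow> 'h) \<Rightarrow> bool"
  where "bounded_clinear sc L \<longleftrightarrow> bounded_linear L \<and> (\<forall>c x. L (sc c x) = sc c (L x))"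

text \<open>A complex space enters through its scalar multiplication \<open>sc\<close>.  Analyticity in the sector is
  meant in operator norm.\<close>

definition analytic_semigroup ::
    "(complex \<Rightarrow> 'h \<Rightarrow> 'h) \<Rightarrow> real \<Rightarrow> (complex \<Rightarrow> 'h \<Rightarrow> 'h::real_normed_vector) \<Rightarrow> bool"
  where "analytic_semigroup sc \<delta> T \<longleftrightarrow>
    T 0 = id \<and>
    (\<forall>z\<in>sector \<delta>. bounded_clinear sc (T z)) \<and>
    (\<forall>z\<in>sector \<delta>. \<forall>w\<in>sector \<delta>. T (z + w) = T z \<circ> T w) \<and>
    (\<forall>z\<in>sector \<delta>. \<exists>T'. bounded_clinear sc T' \<and>
      ((\<lambda>w. onorm (\<lambda>x. sc (1 / (w - z)) (T w x - T z x) - T' x)) \<longlongrightarrow> 0) (at z)) \<and>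
    (\<forall>x. ((\<lambda>z. T z x) \<longlongrightarrow> x) (at 0 within sector \<delta>))"

definition generates_analytic_semigroup_complex :: "'h::complex_inner set \<Rightarrow> ('h \<Rightarrow> 'h) \<Rightarrow> bool"
  where "generates_analytic_semigroup_complex D G \<longleftrightarrow>
    (\<exists>\<delta> T. 0 < \<delta> \<and> \<delta> \<le> pi / 2 \<and> analytic_semigroup scaleC \<delta> T \<and>
      is_generator (\<lambda>t. T (of_real t)) D G)"

text \<open>The complexification of a real space is the product with itself, \<open>(x, y)\<close> standing for
  \<open>x + \<i> y\<close>.\<close>

definition complexified_scale :: "complex \<Rightarrow> 'h \<times> 'h \<Rightarrow> 'h \<times> 'h::real_vector"
  where "complexified_scale c = (\<lambda>(x, y). (Re c *\<^sub>R x - Im c *\<^sub>R y, Re c *\<^sub>R y + Im c *\<^sub>R x))"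

definition complexified_operator :: "('h \<Rightarrow> 'h) \<Rightarrow> 'h \<times> 'h \<Rightarrow> 'h \<times> 'h"
  where "complexified_operator L = map_prod L L"

text \<open>On a real space: a semigroup whose complexification extends to an analytic semigroup
  generated by the complexified operator.\<close>

definition generates_analytic_semigroup_real :: "'h::real_inner set \<Rightarrow> ('h \<Rightarrow> 'h) \<Rightarrow> bool"
  where "generates_analytic_semigroup_real D G \<longleftrightarrow>
    (\<exists>S. C0_semigroup S \<and> is_generator S D G \<and>
      (\<exists>\<delta> T. 0 < \<delta> \<and> \<delta> \<le> pi / 2 \<and> analytic_semigroup complexified_scale \<delta> T \<and>
        (\<forall>t\<ge>0. T (of_real t) = complexified_operator (S t)) \<and>
        is_generator (\<lambda>t. T (of_real t)) (D \<times> D) (complexified_operator G)))"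

end

theory Submission
  imports Defs "HOL-Computational_Algebra.Polynomial"
begin

text \<open>
  The operator is the sum of \<open>L = - \<partial>\<^sup>2\<close> with domain \<open>H\<^sup>2\<close> and of the operator \<open>M\<close> that applies \<open>B\<close>
  pointwise, with domain \<open>L\<^sup>2(\<real>, D)\<close>.  Both are positive and self-adjoint, and they commute: the
  resolvents of \<open>M\<close> act on the values of a function and \<open>L\<close> acts on its argument.  Integration by
  parts gives \<open>\<langle>L u, M\<^sub>n u\<rangle> = \<langle>u', M\<^sub>n u'\<rangle> \<ge> 0\<close> for the bounded Yosida approximations \<open>M\<^sub>n\<close> of \<open>M\<close>,
  and in the limit \<open>\<langle>L u, M u\<rangle> \<ge> 0\<close>.  Hence \<open>\<parallel>L u\<parallel>\<close> is at most \<open>\<parallel>L u + M u\<parallel>\<close>, so \<open>L + M\<close> is closed on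
  the intersection of the domains.  If \<open>(y, z)\<close> lies in the graph of the adjoint of \<open>L + M\<close>, then the
  resolvents \<open>J\<^sub>n = (1 + M / n)\<inverse>\<close> give points \<open>(J\<^sub>n y, J\<^sub>n z)\<close> of the graph of \<open>L + M\<close> that converge to
  \<open>(y, z)\<close>.  So \<open>L + M\<close> is self-adjoint (\<open>positive_selfadjoint_sum\<close>, \<open>positive_selfadjoint_A\<close>).

  Self-adjointness of \<open>L\<close> and of \<open>M\<close> follows from the criterion \<open>positive_selfadjointI\<close>: a positive
  symmetric operator is self-adjoint if \<open>1 +\<close> the operator is onto.  For \<open>M\<close> the preimage is found
  with the resolvent of \<open>B\<close>.  For \<open>L\<close> it is found by projecting \<open>(f, 0)\<close> orthogonally to the graph of
  the weak derivative.  Symmetry of \<open>L\<close> is integration by parts for functions with a square-integrable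
  weak derivative (\<open>weak_derivative_by_parts\<close>).  By another orthogonal projection this reduces to the
  fact that \<open>w' = w\<close> and \<open>w' = - w\<close> have only the zero solution, which holds because
  \<open>h \<mapsto> \<langle>w, \<phi> (\<cdot> - h) e\<rangle>\<close> is then a bounded multiple of an exponential function.

  That a positive self-adjoint operator generates an analytic semigroup is a fact about Hilbert spaces
  (\<open>analytic_semigroup\<close>, \<open>semigroup_generator\<close>).  For a bounded positive operator \<open>P\<close> the semigroup
  \<open>exp (- z P)\<close> is given by the power series.  Energy estimates show that it consists of contractions
  for \<open>Re z \<ge> 0\<close> and that \<open>\<parallel>P exp (- z P) x\<parallel>\<close> is at most \<open>\<parallel>x\<parallel> / Re z\<close>.  These bounds do not depend
  on the norm of \<open>P\<close>, so contraction, semigroup law and differentiability in operator norm pass to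
  the limit along the Yosida approximations.

  Real and complex scalars are treated together, as a real Hilbert space with an isometry \<open>J\<close> such
  that \<open>J\<^sup>2 = - 1\<close>: on a complex space this is multiplication by \<open>\<i>\<close>, on the complexification of a real
  space it is \<open>(x, y) \<mapsto> (- y, x)\<close>.
\<close>

section \<open>Orthogonal projection in Hilbert spaces\<close>

lemma orthogonal_projection_exists:
  fixes S :: "'h::{real_inner,banach} set"
  assumes S: "subspace S" "closed S"
  shows "\<exists>p\<in>S. \<forall>s\<in>S. inner (x - p) s = 0"
proof -
  define d where "d = infdist x S"
  have "S \<noteq> {}"
    using S(1) subspace_0 by blast
  have d: "d \<le> norm (x - s)" if "s \<in> S" for s
    using infdist_le[OF that, of x] by (simp add: d_def dist_norm)
  have d0: "0 \<le> d"
    by (simp add: d_def infdist_nonneg)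
  have "\<exists>s\<in>S. norm (x - s) < d + 1 / Suc n" for n
  proof -
    have "(INF s\<in>S. dist x s) < d + 1 / Suc n"
      using \<open>S \<noteq> {}\<close> by (simp add: d_def infdist_notempty)
    then show ?thesis
      using cINF_less_iff[OF \<open>S \<noteq> {}\<close> bdd_belowI2[of S 0 "dist x"], of "d + 1 / Suc n"]
      by (simp add: dist_norm)
  qed
  then obtain s where s: "\<And>n. s n \<in> S" "\<And>n. norm (x - s n) < d + 1 / Suc n"
    by metis
  \<comment> \<open>The parallelogram identity, with the midpoint of two members of the sequence at distance at least \<open>d\<close>.\<close>
  have par: "(norm (s m - s n))\<^sup>2 \<le> 2 * (norm (x - s m))\<^sup>2 + 2 * (norm (x - s n))\<^sup>2 - 4 * d\<^sup>2" for m n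
  proof -
    have "(1/2) *\<^sub>R (s m + s n) \<in> S"
      using s(1) S(1) by (intro subspace_scale subspace_add)
    then have "d\<^sup>2 \<le> (norm (x - (1/2) *\<^sub>R (s m + s n)))\<^sup>2"
      using d d0 by (intro power_mono)
    moreover have "(norm (s m - s n))\<^sup>2 + 4 * (norm (x - (1/2) *\<^sub>R (s m + s n)))\<^sup>2
        = 2 * (norm (x - s m))\<^sup>2 + 2 * (norm (x - s n))\<^sup>2"
      by (simp add: power2_norm_eq_inner inner_simps inner_commute algebra_simps)
    ultimately show ?thesis by linarith
  qed
  have lim: "(\<lambda>n. norm (x - s n)) \<longlonglongrightarrow> d"
  proof (rule tendsto_sandwich[where f = "\<lambda>n. d" and h = "\<lambda>n. d + 1 / Suc n"])
    show "(\<lambda>n. d + 1 / Suc n) \<longlonglongrightarrow> d"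
      using tendsto_add[OF tendsto_const LIMSEQ_Suc[OF lim_1_over_n], of d] by simp
    show "(\<lambda>n. d) \<longlonglongrightarrow> d" by simp
    show "\<forall>\<^sub>F n in sequentially. d \<le> norm (x - s n)"
      by (intro always_eventually allI d s)
    show "\<forall>\<^sub>F n in sequentially. norm (x - s n) \<le> d + 1 / Suc n"
      by (intro always_eventually allI less_imp_le s)
  qed
  have "Cauchy s"
  proof (rule metric_CauchyI)
    fix e :: real assume e: "0 < e"
    have "(\<lambda>n. 2 * (norm (x - s n))\<^sup>2) \<longlonglongrightarrow> 2 * d\<^sup>2"
      by (intro tendsto_intros lim)
    from order_tendstoD(2)[OF this, of "2 * d\<^sup>2 + e\<^sup>2 / 2"] e
    obtain N where N: "\<And>n. n \<ge> N \<Longrightarrow> 2 * (norm (x - s n))\<^sup>2 < 2 * d\<^sup>2 + e\<^sup>2 / 2"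
      by (auto simp: eventually_sequentially)
    have "dist (s m) (s n) < e" if "m \<ge> N" "n \<ge> N" for m n
    proof -
      have "(norm (s m - s n))\<^sup>2 < e\<^sup>2"
        using par[of m n] N[OF that(1)] N[OF that(2)] by linarith
      then show ?thesis
        using e by (simp add: dist_norm power2_less_imp_less)
    qed
    then show "\<exists>M. \<forall>m\<ge>M. \<forall>n\<ge>M. dist (s m) (s n) < e" by blast
  qed
  then obtain p where p: "s \<longlonglongrightarrow> p"
    using Cauchy_convergent_iff convergent_def by blast
  have "p \<in> S"
    using closed_sequentially[OF S(2)] s(1) p by blast
  have np: "norm (x - p) = d"
    by (rule LIMSEQ_unique[OF _ lim]) (intro tendsto_intros p)
  have "inner (x - p) v = 0" if "v \<in> S" for v
  proof (cases "v = 0")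
    case False
    define t where "t = inner (x - p) v / (norm v)\<^sup>2"
    have "p + t *\<^sub>R v \<in> S"
      using \<open>p \<in> S\<close> that S(1) by (intro subspace_add subspace_scale)
    then have "d\<^sup>2 \<le> (norm (x - p - t *\<^sub>R v))\<^sup>2"
      using d[of "p + t *\<^sub>R v"] d0 by (intro power_mono) (auto simp: algebra_simps)
    also have "\<dots> = (norm (x - p))\<^sup>2 - 2 * t * inner (x - p) v + t\<^sup>2 * (norm v)\<^sup>2"
      unfolding power2_norm_eq_inner
      by (simp add: inner_simps inner_commute power2_eq_square algebra_simps)
    also have "\<dots> = d\<^sup>2 - (inner (x - p) v)\<^sup>2 / (norm v)\<^sup>2"
      using False by (simp add: np t_def field_simps power2_eq_square)
    finally have "(inner (x - p) v)\<^sup>2 / (norm v)\<^sup>2 \<le> 0" by simp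
    then show ?thesis
      using False by (simp add: divide_le_0_iff)
  qed simp
  with \<open>p \<in> S\<close> show ?thesis by blast
qed

lemma closure_of_subspace:
  fixes S :: "'h::real_normed_vector set"
  assumes S: "subspace S"
  shows "subspace (closure S)"
proof (rule subspaceI)
  show "0 \<in> closure S"
    using subspace_0[OF S] closure_subset by blast
next
  fix x y assume "x \<in> closure S" "y \<in> closure S"
  then obtain f g where "\<And>n. f n \<in> S" "f \<longlonglongrightarrow> x" "\<And>n. g n \<in> S" "g \<longlonglongrightarrow> y"
    unfolding closure_sequential by blast
  then show "x + y \<in> closure S"
    unfolding closure_sequential
    by (intro exI[of _ "\<lambda>n. f n + g n"]) (auto intro: tendsto_add subspace_add[OF S])
next
  fix c x assume "x \<in> closure S"
  then obtain f where "\<And>n. f n \<in> S" "f \<longlonglongrightarrow> x"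
    unfolding closure_sequential by blast
  then show "c *\<^sub>R x \<in> closure S"
    unfolding closure_sequential
    by (intro exI[of _ "\<lambda>n. c *\<^sub>R f n"]) (auto intro: tendsto_scaleR subspace_scale[OF S])
qed

lemma dense_subspaceI:
  fixes S :: "'h::{real_inner,banach} set"
  assumes S: "subspace S" and orth: "\<And>q. (\<And>s. s \<in> S \<Longrightarrow> inner q s = 0) \<Longrightarrow> q = 0"
  shows "closure S = UNIV"
proof -
  have "x \<in> closure S" for x
  proof -
    obtain p where p: "p \<in> closure S" "\<And>s. s \<in> closure S \<Longrightarrow> inner (x - p) s = 0"
      using orthogonal_projection_exists[of "closure S" x] closure_of_subspace[OF S] by auto
    then have "x - p = 0"
      using closure_subset by (intro orth) blast
    with p show ?thesis by simp
  qed
  then show ?thesis by blast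
qed


section \<open>Positive self-adjoint operators\<close>

lemma linear_operator_scaleR_iff:
  "linear_operator scaleR D A \<longleftrightarrow> subspace D \<and>
    (\<forall>x\<in>D. \<forall>y\<in>D. A (x + y) = A x + A y) \<and> (\<forall>c. \<forall>x\<in>D. A (c *\<^sub>R x) = c *\<^sub>R A x)"
  by (simp add: linear_operator_def subspace_raw_def)

locale positive_selfadjoint =
  fixes D :: "'h::{real_inner,banach} set" and A :: "'h \<Rightarrow> 'h"
  assumes selfadjoint: "self_adjoint scaleR inner D A"
    and positive: "x \<in> D \<Longrightarrow> 0 \<le> inner (A x) x"
begin

lemma subspace_D: "subspace D"
  and add: "\<And>x y. x \<in> D \<Longrightarrow> y \<in> D \<Longrightarrow> A (x + y) = A x + A y"
  and scale: "\<And>c x. x \<in> D \<Longrightarrow> A (c *\<^sub>R x) = c *\<^sub>R A x"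
  and dense: "closure D = UNIV"
  using selfadjoint by (auto simp: self_adjoint_def linear_operator_scaleR_iff)

lemma diff: "x \<in> D \<Longrightarrow> y \<in> D \<Longrightarrow> A (x - y) = A x - A y"
  using add[of x "- y"] scale[of y "- 1"] subspace_neg[OF subspace_D, of y] by simp

lemma zero: "A 0 = 0"
  using scale[OF subspace_0[OF subspace_D], of 0] by simp

lemma adjointI: "(\<And>x. x \<in> D \<Longrightarrow> inner (A x) y = inner x z) \<Longrightarrow> y \<in> D \<and> A y = z"
proof -
  assume "\<And>x. x \<in> D \<Longrightarrow> inner (A x) y = inner x z"
  then have "(y, z) \<in> operator_graph D A"
    using selfadjoint unfolding self_adjoint_def by (auto simp: adjoint_graph_def)
  then show ?thesis
    by (auto simp: operator_graph_def)
qed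

lemma symmetric: "x \<in> D \<Longrightarrow> y \<in> D \<Longrightarrow> inner (A x) y = inner x (A y)"
  using selfadjoint by (auto simp: self_adjoint_def adjoint_graph_def operator_graph_def set_eq_iff)

text \<open>Adjoints are closed, since inner products are continuous.\<close>

lemma closed_graph:
  assumes "\<And>n. X n \<in> D" "X \<longlonglongrightarrow> x" "(\<lambda>n. A (X n)) \<longlonglongrightarrow> z"
  shows "x \<in> D \<and> A x = z"
proof (rule adjointI)
  fix y assume y: "y \<in> D"
  have "(\<lambda>n. inner (A y) (X n)) \<longlonglongrightarrow> inner (A y) x"
    by (intro tendsto_intros assms)
  moreover have "(\<lambda>n. inner (A y) (X n)) \<longlonglongrightarrow> inner y z"
    using assms(1) y by (simp add: symmetric tendsto_inner[OF tendsto_const assms(3)])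
  ultimately show "inner (A y) x = inner y z"
    by (rule LIMSEQ_unique)
qed

lemma norm_shift_ge:
  assumes "x \<in> D" "0 < l"
  shows "l * norm x \<le> norm (l *\<^sub>R x + A x)"
proof -
  have "l * norm x * norm x \<le> inner (l *\<^sub>R x + A x) x"
    using positive[OF assms(1)] by (simp add: inner_simps power2_norm_eq_inner[symmetric] power2_eq_square)
  also have "\<dots> \<le> norm (l *\<^sub>R x + A x) * norm x"
    by (rule norm_cauchy_schwarz)
  finally show ?thesis
    by (cases "x = 0") auto
qed

text \<open>The range of \<open>l + A\<close> is closed because \<open>l + A\<close> is bounded below and \<open>A\<close> is closed.  It is
  dense because a vector \<open>y\<close> orthogonal to it satisfies \<open>A y = - l y\<close> by self-adjointness, which
  positivity permits only for \<open>y = 0\<close>.\<close>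

lemma shift_surj:
  assumes l: "0 < l"
  shows "\<exists>x\<in>D. l *\<^sub>R x + A x = y"
proof -
  let ?S = "(\<lambda>x. l *\<^sub>R x + A x) ` D"
  have "subspace ?S"
  proof (rule subspaceI)
    show "0 \<in> ?S"
      using subspace_0[OF subspace_D] zero by force
  next
    fix u v assume "u \<in> ?S" "v \<in> ?S"
    then obtain x y where xy: "x \<in> D" "y \<in> D" "u = l *\<^sub>R x + A x" "v = l *\<^sub>R y + A y" by blast
    then have "u + v = l *\<^sub>R (x + y) + A (x + y)"
      by (simp add: add algebra_simps)
    then show "u + v \<in> ?S"
      using xy subspace_add[OF subspace_D] by blast
  next
    fix c u assume "u \<in> ?S"
    then obtain x where x: "x \<in> D" "u = l *\<^sub>R x + A x" by blast
    then have "c *\<^sub>R u = l *\<^sub>R (c *\<^sub>R x) + A (c *\<^sub>R x)"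
      by (simp add: scale algebra_simps)
    then show "c *\<^sub>R u \<in> ?S"
      using x subspace_scale[OF subspace_D] by blast
  qed
  have "closed ?S"
    unfolding closed_sequential_limits
  proof (intro allI impI, elim conjE)
    fix f y assume f: "\<forall>n. f n \<in> ?S" and lim: "f \<longlonglongrightarrow> y"
    then obtain X where X: "\<And>n. X n \<in> D" "\<And>n. f n = l *\<^sub>R X n + A (X n)"
      unfolding image_iff by metis
    have "Cauchy X"
    proof (rule metric_CauchyI)
      fix e :: real assume "0 < e"
      moreover have "Cauchy f"
        using lim by (rule LIMSEQ_imp_Cauchy)
      ultimately obtain M where M: "\<And>m n. m \<ge> M \<Longrightarrow> n \<ge> M \<Longrightarrow> dist (f m) (f n) < l * e"
        using l metric_CauchyD[of f "l * e"] by auto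
      have "dist (X m) (X n) < e" if "m \<ge> M" "n \<ge> M" for m n
      proof -
        have "l * norm (X m - X n) \<le> norm (l *\<^sub>R (X m - X n) + A (X m - X n))"
          by (intro norm_shift_ge l subspace_diff[OF subspace_D] X)
        also have "l *\<^sub>R (X m - X n) + A (X m - X n) = f m - f n"
          by (simp add: X diff algebra_simps)
        also have "norm \<dots> < l * e"
          using M[OF that] by (simp add: dist_norm)
        finally show ?thesis
          using l by (simp add: dist_norm)
      qed
      then show "\<exists>M. \<forall>m\<ge>M. \<forall>n\<ge>M. dist (X m) (X n) < e" by blast
    qed
    then obtain x where x: "X \<longlonglongrightarrow> x"
      using Cauchy_convergent_iff convergent_def by blast
    have "(\<lambda>n. f n - l *\<^sub>R X n) \<longlonglongrightarrow> y - l *\<^sub>R x"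
      by (intro tendsto_intros lim x)
    then have "(\<lambda>n. A (X n)) \<longlonglongrightarrow> y - l *\<^sub>R x"
      by (simp add: X)
    from closed_graph[OF X(1) x this] show "y \<in> ?S"
      by (auto simp: image_iff intro!: bexI[of _ x])
  qed
  then have "?S = closure ?S" by simp
  also have "\<dots> = UNIV"
  proof (rule dense_subspaceI[OF \<open>subspace ?S\<close>])
    fix q assume q: "\<And>s. s \<in> ?S \<Longrightarrow> inner q s = 0"
    have "q \<in> D \<and> A q = - l *\<^sub>R q"
    proof (rule adjointI)
      fix x assume "x \<in> D"
      then have "inner q (l *\<^sub>R x + A x) = 0" by (intro q) blast
      then show "inner (A x) q = inner x (- l *\<^sub>R q)"
        by (simp add: inner_simps inner_commute)
    qed
    then have "0 \<le> - l * inner q q"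
      using positive[of q] by simp
    with l have "inner q q \<le> 0"
      by (simp add: mult_le_0_iff)
    then show "q = 0"
      by (metis inner_eq_zero_iff inner_ge_zero order_antisym)
  qed
  finally have "y \<in> ?S" by simp
  then show ?thesis
    unfolding image_iff by metis
qed

lemma shift_inj:
  assumes "0 < l" "x \<in> D" "y \<in> D" "l *\<^sub>R x + A x = l *\<^sub>R y + A y"
  shows "x = y"
proof -
  have "l *\<^sub>R (x - y) + A (x - y) = 0"
    using assms by (simp add: diff algebra_simps)
  then have "l * norm (x - y) \<le> 0"
    using norm_shift_ge[OF subspace_diff[OF subspace_D assms(2,3)] assms(1)] by simp
  then show ?thesis
    using assms(1) by (simp add: mult_le_0_iff)
qed

definition resolvent :: "real \<Rightarrow> 'h \<Rightarrow> 'h"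
  where "resolvent l y = (THE x. x \<in> D \<and> l *\<^sub>R x + A x = y)"

lemma resolvent:
  assumes "0 < l"
  shows "resolvent l y \<in> D \<and> l *\<^sub>R resolvent l y + A (resolvent l y) = y"
proof -
  have "\<exists>!x. x \<in> D \<and> l *\<^sub>R x + A x = y"
    using shift_surj[OF assms, of y] shift_inj[OF assms] by blast
  then show ?thesis
    unfolding resolvent_def by (rule theI')
qed

lemma resolvent_in_D: "0 < l \<Longrightarrow> resolvent l y \<in> D"
  and A_resolvent: "0 < l \<Longrightarrow> A (resolvent l y) = y - l *\<^sub>R resolvent l y"
  using resolvent[of l y] by (auto simp: algebra_simps eq_diff_eq)

lemma resolvent_eqI: "0 < l \<Longrightarrow> x \<in> D \<Longrightarrow> l *\<^sub>R x + A x = y \<Longrightarrow> resolvent l y = x"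
  using shift_inj resolvent by blast

lemma norm_resolvent: "0 < l \<Longrightarrow> l * norm (resolvent l y) \<le> norm y"
  using norm_shift_ge[of "resolvent l y" l] resolvent[of l y] by simp

lemma bounded_linear_resolvent:
  assumes l: "0 < l"
  shows "bounded_linear (resolvent l)"
proof (rule bounded_linear_intro[where K = "1 / l"])
  fix x y r
  show "resolvent l (x + y) = resolvent l x + resolvent l y"
    using l resolvent_in_D[OF l] subspace_add[OF subspace_D]
    by (intro resolvent_eqI) (auto simp: add A_resolvent algebra_simps)
  show "resolvent l (r *\<^sub>R x) = r *\<^sub>R resolvent l x"
    using l resolvent_in_D[OF l] subspace_scale[OF subspace_D]
    by (intro resolvent_eqI) (auto simp: scale A_resolvent algebra_simps)
  show "norm (resolvent l x) \<le> norm x * (1 / l)"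
    using norm_resolvent[OF l, of x] l by (simp add: field_simps)
qed

lemma resolvent_symmetric:
  assumes l: "0 < l"
  shows "inner (resolvent l x) y = inner x (resolvent l y)"
proof -
  let ?u = "resolvent l x" and ?v = "resolvent l y"
  have "inner ?u (l *\<^sub>R ?v + A ?v) = inner (l *\<^sub>R ?u + A ?u) ?v"
    using symmetric[OF resolvent_in_D resolvent_in_D, OF l l, of x y]
    by (simp add: inner_simps)
  then show ?thesis
    using resolvent[OF l] by simp
qed

lemma resolvent_A: "0 < l \<Longrightarrow> x \<in> D \<Longrightarrow> resolvent l (A x) = x - l *\<^sub>R resolvent l x"
proof -
  assume l: "0 < l" and x: "x \<in> D"
  have "resolvent l (l *\<^sub>R x + A x) = x"
    using l x by (intro resolvent_eqI) auto
  then show ?thesis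
    using bounded_linear_resolvent[OF l]
    by (simp add: linear_simps algebra_simps eq_diff_eq)
qed

lemma resolvent_commute:
  assumes l: "0 < l" and R: "linear R" "\<And>x. x \<in> D \<Longrightarrow> R x \<in> D \<and> A (R x) = R (A x)"
  shows "resolvent l (R y) = R (resolvent l y)"
proof (rule resolvent_eqI[OF l])
  show "R (resolvent l y) \<in> D"
    using R(2) resolvent_in_D[OF l] by blast
  show "l *\<^sub>R R (resolvent l y) + A (R (resolvent l y)) = R y"
    using R(2)[OF resolvent_in_D[OF l, of y]] A_resolvent[OF l, of y] R(1)
    by (simp add: linear_diff linear_scale)
qed

text \<open>The approximations \<open>(1 + A / n)\<inverse>\<close> of the identity and the Yosida approximations
  \<open>A (1 + A / n)\<inverse>\<close> of \<open>A\<close>, with \<open>n + 1\<close> in place of \<open>n\<close>.\<close>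

definition approx_id :: "nat \<Rightarrow> 'h \<Rightarrow> 'h"
  where "approx_id n y = real (Suc n) *\<^sub>R resolvent (real (Suc n)) y"

definition yosida :: "nat \<Rightarrow> 'h \<Rightarrow> 'h"
  where "yosida n y = real (Suc n) *\<^sub>R (y - approx_id n y)"

lemma approx_id_in_D: "approx_id n y \<in> D"
  unfolding approx_id_def by (intro subspace_scale[OF subspace_D] resolvent_in_D) simp

lemma A_approx_id: "A (approx_id n y) = yosida n y"
  unfolding approx_id_def yosida_def
  by (subst scale) (simp_all add: resolvent_in_D A_resolvent del: of_nat_Suc)

lemma approx_id_A: "x \<in> D \<Longrightarrow> approx_id n (A x) = yosida n x"
  unfolding approx_id_def yosida_def by (simp add: resolvent_A del: of_nat_Suc)

lemma bounded_linear_approx_id: "bounded_linear (approx_id n)"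
  unfolding approx_id_def
  by (intro bounded_linear_const_scaleR bounded_linear_resolvent) simp

lemma bounded_linear_yosida: "bounded_linear (yosida n)"
  unfolding yosida_def
  by (intro bounded_linear_const_scaleR bounded_linear_sub bounded_linear_ident bounded_linear_approx_id)

lemma norm_approx_id: "norm (approx_id n y) \<le> norm y"
  using norm_resolvent[of "real (Suc n)" y] by (simp add: approx_id_def)

lemma approx_id_symmetric: "inner (approx_id n x) y = inner x (approx_id n y)"
  by (simp add: approx_id_def resolvent_symmetric del: of_nat_Suc)

lemma yosida_symmetric: "inner (yosida n x) y = inner x (yosida n y)"
  by (simp add: yosida_def inner_simps approx_id_symmetric)

lemma yosida_positive: "0 \<le> inner (yosida n x) x"
proof -
  have "inner (approx_id n x) x \<le> norm (approx_id n x) * norm x"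
    by (rule norm_cauchy_schwarz)
  also have "\<dots> \<le> norm x * norm x"
    by (intro mult_right_mono norm_approx_id) simp
  also have "\<dots> = inner x x"
    by (simp add: power2_norm_eq_inner[symmetric] power2_eq_square)
  finally show ?thesis
    by (simp add: yosida_def inner_diff_left)
qed

lemma norm_yosida_le: "x \<in> D \<Longrightarrow> norm (yosida n x) \<le> norm (A x)"
  by (simp add: approx_id_A[symmetric] norm_approx_id)

text \<open>On the domain the error is \<open>(1 / n) A\<^sub>n x\<close> with the Yosida approximation \<open>A\<^sub>n\<close>, and \<open>\<parallel>A\<^sub>n x\<parallel> \<le> \<parallel>A x\<parallel>\<close>.
  The contraction property extends the convergence to the closure of the domain.\<close>

lemma approx_id_tendsto: "(\<lambda>n. approx_id n y) \<longlonglongrightarrow> y"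
proof (rule metric_LIMSEQ_I)
  fix e :: real assume e: "0 < e"
  have "y \<in> closure D" by (simp add: dense)
  then obtain x where x: "x \<in> D" "dist x y < e / 3"
    using closure_approachable[of y D] e by (metis divide_pos_pos zero_less_numeral)
  obtain N where N: "norm (A x) / real (Suc N) < e / 3"
  proof -
    have "(\<lambda>n. norm (A x) * (1 / real (Suc n))) \<longlonglongrightarrow> norm (A x) * 0"
      by (intro tendsto_intros LIMSEQ_Suc[OF lim_1_over_n])
    then have "\<forall>\<^sub>F n in sequentially. norm (A x) * (1 / real (Suc n)) < e / 3"
      using e by (intro order_tendstoD) auto
    then show ?thesis
      using that by (auto simp: eventually_sequentially)
  qed
  have "dist (approx_id n y) y < e" if "n \<ge> N" for n
  proof -
    have "x - approx_id n x = (1 / real (Suc n)) *\<^sub>R yosida n x"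
      by (simp add: yosida_def)
    then have "norm (x - approx_id n x) = norm (yosida n x) / real (Suc n)"
      by simp
    also have "\<dots> \<le> norm (A x) / real (Suc N)"
      using that by (intro frac_le norm_yosida_le x) auto
    also note N
    finally have 1: "norm (x - approx_id n x) < e / 3" .
    have 2: "norm (approx_id n (y - x)) \<le> norm (y - x)"
      by (rule norm_approx_id)
    have eq: "approx_id n y - y = approx_id n (y - x) - (x - approx_id n x) - (y - x)"
      using bounded_linear_approx_id[of n] by (simp add: linear_simps)
    have "norm (approx_id n y - y) \<le> norm (approx_id n (y - x)) + norm (x - approx_id n x) + norm (y - x)"
      unfolding eq by (meson add_right_mono norm_triangle_ineq4 order_trans)
    then show ?thesis
      using 1 2 x(2) by (simp add: dist_norm norm_minus_commute)
  qed
  then show "\<exists>N. \<forall>n\<ge>N. dist (approx_id n y) y < e" by blast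
qed

lemma yosida_tendsto: "x \<in> D \<Longrightarrow> (\<lambda>n. yosida n x) \<longlonglongrightarrow> A x"
  by (simp add: approx_id_A[symmetric] approx_id_tendsto)

lemma yosida_commute:
  assumes "linear R" "\<And>x. x \<in> D \<Longrightarrow> R x \<in> D \<and> A (R x) = R (A x)"
  shows "yosida n (R y) = R (yosida n y)"
  using assms resolvent_commute[of "real (Suc n)" R y]
  by (simp add: yosida_def approx_id_def linear_diff linear_scale del: of_nat_Suc)

lemma yosida_yosida_commute: "yosida m (yosida n y) = yosida n (yosida m y)"
proof (rule yosida_commute[symmetric])
  show "linear (yosida m)"
    using bounded_linear_yosida by (rule bounded_linear.linear)
  fix x assume x: "x \<in> D"
  have "yosida m x \<in> D"
    unfolding yosida_def
    by (intro subspace_scale subspace_diff subspace_D x approx_id_in_D)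
  moreover have "A (yosida m x) = yosida m (A x)"
    unfolding yosida_def
    using x by (simp add: scale diff subspace_diff subspace_D approx_id_in_D A_approx_id
        approx_id_A[symmetric] del: of_nat_Suc)
  ultimately show "yosida m x \<in> D \<and> A (yosida m x) = yosida m (A x)" ..
qed

end

text \<open>Symmetry gives half of self-adjointness, and surjectivity of \<open>1 + A\<close> the other half: if
  \<open>(y, z)\<close> lies in the graph of the adjoint, then \<open>y + z = u + A u\<close> for some \<open>u\<close> in the domain, and
  \<open>y - u\<close> is orthogonal to the range of \<open>1 + A\<close>.\<close>

lemma positive_selfadjointI:
  fixes D :: "'h::{real_inner,banach} set"
  assumes lin: "linear_operator scaleR D A"
    and sym: "\<And>x y. x \<in> D \<Longrightarrow> y \<in> D \<Longrightarrow> inner (A x) y = inner x (A y)"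
    and pos: "\<And>x. x \<in> D \<Longrightarrow> 0 \<le> inner (A x) x"
    and surj: "\<And>y. \<exists>x\<in>D. x + A x = y"
  shows "positive_selfadjoint D A"
proof (rule positive_selfadjoint.intro[OF _ pos])
  have D: "subspace D"
    using lin by (simp add: linear_operator_scaleR_iff)
  have "closure D = UNIV"
  proof (rule dense_subspaceI[OF D])
    fix q assume q: "\<And>s. s \<in> D \<Longrightarrow> inner q s = 0"
    obtain v where v: "v \<in> D" "v + A v = q" using surj by blast
    have "inner (v + A v) v = 0"
      using q v by blast
    then have "inner v v \<le> 0"
      using pos[OF v(1)] by (simp add: inner_add_left)
    then have "v = 0"
      by (metis inner_eq_zero_iff inner_ge_zero order_antisym)
    then show "q = 0"
      using v lin subspace_0[OF D] by (metis add_0 linear_operator_scaleR_iff scaleR_zero_left)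
  qed
  moreover have "adjoint_graph inner D A = operator_graph D A"
  proof (intro equalityI subsetI)
    fix p assume "p \<in> adjoint_graph inner D A"
    then obtain y z where p: "p = (y, z)" and yz: "\<And>x. x \<in> D \<Longrightarrow> inner (A x) y = inner x z"
      by (auto simp: adjoint_graph_def)
    obtain u where u: "u \<in> D" "u + A u = y + z" using surj by blast
    obtain x where x: "x \<in> D" "x + A x = y - u" using surj by blast
    have "inner (x + A x) (y - u) = inner x (y + z) - inner x (u + A u)"
      using yz[OF x(1)] sym[OF x(1) u(1)] by (simp add: inner_simps)
    then have "inner (y - u) (y - u) = 0"
      using u x by simp
    then have "y = u" by simp
    then have "z = A y" using u by simp
    then show "p \<in> operator_graph D A"
      using u p \<open>y = u\<close> by (auto simp: operator_graph_def)
  qed (auto simp: adjoint_graph_def operator_graph_def sym)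
  ultimately show "self_adjoint scaleR inner D A"
    using lin by (simp add: self_adjoint_def)
qed

text \<open>Applying the resolvents of \<open>M\<close> to an element \<open>(y, z)\<close> of the graph of the adjoint of \<open>L + M\<close> gives
  elements of the graph of \<open>L + M\<close> that converge to \<open>(y, z)\<close>.  The graph of \<open>L + M\<close> is closed because
  \<open>\<langle>L u, M u\<rangle> \<ge> 0\<close> makes both \<open>L u\<close> and \<open>M u\<close> no larger than \<open>L u + M u\<close>.\<close>

lemma positive_selfadjoint_sum:
  assumes L: "positive_selfadjoint DL L" and M: "positive_selfadjoint DM M"
    and comm: "\<And>n x. x \<in> DL \<Longrightarrow> positive_selfadjoint.approx_id DM M n x \<in> DL \<and>
      L (positive_selfadjoint.approx_id DM M n x) = positive_selfadjoint.approx_id DM M n (L x)"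
    and cross: "\<And>n x. x \<in> DL \<Longrightarrow> 0 \<le> inner (L x) (positive_selfadjoint.yosida DM M n x)"
  shows "positive_selfadjoint (DL \<inter> DM) (\<lambda>x. L x + M x)"
proof -
  interpret L: positive_selfadjoint DL L by (rule L)
  interpret M: positive_selfadjoint DM M by (rule M)
  let ?D = "DL \<inter> DM" and ?A = "\<lambda>x. L x + M x"
  have D: "subspace ?D"
    using L.subspace_D M.subspace_D by (rule subspace_inter)
  have cross': "0 \<le> inner (L x) (M x)" if "x \<in> ?D" for x
  proof (rule LIMSEQ_le_const)
    show "(\<lambda>n. inner (L x) (M.yosida n x)) \<longlonglongrightarrow> inner (L x) (M x)"
      using that by (intro tendsto_inner tendsto_const M.yosida_tendsto) auto
  qed (use that cross in auto)
  have bound: "norm (L x) \<le> norm (?A x)" if "x \<in> ?D" for x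
  proof (rule power2_le_imp_le)
    show "(norm (L x))\<^sup>2 \<le> (norm (?A x))\<^sup>2"
      using cross'[OF that] inner_ge_zero[of "M x"]
      by (simp add: power2_norm_eq_inner inner_simps inner_commute del: inner_ge_zero)
  qed simp
  have dense: "closure ?D = UNIV"
  proof -
    have "x \<in> closure ?D" if "x \<in> DL" for x
      unfolding closure_sequential
      using that comm M.approx_id_in_D M.approx_id_tendsto
      by (intro exI[of _ "\<lambda>n. M.approx_id n x"]) auto
    then have "closure DL \<subseteq> closure ?D"
      by (intro closure_minimal) auto
    then show ?thesis
      using L.dense by auto
  qed
  have "adjoint_graph inner ?D ?A = operator_graph ?D ?A"
  proof (intro equalityI subsetI)
    fix p assume "p \<in> adjoint_graph inner ?D ?A"
    then obtain y z where p: "p = (y, z)" and yz: "\<And>x. x \<in> ?D \<Longrightarrow> inner (?A x) y = inner x z"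
      by (auto simp: adjoint_graph_def)
    define Y where "Y = (\<lambda>n. M.approx_id n y)"
    have Y: "Y n \<in> DL \<and> L (Y n) = M.approx_id n z - M.yosida n y" for n
    proof (rule L.adjointI)
      fix x assume x: "x \<in> DL"
      have "inner (L (M.approx_id n x) + M (M.approx_id n x)) y = inner (M.approx_id n x) z"
        using comm[OF x] M.approx_id_in_D by (intro yz) auto
      then show "inner (L x) (Y n) = inner x (M.approx_id n z - M.yosida n y)"
        using comm[OF x]
        by (simp add: Y_def M.A_approx_id M.approx_id_symmetric M.yosida_symmetric inner_simps)
    qed
    have YD: "Y n \<in> ?D" for n
      using Y M.approx_id_in_D by (simp add: Y_def)
    have AY: "?A (Y n) = M.approx_id n z" for n
      using Y by (simp add: Y_def M.A_approx_id)
    have limY: "Y \<longlonglongrightarrow> y"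
      unfolding Y_def by (rule M.approx_id_tendsto)
    have limAY: "(\<lambda>n. ?A (Y n)) \<longlonglongrightarrow> z"
      unfolding AY by (rule M.approx_id_tendsto)
    have "Cauchy (\<lambda>n. L (Y n))"
    proof (rule metric_CauchyI)
      fix e :: real assume "0 < e"
      with LIMSEQ_imp_Cauchy[OF limAY]
      obtain N where N: "\<And>m n. m \<ge> N \<Longrightarrow> n \<ge> N \<Longrightarrow> dist (?A (Y m)) (?A (Y n)) < e"
        using metric_CauchyD by blast
      have "dist (L (Y m)) (L (Y n)) \<le> dist (?A (Y m)) (?A (Y n))" for m n
        using bound[OF subspace_diff[OF D YD YD], of m n] YD
        by (simp add: dist_norm L.diff M.diff algebra_simps)
      with N show "\<exists>N. \<forall>m\<ge>N. \<forall>n\<ge>N. dist (L (Y m)) (L (Y n)) < e"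
        by (meson le_less_trans)
    qed
    then obtain v where v: "(\<lambda>n. L (Y n)) \<longlonglongrightarrow> v"
      using Cauchy_convergent_iff convergent_def by blast
    have "(\<lambda>n. ?A (Y n) - L (Y n)) \<longlonglongrightarrow> z - v"
      by (intro tendsto_intros limAY v)
    then have w: "(\<lambda>n. M (Y n)) \<longlonglongrightarrow> z - v"
      by simp
    show "p \<in> operator_graph ?D ?A"
      using L.closed_graph[OF _ limY v] M.closed_graph[OF _ limY w] YD p
      by (auto simp: operator_graph_def)
  qed (auto simp: adjoint_graph_def operator_graph_def L.symmetric M.symmetric inner_simps)
  then have "self_adjoint scaleR inner ?D ?A"
    using D dense by (simp add: self_adjoint_def linear_operator_scaleR_iff L.add M.add L.scale
        M.scale algebra_simps)
  then show ?thesis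
    by (rule positive_selfadjoint.intro) (simp add: inner_add_left L.positive M.positive)
qed


section \<open>Complex structures on real Hilbert spaces\<close>

text \<open>A real Hilbert space with an isometric multiplication by \<open>\<i>\<close>.  This covers both complex
  Hilbert spaces and complexifications of real ones.\<close>

locale complex_structure =
  fixes J :: "'h::{real_inner,banach} \<Rightarrow> 'h"
  assumes linear_J: "linear J"
    and J_J: "J (J x) = - x"
    and inner_J_J: "inner (J x) (J y) = inner x y"
begin

definition sc :: "complex \<Rightarrow> 'h \<Rightarrow> 'h"
  where "sc c x = Re c *\<^sub>R x + Im c *\<^sub>R J x"

lemma inner_J_left: "inner (J x) y = - inner x (J y)"
  using inner_J_J[of x "J y"] by (simp add: J_J)

lemma inner_J_self [simp]: "inner x (J x) = 0" "inner (J x) x = 0"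
  using inner_J_left[of x x] by (simp_all add: inner_commute)

lemma norm_sc [simp]: "norm (sc c x) = cmod c * norm x"
proof -
  have "(norm (sc c x))\<^sup>2 = (cmod c * norm x)\<^sup>2"
    unfolding power_mult_distrib cmod_power2 power2_norm_eq_inner[where 'a = 'h]
    by (simp add: sc_def inner_simps inner_J_J power2_eq_square algebra_simps)
  then show ?thesis
    by (rule power2_eq_imp_eq) simp_all
qed

lemma bounded_linear_J: "bounded_linear J"
proof (rule bounded_linear_intro[where K = 1])
  show "norm (J x) \<le> norm x * 1" for x
    by (simp add: norm_eq_sqrt_inner inner_J_J)
qed (use linear_J in \<open>simp_all add: linear_add linear_scale\<close>)

lemma sc_add_right: "sc c (x + y) = sc c x + sc c y"
  and sc_add_left: "sc (c + d) x = sc c x + sc d x"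
  and sc_scaleR_right: "sc c (r *\<^sub>R x) = r *\<^sub>R sc c x"
  and sc_minus_left: "sc (- c) x = - sc c x"
  and sc_minus_right: "sc c (- x) = - sc c x"
  and sc_diff_right: "sc c (x - y) = sc c x - sc c y"
  using linear_J by (simp_all add: sc_def linear_add linear_diff linear_neg linear_scale algebra_simps)

lemma sc_of_real [simp]: "sc (of_real r) x = r *\<^sub>R x"
  and sc_zero_left [simp]: "sc 0 x = 0"
  and sc_zero_right [simp]: "sc c 0 = 0"
  and sc_one [simp]: "sc 1 x = x"
  using linear_J by (simp_all add: sc_def linear_0)

lemma sc_sc: "sc c (sc d x) = sc (c * d) x"
  using linear_J by (simp add: sc_def linear_add linear_scale J_J algebra_simps)

lemma bounded_linear_sc_left: "bounded_linear (\<lambda>c. sc c x)"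
  by (rule bounded_linear_intro[where K = "norm x"])
    (simp_all add: sc_add_left, simp add: sc_def algebra_simps)

lemma bounded_linear_sc: "bounded_linear (sc c)"
  by (rule bounded_linear_intro[where K = "cmod c"])
    (simp_all add: sc_add_right sc_scaleR_right)

lemma linear_sc_commute:
  "linear R \<Longrightarrow> (\<And>x. R (J x) = J (R x)) \<Longrightarrow> R (sc c x) = sc c (R x)"
  by (simp add: sc_def linear_add linear_scale)

end


section \<open>The exponential of a bounded positive operator\<close>

lemma inner_has_real_derivative:
  assumes "(u has_vector_derivative u') (at t)" "(v has_vector_derivative v') (at t)"
  shows "((\<lambda>t. inner (u t) (v t)) has_real_derivative inner (u t) v' + inner u' (v t)) (at t)"
  unfolding has_field_derivative_def
  by (rule has_derivative_eq_rhs[OF has_derivative_inner[OF assms[unfolded has_vector_derivative_def]]])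
    (auto simp: fun_eq_iff distrib_left distrib_right)

text \<open>The derivative of \<open>\<parallel>u\<parallel>\<close> is \<open>\<langle>u', u\<rangle> / \<parallel>u\<parallel> \<le> c\<close>.  A small constant under the square root
  avoids the origin, where the norm is not differentiable.\<close>

lemma norm_growth_bound:
  fixes u :: "real \<Rightarrow> 'h::real_inner"
  assumes u: "\<And>t. 0 \<le> t \<Longrightarrow> t \<le> 1 \<Longrightarrow> (u has_vector_derivative u' t) (at t)"
    and c: "\<And>t. 0 \<le> t \<Longrightarrow> t \<le> 1 \<Longrightarrow> inner (u' t) (u t) \<le> c * norm (u t)" "0 \<le> c"
  shows "norm (u 1) \<le> norm (u 0) + c"
proof (rule field_le_epsilon)
  fix e :: real assume e: "0 < e"
  define f where "f t = sqrt (inner (u t) (u t) + e\<^sup>2) - c * t" for t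
  have pos: "0 < inner (u t) (u t) + e\<^sup>2" for t
    using e by (intro add_nonneg_pos) auto
  have "f 1 \<le> f 0"
  proof (rule DERIV_nonpos_imp_nonincreasing[where f = f])
    fix t :: real assume t: "0 \<le> t" "t \<le> 1"
    have D: "((\<lambda>t. inner (u t) (u t)) has_real_derivative 2 * inner (u' t) (u t)) (at t)"
      using inner_has_real_derivative[OF u[OF t] u[OF t]] by (simp add: inner_commute)
    have "(f has_real_derivative (inner (u' t) (u t) / sqrt (inner (u t) (u t) + e\<^sup>2) - c)) (at t)"
      unfolding f_def using pos[of t]
      by (auto intro!: derivative_eq_intros D simp: field_simps)
    moreover have "inner (u' t) (u t) / sqrt (inner (u t) (u t) + e\<^sup>2) \<le> c"
    proof -
      have "inner (u' t) (u t) \<le> c * norm (u t)"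
        using c(1)[OF t] .
      also have "\<dots> \<le> c * sqrt (inner (u t) (u t) + e\<^sup>2)"
        unfolding norm_eq_sqrt_inner by (intro mult_left_mono c real_sqrt_le_mono) simp
      finally show ?thesis
        using pos[of t] by (simp add: pos_divide_le_eq)
    qed
    ultimately show "\<exists>y. (f has_real_derivative y) (at t) \<and> y \<le> 0"
      by (intro exI conjI) auto
  qed simp
  then have "sqrt (inner (u 1) (u 1) + e\<^sup>2) \<le> c + sqrt ((norm (u 0))\<^sup>2 + e\<^sup>2)"
    by (simp add: f_def power2_norm_eq_inner)
  moreover have "norm (u 1) \<le> sqrt (inner (u 1) (u 1) + e\<^sup>2)"
    unfolding norm_eq_sqrt_inner by (intro real_sqrt_le_mono) simp
  moreover have "sqrt ((norm (u 0))\<^sup>2 + e\<^sup>2) \<le> norm (u 0) + e"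
    using e sqrt_sum_squares_le_sum[of "norm (u 0)" e] by simp
  ultimately show "norm (u 1) \<le> norm (u 0) + c + e" by linarith
qed

lemma norm_increment_bound:
  fixes u :: "real \<Rightarrow> 'h::real_inner"
  assumes u: "\<And>t. 0 \<le> t \<Longrightarrow> t \<le> 1 \<Longrightarrow> (u has_vector_derivative u' t) (at t)"
    and c: "\<And>t. 0 \<le> t \<Longrightarrow> t \<le> 1 \<Longrightarrow> norm (u' t) \<le> c"
  shows "norm (u 1 - u 0) \<le> c"
proof -
  have "norm (u 1 - u 0) \<le> norm (u 0 - u 0) + c"
  proof (rule norm_growth_bound)
    fix t :: real assume t: "0 \<le> t" "t \<le> 1"
    show "((\<lambda>t. u t - u 0) has_vector_derivative u' t) (at t)"
      using has_vector_derivative_diff[OF u[OF t] has_vector_derivative_const] by simp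
    have "inner (u' t) (u t - u 0) \<le> norm (u' t) * norm (u t - u 0)"
      by (rule norm_cauchy_schwarz)
    also have "\<dots> \<le> c * norm (u t - u 0)"
      by (intro mult_right_mono c t) simp
    finally show "inner (u' t) (u t - u 0) \<le> c * norm (u t - u 0)" .
  next
    show "0 \<le> c"
      using order_trans[OF norm_ge_zero c[of 0]] by simp
  qed
  then show ?thesis by simp
qed

locale bounded_positive = complex_structure +
  fixes P :: "'a \<Rightarrow> 'a"
  assumes bounded_linear_P: "bounded_linear P"
    and symmetric: "inner (P x) y = inner x (P y)"
    and positive: "0 \<le> inner (P x) x"
    and P_J: "P (J x) = J (P x)"
begin

definition expo :: "complex \<Rightarrow> 'a \<Rightarrow> 'a"
  where "expo z x = (\<Sum>n. sc ((- z) ^ n / fact n) ((P ^^ n) x))"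

lemma P_sc: "P (sc c x) = sc c (P x)"
  using bounded_linear.linear[OF bounded_linear_P] P_J by (rule linear_sc_commute)

text \<open>\<open>\<langle>J (P x), x\<rangle>\<close> vanishes because \<open>J P\<close> is skew-symmetric.\<close>

lemma inner_sc_P: "inner (sc c (P x)) x = Re c * inner (P x) x"
proof -
  have "inner (J (P x)) x = - inner x (J (P x))"
    unfolding inner_J_left[of "P x"] by (simp add: symmetric P_J)
  then have "inner (J (P x)) x = 0"
    by (simp add: inner_commute)
  then show ?thesis
    by (simp add: sc_def inner_add_left)
qed

lemma norm_funpow_bound: "\<exists>K>0. \<forall>n x. norm ((P ^^ n) x) \<le> K ^ n * norm x"
proof -
  obtain K where K: "K > 0" "\<And>x. norm (P x) \<le> norm x * K"
    using bounded_linear.pos_bounded[OF bounded_linear_P] by blast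
  have "norm ((P ^^ n) x) \<le> K ^ n * norm x" for n x
  proof (induction n)
    case (Suc n)
    have "norm ((P ^^ Suc n) x) \<le> norm ((P ^^ n) x) * K"
      using K(2) by simp
    also have "\<dots> \<le> (K ^ n * norm x) * K"
      using K(1) Suc by (intro mult_right_mono) auto
    finally show ?case by (simp add: mult_ac)
  qed simp
  with K(1) show ?thesis by blast
qed

lemma expo_uniform:
  "(\<lambda>n. sc ((- z) ^ n / fact n) ((P ^^ n) x)) sums expo z x" (is ?thesis1)
  "uniform_limit (ball 0 R) (\<lambda>n z. \<Sum>i<n. sc ((- z) ^ i / fact i) ((P ^^ i) x)) (\<lambda>z. expo z x) sequentially"
    (is ?thesis2)
proof -
  obtain K where K: "K > 0" "\<And>n x. norm ((P ^^ n) x) \<le> K ^ n * norm x"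
    using norm_funpow_bound by blast
  have U: "uniform_limit (ball 0 R) (\<lambda>n z. \<Sum>i<n. sc ((- z) ^ i / fact i) ((P ^^ i) x)) (\<lambda>z. expo z x) sequentially" for R
    unfolding expo_def
  proof (rule Weierstrass_m_test[where M = "\<lambda>n. inverse (fact n) * (R * K) ^ n * norm x"])
    fix n and z :: complex assume z: "z \<in> ball 0 R"
    have "norm (sc ((- z) ^ n / fact n) ((P ^^ n) x)) = (cmod z ^ n / fact n) * norm ((P ^^ n) x)"
      by (simp add: norm_divide norm_power)
    also have "\<dots> \<le> (R ^ n / fact n) * (K ^ n * norm x)"
      using z less_imp_le[OF le_less_trans[OF norm_ge_zero, of z R]]
      by (intro mult_mono divide_right_mono power_mono K) auto
    also have "\<dots> = inverse (fact n) * (R * K) ^ n * norm x"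
      by (simp add: field_simps power_mult_distrib)
    finally show "norm (sc ((- z) ^ n / fact n) ((P ^^ n) x)) \<le> inverse (fact n) * (R * K) ^ n * norm x" .
  next
    show "summable (\<lambda>n. inverse (fact n) * (R * K) ^ n * norm x)"
      by (intro summable_mult2 summable_exp)
  qed
  then show ?thesis2 .
  show ?thesis1
    unfolding sums_def using tendsto_uniform_limitI[OF U[of "cmod z + 1"], of z] by simp
qed

lemma expo_zero [simp]: "expo 0 x = x"
proof -
  have "(\<lambda>n. sc ((- 0) ^ n / fact n) ((P ^^ n) x)) sums (\<Sum>n\<in>{0}. sc ((- 0) ^ n / fact n) ((P ^^ n) x))"
    by (rule sums_finite) (auto simp: power_0_left)
  then show ?thesis
    using expo_uniform(1)[of 0 x] sums_unique2 by fastforce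
qed

lemma linear_expo: "linear (expo z)"
proof
  have pow: "linear (P ^^ n)" for n
    using bounded_linear.linear[OF bounded_linear_P]
    by (induction n) (simp_all add: linear_iff)
  fix x y r
  show "expo z (x + y) = expo z x + expo z y"
    using sums_unique2[OF expo_uniform(1) sums_add[OF expo_uniform(1)[of z x] expo_uniform(1)[of z y], folded sc_add_right linear_add[OF pow]]] .
  show "expo z (r *\<^sub>R x) = r *\<^sub>R expo z x"
    using sums_unique2[OF expo_uniform(1) sums_scaleR_right[OF expo_uniform(1)[of z x], of r, folded sc_scaleR_right linear_scale[OF pow]]] .
qed

text \<open>Commutation with the coefficients of the series holds for complex linear operators, and at real
  times for real linear ones, such as the projection of a complexification to its real part.\<close>

lemma expo_commute:
  assumes R: "bounded_linear R" "\<And>x. R (P x) = P (R x)"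
    and coeff: "\<And>n x. R (sc ((- z) ^ n / fact n) x) = sc ((- z) ^ n / fact n) (R x)"
  shows "R (expo z x) = expo z (R x)"
proof -
  have pow: "R ((P ^^ n) x) = (P ^^ n) (R x)" for n
    by (induction n) (simp_all add: R)
  have "(\<lambda>n. R (sc ((- z) ^ n / fact n) ((P ^^ n) x))) sums R (expo z x)"
    by (intro bounded_linear.sums[OF R(1)] expo_uniform(1))
  then show ?thesis
    unfolding coeff pow using expo_uniform(1) sums_unique2 by blast
qed

lemma expo_of_real_sums: "(\<lambda>n. ((- t) ^ n / fact n) *\<^sub>R (P ^^ n) x) sums expo (of_real t) x"
proof -
  have eq: "(- complex_of_real t) ^ n / fact n = of_real ((- t) ^ n / fact n)" for n
    by simp
  show ?thesis
    using expo_uniform(1)[of "of_real t" x] unfolding eq sc_of_real .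
qed

lemma expo_P: "P (expo z x) = expo z (P x)"
  by (rule expo_commute[OF bounded_linear_P]) (simp_all add: P_sc)

text \<open>Termwise differentiation.  The derivative of each term of the series except the first is \<open>- h P\<close>
  applied to the preceding term.\<close>

lemma expo_has_derivative: "((\<lambda>z. expo z x) has_derivative (\<lambda>h. - sc h (P (expo z x)))) (at z)"
proof -
  define R where "R = cmod z + 1"
  let ?S = "ball (0::complex) R"
  let ?f = "\<lambda>n z. sc ((- z) ^ n / fact n) ((P ^^ n) x)"
  let ?f' = "\<lambda>n z h. sc (- h * (of_nat n * (- z) ^ (n - 1)) / fact n) ((P ^^ n) x)"
  let ?g' = "\<lambda>z h. - sc h (P (expo z x))"
  obtain K where K: "K > 0" "\<And>x. norm (P x) \<le> norm x * K"
    using bounded_linear.pos_bounded[OF bounded_linear_P] by blast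
  have z: "z \<in> ?S" by (simp add: R_def)
  have shift: "(\<Sum>i<Suc n. ?f' i z h) = - sc h (P (\<Sum>i<n. ?f i z))" for n z h
  proof -
    have "?f' (Suc i) z h = - sc h (P (?f i z))" for i
      by (simp add: P_sc sc_sc sc_minus_left[symmetric] fact_Suc field_simps del: of_nat_Suc)
    then show ?thesis
      using bounded_linear.linear[OF bounded_linear_P] bounded_linear.linear[OF bounded_linear_sc[of h]]
      by (subst sum.lessThan_Suc_shift) (simp add: linear_sum sum_negf)
  qed
  have "\<exists>g. \<forall>z\<in>?S. (\<lambda>n. ?f n z) sums g z \<and> (g has_derivative ?g' z) (at z within ?S)"
  proof (rule has_derivative_series[where f' = ?f' and x = z])
    show "convex ?S" by (rule convex_ball)
    show "z \<in> ?S" by (rule z)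
    show "(\<lambda>n. ?f n z) sums expo z x" by (rule expo_uniform(1))
    fix n and w :: complex
    have "((\<lambda>z. (- z) ^ n / fact n) has_derivative (\<lambda>h. - h * (of_nat n * (- w) ^ (n - 1)) / fact n)) (at w within ?S)"
      by (auto intro!: derivative_eq_intros simp: field_simps)
    then show "(?f n has_derivative ?f' n w) (at w within ?S)"
      by (rule bounded_linear.has_derivative[OF bounded_linear_sc_left])
  next
    fix e :: real assume e: "0 < e"
    have "\<forall>\<^sub>F n in sequentially. \<forall>z\<in>?S. dist (\<Sum>i<n. ?f i z) (expo z x) < e / K"
      using expo_uniform(2)[where R = R and x = x] e K(1) by (auto simp: uniform_limit_iff)
    then have "\<forall>\<^sub>F n in sequentially. \<forall>z\<in>?S. \<forall>h. norm ((\<Sum>i<Suc n. ?f' i z h) - ?g' z h) \<le> e * norm h"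
    proof eventually_elim
      fix n assume n: "\<forall>z\<in>?S. dist (\<Sum>i<n. ?f i z) (expo z x) < e / K"
      show "\<forall>z\<in>?S. \<forall>h. norm ((\<Sum>i<Suc n. ?f' i z h) - ?g' z h) \<le> e * norm h"
      proof (intro ballI allI)
        fix w h assume w: "w \<in> ?S"
        let ?d = "expo w x - (\<Sum>i<n. ?f i w)"
        have "norm (P ?d) \<le> norm ?d * K" by (rule K)
        also have "\<dots> \<le> (e / K) * K"
          using n w K(1) by (intro mult_right_mono) (auto simp: dist_norm norm_minus_commute less_imp_le)
        finally have "norm (P ?d) \<le> e" using K(1) by simp
        have eq: "(\<Sum>i<Suc n. ?f' i w h) - ?g' w h = sc h (P ?d)"
          unfolding shift using bounded_linear_P by (simp add: sc_diff_right linear_simps)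
        show "norm ((\<Sum>i<Suc n. ?f' i w h) - ?g' w h) \<le> e * norm h"
          unfolding eq norm_sc mult.commute[of e] using \<open>norm (P ?d) \<le> e\<close>
          by (rule mult_left_mono) simp
      qed
    qed
    then show "\<forall>\<^sub>F n in sequentially. \<forall>z\<in>?S. \<forall>h. norm ((\<Sum>i<n. ?f' i z h) - ?g' z h) \<le> e * norm h"
      by (subst eventually_sequentially_Suc[symmetric])
  qed
  then obtain g where g: "\<And>z. z \<in> ?S \<Longrightarrow> (\<lambda>n. ?f n z) sums g z"
      "\<And>z. z \<in> ?S \<Longrightarrow> (g has_derivative ?g' z) (at z within ?S)"
    by blast
  have "g w = expo w x" if "w \<in> ?S" for w
    using g(1)[OF that] expo_uniform(1) sums_unique2 by blast
  moreover have "(g has_derivative ?g' z) (at z)"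
    using g(2)[OF z] z by (simp add: at_within_open[OF z])
  ultimately show ?thesis
    using has_derivative_transform_within_open[OF _ open_ball z, of g "?g' z" UNIV "\<lambda>z. expo z x"]
    by blast
qed

lemma expo_has_vector_derivative:
  "((\<lambda>t. expo (a + of_real t * b) x) has_vector_derivative - sc b (P (expo (a + of_real t * b) x))) (at t)"
proof -
  have "((\<lambda>t. a + of_real t * b) has_derivative (\<lambda>s. of_real s * b)) (at t)"
    by (auto intro!: derivative_eq_intros)
  from has_derivative_compose[OF this expo_has_derivative]
  show ?thesis
    by (simp add: has_vector_derivative_def sc_scaleR_right[symmetric] o_def sc_sc[symmetric])
qed

lemma norm_expo_le:
  assumes "0 \<le> Re z"
  shows "norm (expo z x) \<le> norm x"
  using norm_growth_bound[of "\<lambda>t. expo (0 + of_real t * z) x", OF expo_has_vector_derivative, of 0]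
    assms positive by (simp add: inner_sc_P)

text \<open>Along \<open>t \<mapsto> t z\<close> both sides solve \<open>u' = - z P u\<close> with the same initial value.  The norm of
  their difference does not grow.\<close>

lemma expo_add:
  assumes "0 \<le> Re z"
  shows "expo (z + w) x = expo z (expo w x)"
proof -
  let ?u = "\<lambda>t. expo (w + of_real t * z) x - expo (0 + of_real t * z) (expo w x)"
  have "norm (?u 1) \<le> norm (?u 0) + 0"
  proof (rule norm_growth_bound)
    fix t :: real
    show "(?u has_vector_derivative - sc z (P (?u t))) (at t)"
      using has_vector_derivative_diff[OF expo_has_vector_derivative[of w z x t] expo_has_vector_derivative[of 0 z "expo w x" t]]
        bounded_linear_P by (simp add: linear_simps sc_diff_right algebra_simps)
    show "inner (- sc z (P (?u t))) (?u t) \<le> 0 * norm (?u t)"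
      using assms positive[of "?u t"] by (simp add: inner_sc_P)
  qed simp
  then show ?thesis
    by (simp add: add.commute)
qed

text \<open>For \<open>u' = - P u\<close> the function
  \<open>\<parallel>u\<parallel>\<^sup>2 / 2 + t \<langle>P u, u\<rangle> + t\<^sup>2 \<parallel>P u\<parallel>\<^sup>2\<close> has derivative \<open>- 2 t\<^sup>2 \<langle>P (P u), P u\<rangle>\<close>, so it decreases.\<close>

lemma norm_P_expo_real:
  assumes t: "0 < t"
  shows "t * norm (P (expo (of_real t) x)) \<le> norm x"
proof -
  define u where "u t = expo (of_real t) x" for t :: real
  define F where "F s = inner (u s) (u s) / 2 + s * inner (P (u s)) (u s) + s\<^sup>2 * inner (P (u s)) (P (u s))" for s
  have "F t \<le> F 0"
  proof (rule DERIV_nonpos_imp_nonincreasing[where f = F])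
    fix s :: real assume s: "0 \<le> s" "s \<le> t"
    have du: "(u has_vector_derivative - P (u s)) (at s)"
      unfolding u_def using expo_has_vector_derivative[of 0 1 x s] by simp
    have dPu: "((\<lambda>s. P (u s)) has_vector_derivative - P (P (u s))) (at s)"
      using bounded_linear.has_vector_derivative[OF bounded_linear_P du] bounded_linear_P
      by (simp add: linear_simps)
    have 1: "((\<lambda>s. inner (u s) (u s)) has_real_derivative - 2 * inner (P (u s)) (u s)) (at s)"
      using inner_has_real_derivative[OF du du] by (simp add: inner_commute)
    have 2: "((\<lambda>s. inner (P (u s)) (u s)) has_real_derivative - 2 * inner (P (u s)) (P (u s))) (at s)"
      using inner_has_real_derivative[OF dPu du] symmetric[of "P (u s)" "u s"] by simp
    have 3: "((\<lambda>s. inner (P (u s)) (P (u s))) has_real_derivative - 2 * inner (P (P (u s))) (P (u s))) (at s)"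
      using inner_has_real_derivative[OF dPu dPu] by (simp add: inner_commute)
    have "(F has_real_derivative - 2 * s\<^sup>2 * inner (P (P (u s))) (P (u s))) (at s)"
      unfolding F_def by (auto intro!: derivative_eq_intros 1 2 3 simp: field_simps power2_eq_square)
    then show "\<exists>y. (F has_real_derivative y) (at s) \<and> y \<le> 0"
      using positive[of "P (u s)"] by (intro exI conjI) auto
  qed (use t in simp)
  moreover have "t\<^sup>2 * inner (P (u t)) (P (u t)) \<le> F t"
    using t positive[of "u t"] by (simp add: F_def)
  moreover have "F 0 \<le> inner x x"
    by (simp add: F_def u_def)
  ultimately have "t\<^sup>2 * inner (P (u t)) (P (u t)) \<le> inner x x" by linarith
  then have "(t * norm (P (u t)))\<^sup>2 \<le> (norm x)\<^sup>2"
    by (simp add: power_mult_distrib power2_norm_eq_inner)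
  then show ?thesis
    unfolding u_def by (rule power2_le_imp_le) simp
qed

text \<open>The imaginary part of \<open>z\<close> contributes a contraction that commutes with \<open>P\<close>.\<close>

lemma norm_P_expo:
  assumes "0 < Re z"
  shows "norm (P (expo z x)) \<le> norm x / Re z"
proof -
  define w where "w = \<i> * of_real (Im z)"
  have z: "z = w + of_real (Re z)"
    by (simp add: w_def complex_eq_iff)
  have "P (expo z x) = expo w (P (expo (of_real (Re z)) x))"
    by (subst z) (simp add: expo_add expo_P w_def)
  then have "norm (P (expo z x)) \<le> norm (P (expo (of_real (Re z)) x))"
    by (simp add: norm_expo_le w_def)
  also have "\<dots> \<le> norm x / Re z"
    using norm_P_expo_real[OF assms, of x] assms by (simp add: field_simps)
  finally show ?thesis .
qed

text \<open>Half of the time is spent on each factor \<open>P\<close>.\<close>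

lemma norm_P_P_expo:
  assumes "0 < Re z"
  shows "norm (P (P (expo z x))) \<le> 4 / (Re z)\<^sup>2 * norm x"
proof -
  have "P (P (expo z x)) = P (expo (z / 2) (P (expo (z / 2) x)))"
    using expo_add[of "z / 2" "z / 2" x] assms by (simp add: expo_P)
  also have "norm \<dots> \<le> norm (P (expo (z / 2) x)) / Re (z / 2)"
    using assms by (intro norm_P_expo) simp
  also have "\<dots> \<le> (norm x / Re (z / 2)) / Re (z / 2)"
    using assms by (intro divide_right_mono norm_P_expo) auto
  finally show ?thesis
    using assms by (simp add: field_simps power2_eq_square)
qed

lemma Re_ge_half_on_segment:
  assumes "cmod h \<le> Re z / 2" "0 \<le> t" "t \<le> 1"
  shows "Re z / 2 \<le> Re (z + of_real t * h)"
proof -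
  have "cmod (of_real t * h) \<le> cmod h"
    using assms by (simp add: norm_mult mult_left_le_one_le)
  then show ?thesis
    using abs_Re_le_cmod[of "of_real t * h"] assms(1) by simp
qed

lemma norm_P_expo_diff:
  assumes z: "0 < Re z" and h: "cmod h \<le> Re z / 2"
  shows "norm (P (expo (z + h) x) - P (expo z x)) \<le> cmod h * (16 / (Re z)\<^sup>2 * norm x)"
proof -
  have "norm (P (expo (z + of_real 1 * h) x) - P (expo (z + of_real 0 * h) x)) \<le> cmod h * (16 / (Re z)\<^sup>2 * norm x)"
  proof (rule norm_increment_bound)
    fix t :: real assume t: "0 \<le> t" "t \<le> 1"
    let ?w = "z + of_real t * h"
    show "((\<lambda>t. P (expo (z + of_real t * h) x)) has_vector_derivative - sc h (P (P (expo ?w x)))) (at t)"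
      using bounded_linear.has_vector_derivative[OF bounded_linear_P expo_has_vector_derivative[of z h x t]]
        bounded_linear_P by (simp add: linear_simps P_sc)
    have w: "Re z / 2 \<le> Re ?w"
      by (rule Re_ge_half_on_segment[OF h t])
    have "norm (P (P (expo ?w x))) \<le> 4 / (Re ?w)\<^sup>2 * norm x"
      using w z by (intro norm_P_P_expo) linarith
    also have "\<dots> \<le> 4 / (Re z / 2)\<^sup>2 * norm x"
      using w z by (intro mult_right_mono divide_left_mono power_mono mult_pos_pos) auto
    also have "\<dots> = 16 / (Re z)\<^sup>2 * norm x"
      by (simp add: power2_eq_square)
    finally show "norm (- sc h (P (P (expo ?w x)))) \<le> cmod h * (16 / (Re z)\<^sup>2 * norm x)"
      unfolding norm_minus_cancel norm_sc by (rule mult_left_mono) simp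
  qed
  then show ?thesis by simp
qed

lemma expo_taylor:
  assumes z: "0 < Re z" and h: "cmod h \<le> Re z / 2"
  shows "norm (expo (z + h) x - expo z x + sc h (P (expo z x))) \<le> (cmod h)\<^sup>2 * (16 / (Re z)\<^sup>2 * norm x)"
proof -
  let ?u = "\<lambda>t. expo (z + of_real t * h) x + t *\<^sub>R sc h (P (expo z x))"
  have "norm (?u 1 - ?u 0) \<le> (cmod h)\<^sup>2 * (16 / (Re z)\<^sup>2 * norm x)"
  proof (rule norm_increment_bound)
    fix t :: real assume t: "0 \<le> t" "t \<le> 1"
    let ?d = "P (expo (z + of_real t * h) x) - P (expo z x)"
    have "((\<lambda>t. t *\<^sub>R sc h (P (expo z x))) has_vector_derivative sc h (P (expo z x))) (at t)"
      by (auto intro!: derivative_eq_intros)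
    from has_vector_derivative_add[OF expo_has_vector_derivative[of z h x t] this]
    show "(?u has_vector_derivative - sc h ?d) (at t)"
      by (simp add: sc_diff_right)
    have th: "cmod (of_real t * h) \<le> cmod h"
      using t by (simp add: norm_mult mult_left_le_one_le)
    have "norm ?d \<le> cmod (of_real t * h) * (16 / (Re z)\<^sup>2 * norm x)"
      using th h by (intro norm_P_expo_diff z) linarith
    also have "\<dots> \<le> cmod h * (16 / (Re z)\<^sup>2 * norm x)"
      using th by (intro mult_right_mono) auto
    finally show "norm (- sc h ?d) \<le> (cmod h)\<^sup>2 * (16 / (Re z)\<^sup>2 * norm x)"
      unfolding norm_minus_cancel norm_sc power2_eq_square[of "cmod h"] mult.assoc
      by (rule mult_left_mono) simp
  qed
  then show ?thesis
    by (simp add: algebra_simps)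
qed

lemma norm_expo_diff_self:
  assumes z: "0 \<le> Re z"
  shows "norm (expo z x - x) \<le> cmod z * norm (P x)"
proof -
  have "norm (expo (0 + of_real 1 * z) x - expo (0 + of_real 0 * z) x) \<le> cmod z * norm (P x)"
  proof (rule norm_increment_bound[OF expo_has_vector_derivative])
    fix t :: real assume "0 \<le> t"
    then show "norm (- sc z (P (expo (0 + of_real t * z) x))) \<le> cmod z * norm (P x)"
      using z by (simp add: expo_P mult_left_mono norm_expo_le)
  qed
  then show ?thesis by simp
qed

lemma norm_expo_diff_self':
  assumes z: "0 \<le> Re z"
  shows "norm (expo z x - x) \<le> 2 * norm (x - y) + cmod z * norm (P y)"
proof -
  have eq: "expo z x - x = expo z (x - y) - (x - y) + (expo z y - y)"
    by (simp add: linear_diff[OF linear_expo])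
  have "norm (expo z x - x) \<le> (norm (expo z (x - y)) + norm (x - y)) + norm (expo z y - y)"
    unfolding eq by (meson add_right_mono norm_triangle_ineq norm_triangle_ineq4 order_trans)
  then show ?thesis
    using norm_expo_le[OF z, of "x - y"] norm_expo_diff_self[OF z, of y] by linarith
qed

lemma norm_expo_first_order:
  assumes t: "0 \<le> t"
  shows "norm (expo (of_real t) x - x + t *\<^sub>R P x) \<le> t * (2 * norm (P x - y) + t * norm (P y))"
proof -
  let ?u = "\<lambda>s. expo (0 + of_real s * of_real t) x + s *\<^sub>R t *\<^sub>R P x"
  have "norm (?u 1 - ?u 0) \<le> t * (2 * norm (P x - y) + t * norm (P y))"
  proof (rule norm_increment_bound)
    fix s :: real assume s: "0 \<le> s" "s \<le> 1"
    let ?d = "expo (of_real (s * t)) (P x) - P x"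
    have "((\<lambda>s. s *\<^sub>R t *\<^sub>R P x) has_vector_derivative t *\<^sub>R P x) (at s)"
      by (auto intro!: derivative_eq_intros)
    from has_vector_derivative_add[OF expo_has_vector_derivative[of 0 "of_real t" x s] this]
    show "(?u has_vector_derivative - (t *\<^sub>R ?d)) (at s)"
      by (simp add: expo_P scaleR_diff_right)
    have "norm ?d \<le> 2 * norm (P x - y) + cmod (of_real (s * t)) * norm (P y)"
      using s t by (intro norm_expo_diff_self') simp
    also have "\<dots> \<le> 2 * norm (P x - y) + t * norm (P y)"
      using s t by (intro add_left_mono mult_right_mono) (auto simp: norm_mult mult_left_le_one_le)
    finally show "norm (- (t *\<^sub>R ?d)) \<le> t * (2 * norm (P x - y) + t * norm (P y))"
      using t by (simp add: mult_left_mono)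
  qed
  then show ?thesis
    by (simp add: algebra_simps)
qed

lemma expo_symmetric: "inner (expo (of_real t) x) y = inner x (expo (of_real t) y)"
proof -
  have pow: "inner ((P ^^ n) x) y = inner x ((P ^^ n) y)" for n x y
    by (induction n arbitrary: x y) (simp_all add: symmetric funpow_swap1)
  have "(\<lambda>n. inner (((- t) ^ n / fact n) *\<^sub>R (P ^^ n) x) y) sums inner (expo (of_real t) x) y"
    by (intro bounded_linear.sums[OF bounded_linear_inner_left] expo_of_real_sums)
  moreover have "(\<lambda>n. inner x (((- t) ^ n / fact n) *\<^sub>R (P ^^ n) y)) sums inner x (expo (of_real t) y)"
    by (intro bounded_linear.sums[OF bounded_linear_inner_right] expo_of_real_sums)
  ultimately show ?thesis
    by (simp add: pow sums_unique2)
qed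

end

text \<open>The difference \<open>u\<close> of the two exponentials along \<open>t \<mapsto> t z\<close> solves
  \<open>u' = - z P u - z (P - Q) exp (- t z Q) x\<close>.  The first term does not increase the norm.  The second
  one is at most \<open>\<bar>z\<bar> \<parallel>P x - Q x\<parallel>\<close> in norm, because \<open>P - Q\<close> commutes with the contraction
  \<open>exp (- t z Q)\<close>.\<close>

lemma norm_expo_diff_le:
  assumes P: "bounded_positive J P" and Q: "bounded_positive J Q"
    and comm: "\<And>x. P (Q x) = Q (P x)" and z: "0 \<le> Re z"
  shows "norm (bounded_positive.expo J P z x - bounded_positive.expo J Q z x) \<le> cmod z * norm (P x - Q x)"
proof -
  interpret P: bounded_positive J P by (rule P)
  interpret Q: bounded_positive J Q by (rule Q)
  let ?u = "\<lambda>t. P.expo (0 + of_real t * z) x - Q.expo (0 + of_real t * z) x"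
  have "norm (?u 1) \<le> norm (?u 0) + cmod z * norm (P x - Q x)"
  proof (rule norm_growth_bound)
    fix t :: real assume t: "0 \<le> t" "t \<le> 1"
    let ?p = "P.expo (0 + of_real t * z) x" and ?q = "Q.expo (0 + of_real t * z) x"
    show "(?u has_vector_derivative - P.sc z (P ?p) - - P.sc z (Q ?q)) (at t)"
      by (intro has_vector_derivative_diff P.expo_has_vector_derivative Q.expo_has_vector_derivative)
    have "P ?q - Q ?q = Q.expo (0 + of_real t * z) (P x - Q x)"
      using comm by (simp add: Q.expo_P linear_diff[OF Q.linear_expo]
          Q.expo_commute[OF P.bounded_linear_P _ P.P_sc])
    then have bound: "norm (P ?q - Q ?q) \<le> norm (P x - Q x)"
      using z t by (simp add: Q.norm_expo_le)
    have eq: "- P.sc z (P ?p) - - P.sc z (Q ?q) = - P.sc z (P (?u t)) - P.sc z (P ?q - Q ?q)"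
      using P.bounded_linear_P by (simp add: linear_simps P.sc_diff_right)
    have "inner (- P.sc z (P ?p) - - P.sc z (Q ?q)) (?u t) = - (Re z * inner (P (?u t)) (?u t)) - inner (P.sc z (P ?q - Q ?q)) (?u t)"
      unfolding eq by (simp only: inner_diff_left[of "- P.sc z (P (?u t))" "P.sc z (P ?q - Q ?q)"]
          inner_minus_left P.inner_sc_P)
    also have "\<dots> \<le> norm (P.sc z (P ?q - Q ?q)) * norm (?u t)"
      using norm_cauchy_schwarz[of "- P.sc z (P ?q - Q ?q)" "?u t"]
        mult_nonneg_nonneg[OF z P.positive[of "?u t"]]
      unfolding norm_minus_cancel inner_minus_left by linarith
    also have "\<dots> \<le> cmod z * norm (P x - Q x) * norm (?u t)"
      using bound by (intro mult_right_mono) (auto intro: mult_left_mono)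
    finally show "inner (- P.sc z (P ?p) - - P.sc z (Q ?q)) (?u t) \<le> cmod z * norm (P x - Q x) * norm (?u t)" .
  qed simp
  then show ?thesis by simp
qed


section \<open>The analytic semigroup of a positive self-adjoint operator\<close>

locale positive_selfadjoint_complex = complex_structure J + positive_selfadjoint D A
  for J :: "'h::{real_inner,banach} \<Rightarrow> 'h" and D :: "'h set" and A +
  assumes A_J: "x \<in> D \<Longrightarrow> J x \<in> D \<and> A (J x) = J (A x)"
begin

lemma bounded_positive_yosida: "bounded_positive J (yosida n)"
  by (intro bounded_positive.intro complex_structure_axioms bounded_positive_axioms.intro
      bounded_linear_yosida yosida_symmetric yosida_positive yosida_commute[OF linear_J A_J])

sublocale Y: bounded_positive J "yosida n" for n
  by (rule bounded_positive_yosida)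

text \<open>The limit exists for \<open>Re z \<ge> 0\<close>; elsewhere the value is arbitrary.\<close>

definition semigroup :: "complex \<Rightarrow> 'h \<Rightarrow> 'h"
  where "semigroup z x = lim (\<lambda>n. Y.expo n z x)"

lemma dense_approx:
  assumes "0 < e"
  obtains y where "y \<in> D" "norm (x - y) < e"
proof -
  have "x \<in> closure D" by (simp add: dense)
  then show ?thesis
    using that closure_approachable[of x D] assms by (metis dist_norm norm_minus_commute)
qed

text \<open>On the domain the difference of two approximations is controlled by the difference of the Yosida
  approximations, which converge there.  Contractivity extends this to the whole space.\<close>

lemma semigroup_tendsto:
  assumes z: "0 \<le> Re z"
  shows "(\<lambda>n. Y.expo n z x) \<longlonglongrightarrow> semigroup z x"
proof -
  have "Cauchy (\<lambda>n. Y.expo n z x)"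
  proof (rule metric_CauchyI)
    fix e :: real assume e: "0 < e"
    then obtain y where y: "y \<in> D" "norm (x - y) < e / 4"
      using dense_approx[of "e / 4" x] by auto
    define c where "c = e / 2 / (cmod z + 1)"
    have pos: "0 < cmod z + 1"
      by (rule add_nonneg_pos) simp_all
    with e have c: "0 < c"
      by (simp add: c_def)
    have "cmod z * c < (cmod z + 1) * c"
      using c by simp
    also have "\<dots> = e / 2"
    proof -
      have "r * (e / 2 / r) = e / 2" if "0 < r" for r :: real
        using that by simp
      then show ?thesis unfolding c_def using pos by blast
    qed
    finally have cz: "cmod z * c < e / 2" .
    have ca: "Cauchy (\<lambda>n. yosida n y)"
      by (rule LIMSEQ_imp_Cauchy[OF yosida_tendsto[OF y(1)]])
    from metric_CauchyD[OF ca c] obtain N where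
      N: "\<And>m n. m \<ge> N \<Longrightarrow> n \<ge> N \<Longrightarrow> norm (yosida m y - yosida n y) < c"
      unfolding dist_norm by blast
    have "dist (Y.expo m z x) (Y.expo n z x) < e" if "m \<ge> N" "n \<ge> N" for m n
    proof -
      have eq: "Y.expo m z x - Y.expo n z x
          = Y.expo m z (x - y) - Y.expo n z (x - y) + (Y.expo m z y - Y.expo n z y)"
        by (simp add: linear_diff[OF Y.linear_expo])
      have "norm (Y.expo m z x - Y.expo n z x)
          \<le> (norm (Y.expo m z (x - y)) + norm (Y.expo n z (x - y))) + norm (Y.expo m z y - Y.expo n z y)"
        unfolding eq by (rule norm_triangle_le) (rule add_right_mono[OF norm_triangle_ineq4])
      moreover have "norm (Y.expo m z y - Y.expo n z y) \<le> cmod z * norm (yosida m y - yosida n y)"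
        using bounded_positive_yosida[of m] bounded_positive_yosida[of n] yosida_yosida_commute[of m n] z
        by (rule norm_expo_diff_le)
      moreover have "cmod z * norm (yosida m y - yosida n y) \<le> cmod z * c"
        using N[OF that] by (intro mult_left_mono) auto
      ultimately show ?thesis
        using Y.norm_expo_le[OF z, of m "x - y"] Y.norm_expo_le[OF z, of n "x - y"] y(2) cz
        by (simp add: dist_norm)
    qed
    then show "\<exists>N. \<forall>m\<ge>N. \<forall>n\<ge>N. dist (Y.expo m z x) (Y.expo n z x) < e" by blast
  qed
  then show ?thesis
    unfolding semigroup_def using Cauchy_convergent_iff convergent_LIMSEQ_iff by blast
qed

lemma semigroup_zero [simp]: "semigroup 0 x = x"
  using semigroup_tendsto[of 0 x] by (simp add: LIMSEQ_const_iff)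

lemma norm_semigroup_le: "0 \<le> Re z \<Longrightarrow> norm (semigroup z x) \<le> norm x"
  by (rule LIMSEQ_le_const2[OF tendsto_norm[OF semigroup_tendsto]]) (auto intro: Y.norm_expo_le)

lemma bounded_linear_semigroup:
  assumes z: "0 \<le> Re z"
  shows "bounded_linear (semigroup z)"
proof (rule bounded_linear_intro[where K = 1])
  fix x y r
  show "semigroup z (x + y) = semigroup z x + semigroup z y"
    using tendsto_add[OF semigroup_tendsto[OF z, of x] semigroup_tendsto[OF z, of y]]
      semigroup_tendsto[OF z, of "x + y"]
    by (simp add: linear_add[OF Y.linear_expo] LIMSEQ_unique)
  show "semigroup z (r *\<^sub>R x) = r *\<^sub>R semigroup z x"
    using tendsto_scaleR[OF tendsto_const semigroup_tendsto[OF z, of x], of r]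
      semigroup_tendsto[OF z, of "r *\<^sub>R x"]
    by (simp add: linear_scale[OF Y.linear_expo] LIMSEQ_unique)
  show "norm (semigroup z x) \<le> norm x * 1"
    using norm_semigroup_le[OF z] by simp
qed

lemma semigroup_commute:
  assumes R: "bounded_linear R" "\<And>x. x \<in> D \<Longrightarrow> R x \<in> D \<and> A (R x) = R (A x)"
    "\<And>n x. R (sc ((- z) ^ n / fact n) x) = sc ((- z) ^ n / fact n) (R x)" and z: "0 \<le> Re z"
  shows "R (semigroup z x) = semigroup z (R x)"
proof -
  have "R (Y.expo n z x) = Y.expo n z (R x)" for n
    using yosida_commute[OF bounded_linear.linear[OF R(1)] R(2)] R(1,3)
    by (intro Y.expo_commute) auto
  then have "(\<lambda>n. Y.expo n z (R x)) \<longlonglongrightarrow> R (semigroup z x)"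
    using bounded_linear.tendsto[OF R(1) semigroup_tendsto[OF z, of x]] by simp
  then show ?thesis
    using semigroup_tendsto[OF z] LIMSEQ_unique by blast
qed

lemma semigroup_sc:
  assumes z: "0 \<le> Re z"
  shows "semigroup z (sc c x) = sc c (semigroup z x)"
proof (rule linear_sc_commute)
  show "linear (semigroup z)"
    by (rule bounded_linear.linear[OF bounded_linear_semigroup[OF z]])
  show "semigroup z (J x) = J (semigroup z x)" for x
    by (rule semigroup_commute[OF bounded_linear_J A_J linear_sc_commute[OF linear_J refl] z, symmetric])
qed

lemma semigroup_add:
  assumes z: "0 \<le> Re z" and w: "0 \<le> Re w"
  shows "semigroup (z + w) x = semigroup z (semigroup w x)"
proof -
  have a: "(\<lambda>n. norm (Y.expo n w x - semigroup w x)) \<longlonglongrightarrow> 0"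
    using semigroup_tendsto[OF w, of x] by (simp add: LIM_zero_iff tendsto_norm_zero)
  have b: "norm (Y.expo n z (Y.expo n w x - semigroup w x)) \<le> norm (Y.expo n w x - semigroup w x)" for n
    by (rule Y.norm_expo_le[OF z])
  have "(\<lambda>n. Y.expo n z (Y.expo n w x - semigroup w x)) \<longlonglongrightarrow> 0"
    by (rule Lim_null_comparison[OF always_eventually[OF allI[OF b]] a])
  from tendsto_add[OF this semigroup_tendsto[OF z, of "semigroup w x"]]
  have "(\<lambda>n. Y.expo n (z + w) x) \<longlonglongrightarrow> semigroup z (semigroup w x)"
    by (simp add: linear_diff[OF Y.linear_expo] Y.expo_add[OF z])
  then show ?thesis
    using semigroup_tendsto[of "z + w" x] z w LIMSEQ_unique by auto
qed

lemma norm_semigroup_diff_self: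
  assumes z: "0 \<le> Re z" and y: "y \<in> D"
  shows "norm (semigroup z x - x) \<le> 2 * norm (x - y) + cmod z * norm (A y)"
proof (rule LIMSEQ_le_const2)
  show "(\<lambda>n. norm (Y.expo n z x - x)) \<longlonglongrightarrow> norm (semigroup z x - x)"
    by (intro tendsto_intros semigroup_tendsto z)
  have "norm (Y.expo n z x - x) \<le> 2 * norm (x - y) + cmod z * norm (A y)" for n
    using Y.norm_expo_diff_self'[OF z, of n x y] mult_left_mono[OF norm_yosida_le[OF y, of n], of "cmod z"]
    by simp
  then show "\<exists>N. \<forall>n\<ge>N. norm (Y.expo n z x - x) \<le> 2 * norm (x - y) + cmod z * norm (A y)"
    by blast
qed

lemma semigroup_tendsto_zero: "((\<lambda>z. semigroup z x) \<longlongrightarrow> x) (at 0 within {z. 0 \<le> Re z})"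
  unfolding tendsto_iff
proof (intro allI impI)
  fix e :: real assume e: "0 < e"
  then obtain y where y: "y \<in> D" "norm (x - y) < e / 4"
    using dense_approx[of "e / 4" x] by auto
  have "((\<lambda>z. cmod z * norm (A y)) \<longlongrightarrow> cmod 0 * norm (A y)) (at 0 within {z. 0 \<le> Re z})"
    by (intro tendsto_intros)
  then have "\<forall>\<^sub>F z in at 0 within {z. 0 \<le> Re z}. cmod z * norm (A y) < e / 2"
    using e by (intro order_tendstoD) auto
  moreover have "\<forall>\<^sub>F z in at 0 within {z. 0 \<le> Re z}. 0 \<le> Re z"
    by (simp add: eventually_at_filter)
  ultimately show "\<forall>\<^sub>F z in at 0 within {z. 0 \<le> Re z}. dist (semigroup z x) x < e"
  proof eventually_elim
    fix z assume "cmod z * norm (A y) < e / 2" "0 \<le> Re z"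
    then show "dist (semigroup z x) x < e"
      using norm_semigroup_diff_self[OF _ y(1), of z x] y(2) by (simp add: dist_norm)
  qed
qed

definition semigroup_deriv :: "complex \<Rightarrow> 'h \<Rightarrow> 'h"
  where "semigroup_deriv z x = - lim (\<lambda>n. yosida n (Y.expo n z x))"

text \<open>The Taylor bounds are uniform in the approximation, so the convergence of the difference
  quotients carries over to the derivatives.\<close>

lemma semigroup_deriv_tendsto:
  assumes z: "0 < Re z"
  shows "(\<lambda>n. yosida n (Y.expo n z x)) \<longlonglongrightarrow> - semigroup_deriv z x"
proof -
  have "Cauchy (\<lambda>n. yosida n (Y.expo n z x))"
  proof (rule metric_CauchyI)
    fix e :: real assume e: "0 < e"
    define C where "C = 16 / (Re z)\<^sup>2 * norm x"
    have C: "0 \<le> C" using z by (simp add: C_def)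
    \<comment> \<open>A step so short that the remainder of the first-order expansion is small, relative to \<open>h\<close>.\<close>
    define h where "h = min (Re z / 2) (e / (4 * (C + 1)))"
    have h: "0 < h" "h \<le> Re z / 2" "2 * (h * C) < e / 2 + 0"
    proof -
      show "0 < h" using z e C by (auto simp: h_def)
      show "h \<le> Re z / 2" unfolding h_def by (rule min.cobounded1)
      have "h * C \<le> (e / (4 * (C + 1))) * C"
        using C by (intro mult_right_mono) (auto simp: h_def)
      also have "\<dots> < e / 4"
        using e C by (simp add: field_simps)
      finally show "2 * (h * C) < e / 2 + 0" by simp
    qed
    let ?E = "\<lambda>n. Y.expo n"
    have ca: "Cauchy (\<lambda>n. ?E n (z + of_real h) x - ?E n z x)"
      using z h by (intro LIMSEQ_imp_Cauchy[OF tendsto_diff[OF semigroup_tendsto semigroup_tendsto]]) auto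
    have "0 < h * (e / 2)"
      using h e by simp
    from metric_CauchyD[OF ca this] obtain N where N: "\<And>m n. m \<ge> N \<Longrightarrow> n \<ge> N \<Longrightarrow>
        norm ((?E m (z + of_real h) x - ?E m z x) - (?E n (z + of_real h) x - ?E n z x)) < h * (e / 2)"
      unfolding dist_norm by blast
    have "dist (yosida m (?E m z x)) (yosida n (?E n z x)) < e" if mn: "m \<ge> N" "n \<ge> N" for m n
    proof -
      let ?r = "\<lambda>n. ?E n (z + of_real h) x - ?E n z x + h *\<^sub>R yosida n (?E n z x)"
      have r: "norm (?r n) \<le> h * (h * C)" for n
        using Y.expo_taylor[OF z, of "of_real h" n x] h by (simp add: C_def power2_eq_square)
      let ?d = "(?E m (z + of_real h) x - ?E m z x) - (?E n (z + of_real h) x - ?E n z x)"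
      have eq: "h *\<^sub>R (yosida m (?E m z x) - yosida n (?E n z x)) = ?r m - ?r n - ?d"
        by (simp add: algebra_simps)
      have "norm (h *\<^sub>R (yosida m (?E m z x) - yosida n (?E n z x))) \<le> norm (?r m) + norm (?r n) + norm ?d"
        unfolding eq by (rule order_trans[OF norm_triangle_ineq4 add_right_mono[OF norm_triangle_ineq4]])
      also have "\<dots> < h * (h * C) + h * (h * C) + h * (e / 2)"
        using r[of m] r[of n] N[OF mn] by linarith
      also have "\<dots> = h * (2 * (h * C) + e / 2)"
        by (simp add: algebra_simps)
      also have "\<dots> \<le> h * e"
        using h by (intro mult_left_mono) auto
      finally show ?thesis
        using h(1) by (simp add: dist_norm)
    qed
    then show "\<exists>N. \<forall>m\<ge>N. \<forall>n\<ge>N. dist (yosida m (?E m z x)) (yosida n (?E n z x)) < e" by blast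
  qed
  then show ?thesis
    unfolding semigroup_deriv_def minus_minus
    using Cauchy_convergent_iff convergent_LIMSEQ_iff by blast
qed

lemma semigroup_taylor:
  assumes z: "0 < Re z" and h: "cmod h \<le> Re z / 2"
  shows "norm (semigroup (z + h) x - semigroup z x - sc h (semigroup_deriv z x))
    \<le> (cmod h)\<^sup>2 * (16 / (Re z)\<^sup>2 * norm x)"
proof -
  have zh: "0 \<le> Re (z + h)"
    using Y.Re_ge_half_on_segment[OF h, of 1] z by simp
  have "(\<lambda>n. Y.expo n (z + h) x - Y.expo n z x + sc h (yosida n (Y.expo n z x)))
      \<longlonglongrightarrow> semigroup (z + h) x - semigroup z x + sc h (- semigroup_deriv z x)"
    by (intro tendsto_intros semigroup_tendsto zh less_imp_le[OF z] semigroup_deriv_tendsto[OF z]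
        bounded_linear.tendsto[OF bounded_linear_sc])
  from tendsto_norm[OF this] show ?thesis
    unfolding sc_minus_right add_uminus_conv_diff
    by (rule LIMSEQ_le_const2) (use Y.expo_taylor[OF z h] in blast)
qed

lemma bounded_linear_semigroup_deriv:
  assumes z: "0 < Re z"
  shows "bounded_linear (semigroup_deriv z)"
proof (rule bounded_linear_intro[where K = "1 / Re z"])
  have lin: "linear (\<lambda>x. yosida n (Y.expo n z x))" for n
    using linear_compose[OF Y.linear_expo bounded_linear.linear[OF bounded_linear_yosida]]
    by (simp add: o_def)
  fix x y r
  have "- semigroup_deriv z (x + y) = - semigroup_deriv z x + - semigroup_deriv z y"
    using tendsto_add[OF semigroup_deriv_tendsto[OF z, of x] semigroup_deriv_tendsto[OF z, of y]]
      semigroup_deriv_tendsto[OF z, of "x + y"] LIMSEQ_unique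
    unfolding linear_add[OF lin] by blast
  then show "semigroup_deriv z (x + y) = semigroup_deriv z x + semigroup_deriv z y"
    by (simp add: algebra_simps)
  have "- semigroup_deriv z (r *\<^sub>R x) = r *\<^sub>R - semigroup_deriv z x"
    using tendsto_scaleR[OF tendsto_const semigroup_deriv_tendsto[OF z, of x], of r]
      semigroup_deriv_tendsto[OF z, of "r *\<^sub>R x"] LIMSEQ_unique
    unfolding linear_scale[OF lin] by blast
  then show "semigroup_deriv z (r *\<^sub>R x) = r *\<^sub>R semigroup_deriv z x"
    by simp
  have "norm (- semigroup_deriv z x) \<le> norm x / Re z"
    by (rule LIMSEQ_le_const2[OF tendsto_norm[OF semigroup_deriv_tendsto[OF z]]])
      (auto intro: Y.norm_P_expo[OF z])
  then show "norm (semigroup_deriv z x) \<le> norm x * (1 / Re z)" by simp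
qed

lemma semigroup_deriv_sc:
  assumes z: "0 < Re z"
  shows "semigroup_deriv z (sc c x) = sc c (semigroup_deriv z x)"
proof (rule linear_sc_commute)
  show "linear (semigroup_deriv z)"
    by (rule bounded_linear.linear[OF bounded_linear_semigroup_deriv[OF z]])
  fix x
  have "yosida n (Y.expo n z (J x)) = J (yosida n (Y.expo n z x))" for n
    using Y.expo_commute[OF bounded_linear_J _ linear_sc_commute[OF linear_J refl], of n z x] Y.P_J by metis
  then have "- semigroup_deriv z (J x) = J (- semigroup_deriv z x)"
    using semigroup_deriv_tendsto[OF z, of "J x"] LIMSEQ_unique
      bounded_linear.tendsto[OF bounded_linear_J semigroup_deriv_tendsto[OF z, of x]] by simp
  then show "semigroup_deriv z (J x) = J (semigroup_deriv z x)"
    using linear_J by (simp add: linear_neg)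
qed

lemma sector_right_half_plane: "sector (pi / 2) = {z. 0 < Re z}"
  unfolding sector_def Arg_Re_pos by auto

theorem analytic_semigroup: "analytic_semigroup sc (pi / 2) semigroup"
  unfolding analytic_semigroup_def sector_right_half_plane
proof (intro conjI ballI allI)
  show "semigroup 0 = id" by (simp add: fun_eq_iff)
  show "bounded_clinear sc (semigroup z)" if "z \<in> {z. 0 < Re z}" for z
    using that by (simp add: bounded_clinear_def bounded_linear_semigroup semigroup_sc)
  show "semigroup (z + w) = semigroup z \<circ> semigroup w" if "z \<in> {z. 0 < Re z}" "w \<in> {z. 0 < Re z}" for z w
    using that by (simp add: fun_eq_iff semigroup_add)
  show "((\<lambda>z. semigroup z x) \<longlongrightarrow> x) (at 0 within {z. 0 < Re z})" for x
    by (rule tendsto_within_subset[OF semigroup_tendsto_zero]) auto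
  fix z assume "z \<in> {z. 0 < Re z}"
  then have z: "0 < Re z" by simp
  let ?d = "\<lambda>w x. sc (1 / (w - z)) (semigroup w x - semigroup z x) - semigroup_deriv z x"
  have "((\<lambda>w. onorm (?d w)) \<longlongrightarrow> 0) (at z)"
  proof (rule Lim_null_comparison)
    show "((\<lambda>w. cmod (w - z) * (16 / (Re z)\<^sup>2)) \<longlongrightarrow> 0) (at z)"
      using z by (auto intro!: tendsto_eq_intros)
    have "\<forall>\<^sub>F w in at z. dist w z < Re z / 2 \<and> w \<noteq> z"
      using z by (auto simp: eventually_at intro!: exI[of _ "Re z / 2"])
    then show "\<forall>\<^sub>F w in at z. norm (onorm (?d w)) \<le> cmod (w - z) * (16 / (Re z)\<^sup>2)"
    proof eventually_elim
      fix w assume w: "dist w z < Re z / 2 \<and> w \<noteq> z"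
      have bound: "norm (?d w x) \<le> cmod (w - z) * (16 / (Re z)\<^sup>2) * norm x" for x
      proof -
        have eq: "?d w x = sc (1 / (w - z)) (semigroup (z + (w - z)) x - semigroup z x - sc (w - z) (semigroup_deriv z x))"
          using w by (simp add: sc_diff_right sc_sc)
        have "norm (?d w x) = norm (semigroup (z + (w - z)) x - semigroup z x - sc (w - z) (semigroup_deriv z x)) / cmod (w - z)"
          unfolding eq by (simp add: norm_divide)
        also have "\<dots> \<le> ((cmod (w - z))\<^sup>2 * (16 / (Re z)\<^sup>2 * norm x)) / cmod (w - z)"
          using w by (intro divide_right_mono semigroup_taylor z) (auto simp: dist_norm)
        also have "\<dots> = cmod (w - z) * (16 / (Re z)\<^sup>2) * norm x"
          by (simp add: power2_eq_square)
        finally show ?thesis .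
      qed
      have "onorm (?d w) \<le> cmod (w - z) * (16 / (Re z)\<^sup>2)"
        by (rule onorm_bound[OF _ bound]) simp
      moreover have "0 \<le> onorm (?d w)"
      proof (rule onorm_pos_le)
        have "0 \<le> Re w"
          using Y.Re_ge_half_on_segment[of "w - z" z 1] w z by (simp add: dist_norm)
        then show "bounded_linear (?d w)"
          using z by (intro bounded_linear_sub bounded_linear_semigroup_deriv
            bounded_linear_compose[OF bounded_linear_sc] bounded_linear_semigroup) auto
      qed
      ultimately show "norm (onorm (?d w)) \<le> cmod (w - z) * (16 / (Re z)\<^sup>2)" by simp
    qed
  qed
  then show "\<exists>T'. bounded_clinear sc T' \<and>
      ((\<lambda>w. onorm (\<lambda>x. sc (1 / (w - z)) (semigroup w x - semigroup z x) - T' x)) \<longlongrightarrow> 0) (at z)"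
    using z by (intro exI[of _ "semigroup_deriv z"])
      (simp add: bounded_clinear_def bounded_linear_semigroup_deriv semigroup_deriv_sc)
qed

lemma semigroup_symmetric:
  assumes t: "0 \<le> t"
  shows "inner (semigroup (of_real t) x) y = inner x (semigroup (of_real t) y)"
proof -
  have "(\<lambda>n. inner (Y.expo n (of_real t) x) y) \<longlonglongrightarrow> inner (semigroup (of_real t) x) y"
    using t by (intro tendsto_intros semigroup_tendsto) simp
  moreover have "(\<lambda>n. inner x (Y.expo n (of_real t) y)) \<longlonglongrightarrow> inner x (semigroup (of_real t) y)"
    using t by (intro tendsto_intros semigroup_tendsto) simp
  ultimately show ?thesis
    by (simp add: Y.expo_symmetric LIMSEQ_unique)
qed

text \<open>The generator extends \<open>- A\<close> by the first-order expansion of the approximations.  As the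
  generator of a symmetric semigroup it is symmetric, so \<open>- A\<close>, being self-adjoint, has no proper
  extension of this kind.\<close>

theorem semigroup_generator: "is_generator (\<lambda>t. semigroup (of_real t)) D (\<lambda>x. - A x)"
proof -
  let ?q = "\<lambda>x t. (semigroup (of_real t) x - x) /\<^sub>R t"
  have ext: "(?q x \<longlongrightarrow> - A x) (at_right 0)" if x: "x \<in> D" for x
    unfolding tendsto_iff
  proof (intro allI impI)
    fix e :: real assume e: "0 < e"
    then obtain y where y: "y \<in> D" "norm (A x - y) < e / 4"
      using dense_approx[of "e / 4" "A x"] by auto
    have "((\<lambda>t. t * norm (A y)) \<longlongrightarrow> 0 * norm (A y)) (at_right 0)"
      by (intro tendsto_intros)
    then have "\<forall>\<^sub>F t in at_right 0. t * norm (A y) < e / 2"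
      using e by (intro order_tendstoD) auto
    then show "\<forall>\<^sub>F t in at_right 0. dist (?q x t) (- A x) < e"
      using eventually_at_right_less[of "0::real"]
    proof eventually_elim
      fix t :: real assume t: "t * norm (A y) < e / 2" "0 < t"
      have "norm (semigroup (of_real t) x - x + t *\<^sub>R A x) \<le> t * (2 * norm (A x - y) + t * norm (A y))"
      proof (rule LIMSEQ_le)
        show "(\<lambda>n. norm (Y.expo n (of_real t) x - x + t *\<^sub>R yosida n x)) \<longlonglongrightarrow> norm (semigroup (of_real t) x - x + t *\<^sub>R A x)"
          using t by (intro tendsto_intros semigroup_tendsto yosida_tendsto x) simp
        show "(\<lambda>n. t * (2 * norm (yosida n x - y) + t * norm (yosida n y))) \<longlonglongrightarrow> t * (2 * norm (A x - y) + t * norm (A y))"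
          by (intro tendsto_intros yosida_tendsto x y)
      qed (use t in \<open>auto intro!: Y.norm_expo_first_order\<close>)
      also have "\<dots> < t * e"
        using t y by (intro mult_strict_left_mono) auto
      finally have "norm (semigroup (of_real t) x - x + t *\<^sub>R A x) < t * e" .
      moreover have "?q x t - - A x = (semigroup (of_real t) x - x + t *\<^sub>R A x) /\<^sub>R t"
        using t by (simp add: scaleR_add_right)
      ultimately show "dist (?q x t) (- A x) < e"
        using t(2) by (simp add: dist_norm divide_inverse_commute[symmetric] pos_divide_less_eq mult.commute)
    qed
  qed
  have "x \<in> D \<and> y = - A x" if lim: "(?q x \<longlongrightarrow> y) (at_right 0)" for x y
  proof -
    have "x \<in> D \<and> A x = - y"
    proof (rule adjointI)
      fix v assume v: "v \<in> D"
      have l1: "((\<lambda>t. inner (?q v t) x) \<longlongrightarrow> inner (- A v) x) (at_right 0)"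
        by (intro tendsto_intros ext v)
      have l2: "((\<lambda>t. inner v (?q x t)) \<longlongrightarrow> inner v y) (at_right 0)"
        by (intro tendsto_intros lim)
      have "\<forall>\<^sub>F t in at_right 0. inner (?q v t) x = inner v (?q x t)"
        using eventually_at_right_less[of "0::real"]
        by eventually_elim (simp add: inner_diff_left inner_diff_right semigroup_symmetric)
      from Lim_transform_eventually[OF l1 this] have "inner (- A v) x = inner v y"
        using l2 by (rule tendsto_unique[OF trivial_limit_at_right_real])
      then show "inner (A v) x = inner v (- y)" by simp
    qed
    then show ?thesis by simp
  qed
  with ext show ?thesis
    unfolding is_generator_def by blast
qed

end


section \<open>Completeness of the Bochner space\<close>

lemma L2_eq_refl: "L2_eq f f \<longleftrightarrow> square_integrable f"
  by (auto simp: L2_eq_def)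

lemma L2_cases:
  obtains f where "square_integrable f" "u = abs_L2 f"
  by (induction u rule: L2.abs_induct) (auto simp: L2_eq_refl)

lemma abs_L2_eqI:
  "square_integrable f \<Longrightarrow> square_integrable g \<Longrightarrow> (AE x in lborel. f x = g x) \<Longrightarrow> abs_L2 f = abs_L2 g"
  using Quotient_rel[OF Quotient_L2, of f g] by (auto simp: L2_eq_def)

lemma plus_abs_L2: "square_integrable f \<Longrightarrow> square_integrable g \<Longrightarrow> abs_L2 f + abs_L2 g = abs_L2 (\<lambda>x. f x + g x)"
  and minus_abs_L2: "square_integrable f \<Longrightarrow> square_integrable g \<Longrightarrow> abs_L2 f - abs_L2 g = abs_L2 (\<lambda>x. f x - g x)"
  and scaleR_abs_L2: "square_integrable f \<Longrightarrow> r *\<^sub>R abs_L2 f = abs_L2 (\<lambda>x. r *\<^sub>R f x)"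
  and inner_abs_L2: "square_integrable f \<Longrightarrow> square_integrable g \<Longrightarrow>
    inner (abs_L2 f) (abs_L2 g) = (\<integral>x. inner (f x) (g x) \<partial>lborel)"
  by (simp_all add: plus_L2.abs_eq minus_L2.abs_eq scaleR_L2.abs_eq inner_L2.abs_eq L2_eq_refl)

lemma norm_abs_L2: "square_integrable f \<Longrightarrow> (norm (abs_L2 f))\<^sup>2 = (\<integral>x. (norm (f x))\<^sup>2 \<partial>lborel)"
  by (simp add: power2_norm_eq_inner inner_abs_L2)

lemma nn_norm_abs_L2:
  assumes "square_integrable f"
  shows "(\<integral>\<^sup>+x. ennreal ((norm (f x))\<^sup>2) \<partial>lborel) = ennreal ((norm (abs_L2 f))\<^sup>2)"
  unfolding norm_abs_L2[OF assms]
  using assms by (intro nn_integral_eq_integral) (auto simp: square_integrable_def)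

text \<open>The sum of the weighted squares \<open>2\<^sup>n \<parallel>d n\<parallel>\<^sup>2\<close> of the increments of a fast Cauchy sequence is
  integrable, hence finite almost everywhere, and it controls the sum of the \<open>\<parallel>d n\<parallel>\<close>.\<close>

lemma AE_convergent_if_fast_Cauchy:
  fixes f :: "nat \<Rightarrow> real \<Rightarrow> 'a::{real_inner,banach,second_countable_topology}"
  assumes f: "\<And>n. square_integrable (f n)"
    and fast: "\<And>n. norm (abs_L2 (f (Suc n)) - abs_L2 (f n)) \<le> (1/2) ^ n"
  shows "AE x in lborel. convergent (\<lambda>n. f n x)"
proof -
  define d where "d n x = norm (f (Suc n) x - f n x)" for n x
  have [measurable]: "f n \<in> borel_measurable lborel" for n
    using f by (simp add: square_integrable_def)
  have [measurable]: "d n \<in> borel_measurable lborel" for n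
    unfolding d_def by measurable
  have int: "(\<integral>\<^sup>+x. ennreal (2 ^ n * (d n x)\<^sup>2) \<partial>lborel) \<le> ennreal ((1/2) ^ n)" for n
  proof -
    have "(\<integral>\<^sup>+x. ennreal (2 ^ n * (d n x)\<^sup>2) \<partial>lborel) = ennreal (2 ^ n) * (\<integral>\<^sup>+x. ennreal ((d n x)\<^sup>2) \<partial>lborel)"
      by (subst nn_integral_cmult[symmetric]) (auto simp: ennreal_mult)
    also have "\<dots> = ennreal (2 ^ n) * ennreal ((norm (abs_L2 (\<lambda>x. f (Suc n) x - f n x)))\<^sup>2)"
      unfolding d_def by (subst nn_norm_abs_L2) (auto intro: square_integrable_diff f)
    also have "\<dots> = ennreal (2 ^ n * (norm (abs_L2 (f (Suc n)) - abs_L2 (f n)))\<^sup>2)"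
      by (simp add: ennreal_mult minus_abs_L2 f)
    also have "\<dots> \<le> ennreal (2 ^ n * ((1/2) ^ n)\<^sup>2)"
      by (intro ennreal_leI mult_left_mono power_mono fast) auto
    also have "2 ^ n * ((1/2) ^ n)\<^sup>2 = (1/2 :: real) ^ n"
      by (simp add: power2_eq_square power_divide)
    finally show ?thesis .
  qed
  have "(\<integral>\<^sup>+x. (\<Sum>n. ennreal (2 ^ n * (d n x)\<^sup>2)) \<partial>lborel) = (\<Sum>n. \<integral>\<^sup>+x. ennreal (2 ^ n * (d n x)\<^sup>2) \<partial>lborel)"
    by (rule nn_integral_suminf) simp
  also have "\<dots> \<le> (\<Sum>n. ennreal ((1/2) ^ n))"
    by (intro suminf_le int) auto
  also have "\<dots> = ennreal (\<Sum>n. (1/2) ^ n)"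
    by (intro suminf_ennreal2 summable_geometric) auto
  finally have "(\<integral>\<^sup>+x. (\<Sum>n. ennreal (2 ^ n * (d n x)\<^sup>2)) \<partial>lborel) \<noteq> \<infinity>"
    by (auto simp: top_unique)
  then have "AE x in lborel. (\<Sum>n. ennreal (2 ^ n * (d n x)\<^sup>2)) \<noteq> \<infinity>"
    by (intro nn_integral_PInf_AE) auto
  then show ?thesis
  proof eventually_elim
    case (elim x)
    then have "summable (\<lambda>n. 2 ^ n * (d n x)\<^sup>2)"
      by (intro summable_suminf_not_top) auto
    then have "summable (\<lambda>n. 2 ^ n * (d n x)\<^sup>2 + (1/2) ^ n)"
      by (intro summable_add summable_geometric) auto
    moreover have "norm (f (Suc n) x - f n x) \<le> 2 ^ n * (d n x)\<^sup>2 + (1/2) ^ n" for n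
    proof -
      have "0 \<le> 2 ^ n * (d n x - (1/2) ^ n)\<^sup>2" by simp
      also have "\<dots> = 2 ^ n * (d n x)\<^sup>2 + (1/2) ^ n - 2 * d n x"
        by (simp add: power2_diff power2_eq_square algebra_simps power_divide)
      finally show ?thesis
        using norm_ge_zero[of "f (Suc n) x - f n x"] unfolding d_def by linarith
    qed
    ultimately have "summable (\<lambda>n. f (Suc n) x - f n x)"
      by (intro summable_comparison_test[where f = "\<lambda>n. f (Suc n) x - f n x"]) auto
    then have "convergent (\<lambda>n. f n x - f 0 x)"
      by (simp add: summable_iff_convergent sum_lessThan_telescope[of "\<lambda>n. f n x"])
    then have "convergent (\<lambda>n. f n x - f 0 x + f 0 x)"
      by (intro convergent_add convergent_const)
    then show ?case by simp
  qed
qed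

text \<open>The almost everywhere limit of a fast subsequence is its limit in mean square by the lemma of
  Fatou.\<close>

instance L2 :: ("{real_inner,banach,second_countable_topology}") banach
proof
  fix X :: "nat \<Rightarrow> 'a L2"
  assume X: "Cauchy X"
  have "\<exists>N. \<forall>m\<ge>N. \<forall>k\<ge>N. norm (X m - X k) < (1/2) ^ n" for n
    using metric_CauchyD[OF X, of "(1/2) ^ n"] by (simp add: dist_norm)
  then obtain N where N: "\<And>n m k. m \<ge> N n \<Longrightarrow> k \<ge> N n \<Longrightarrow> norm (X m - X k) < (1/2) ^ n"
    by metis
  define r where "r n = n + (\<Sum>i\<le>n. N i)" for n
  have r: "strict_mono r"
    by (simp add: strict_mono_Suc_iff r_def)
  have rN: "N n \<le> r m" if "n \<le> m" for n m
  proof -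
    have "N n \<le> (\<Sum>i\<le>m. N i)" using that by (intro member_le_sum) auto
    then show ?thesis by (simp add: r_def)
  qed
  have "\<exists>f. square_integrable f \<and> X (r n) = abs_L2 f" for n
    by (rule L2_cases[of "X (r n)"]) blast
  then obtain f where f: "\<And>n. square_integrable (f n)" "\<And>n. X (r n) = abs_L2 (f n)"
    by metis
  have [measurable]: "f n \<in> borel_measurable lborel" for n
    using f by (simp add: square_integrable_def)
  have close: "norm (abs_L2 (f m) - abs_L2 (f n)) < (1/2) ^ n" if "n \<le> m" for m n
    using N[OF rN[OF that] rN[OF order_refl]] by (simp add: f)
  define g where "g x = lim (\<lambda>n. f n x)" for x
  have [measurable]: "g \<in> borel_measurable lborel"
    unfolding g_def by measurable
  have "AE x in lborel. convergent (\<lambda>n. f n x)"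
    by (rule AE_convergent_if_fast_Cauchy[OF f(1)]) (auto intro: less_imp_le close)
  then have lim: "AE x in lborel. (\<lambda>n. f n x) \<longlonglongrightarrow> g x"
    by eventually_elim (simp add: g_def convergent_LIMSEQ_iff)
  have nn: "(\<integral>\<^sup>+x. ennreal ((norm (g x - f n x))\<^sup>2) \<partial>lborel) \<le> ennreal (((1/2) ^ n)\<^sup>2)" for n
  proof -
    have "(\<integral>\<^sup>+x. ennreal ((norm (g x - f n x))\<^sup>2) \<partial>lborel)
        = (\<integral>\<^sup>+x. liminf (\<lambda>m. ennreal ((norm (f m x - f n x))\<^sup>2)) \<partial>lborel)"
      using lim
    proof (intro nn_integral_cong_AE, eventually_elim)
      case (elim x)
      then have "(\<lambda>m. ennreal ((norm (f m x - f n x))\<^sup>2)) \<longlonglongrightarrow> ennreal ((norm (g x - f n x))\<^sup>2)"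
        by (intro tendsto_intros)
      then show ?case
        by (intro lim_imp_Liminf[symmetric]) simp_all
    qed
    also have "\<dots> \<le> liminf (\<lambda>m. \<integral>\<^sup>+x. ennreal ((norm (f m x - f n x))\<^sup>2) \<partial>lborel)"
      by (rule nn_integral_liminf) measurable
    also have "\<dots> \<le> ennreal (((1/2) ^ n)\<^sup>2)"
    proof (rule Liminf_le)
      have "(\<integral>\<^sup>+x. ennreal ((norm (f m x - f n x))\<^sup>2) \<partial>lborel) \<le> ennreal (((1/2) ^ n)\<^sup>2)" if "n \<le> m" for m
      proof -
        have "(\<integral>\<^sup>+x. ennreal ((norm (f m x - f n x))\<^sup>2) \<partial>lborel) = ennreal ((norm (abs_L2 (f m) - abs_L2 (f n)))\<^sup>2)"
          by (subst nn_norm_abs_L2) (auto intro: square_integrable_diff f simp: minus_abs_L2 f)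
        also have "\<dots> \<le> ennreal (((1/2) ^ n)\<^sup>2)"
          using close[OF that] by (intro ennreal_leI power_mono) auto
        finally show ?thesis .
      qed
      then show "\<forall>\<^sub>F m in sequentially. (\<integral>\<^sup>+x. ennreal ((norm (f m x - f n x))\<^sup>2) \<partial>lborel) \<le> ennreal (((1/2) ^ n)\<^sup>2)"
        by (auto simp: eventually_sequentially)
    qed simp
    finally show ?thesis .
  qed
  have si: "square_integrable (\<lambda>x. g x - f n x)" for n
    unfolding square_integrable_def
  proof
    show "integrable lborel (\<lambda>x. (norm (g x - f n x))\<^sup>2)"
      using nn[of n] by (intro integrableI_bounded) (auto simp: less_top[symmetric] top_unique)
  qed measurable
  have g: "square_integrable g"
    using square_integrable_add[OF si[of 0] f(1)[of 0]] by simp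
  have "norm (X (r n) - abs_L2 g) \<le> (1/2) ^ n" for n
  proof (rule power2_le_imp_le)
    have "ennreal ((norm (abs_L2 (\<lambda>x. g x - f n x)))\<^sup>2) \<le> ennreal (((1/2) ^ n)\<^sup>2)"
      using nn[of n] by (simp add: nn_norm_abs_L2[OF si])
    then have "(norm (abs_L2 (\<lambda>x. g x - f n x)))\<^sup>2 \<le> ((1/2) ^ n)\<^sup>2"
      by (subst (asm) ennreal_le_iff) auto
    also have "abs_L2 (\<lambda>x. g x - f n x) = abs_L2 g - X (r n)"
      by (simp add: minus_abs_L2 g f)
    finally show "(norm (X (r n) - abs_L2 g))\<^sup>2 \<le> ((1/2) ^ n)\<^sup>2"
      by (simp add: norm_minus_commute)
  qed simp
  then have "(\<lambda>n. X (r n) - abs_L2 g) \<longlonglongrightarrow> 0"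
    by (intro Lim_null_comparison[OF always_eventually[OF allI] LIMSEQ_power_zero[of "1/2 :: real"]]) auto
  then have "(X \<circ> r) \<longlonglongrightarrow> abs_L2 g"
    by (simp add: o_def LIM_zero_iff)
  from Cauchy_converges_subseq[OF X r this] show "convergent X"
    by (auto simp: convergent_def)
qed


section \<open>Test functions\<close>

definition smooth :: "(real \<Rightarrow> real) \<Rightarrow> bool"
  where "smooth f \<longleftrightarrow> (\<forall>n x. (deriv ^^ n) f field_differentiable (at x))"

text \<open>Smoothness is shown by exhibiting a class of differentiable functions that is stable under
  differentiation.\<close>

lemma smooth_coinduct:
  assumes "f \<in> F" "\<And>g x. g \<in> F \<Longrightarrow> g field_differentiable (at x)" "\<And>g. g \<in> F \<Longrightarrow> deriv g \<in> F"
  shows "smooth f"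
proof -
  have "(deriv ^^ n) f \<in> F" for n
    by (induction n) (auto intro: assms)
  then show ?thesis
    by (simp add: smooth_def assms(2))
qed

lemma smooth_deriv: "smooth f \<Longrightarrow> smooth (deriv f)"
  unfolding smooth_def by (metis comp_apply funpow_Suc_right)

lemma smooth_DERIV: "smooth f \<Longrightarrow> (f has_real_derivative deriv f x) (at x)"
  unfolding smooth_def by (metis DERIV_deriv_iff_field_differentiable funpow_0)

lemma smooth_differentiable: "smooth f \<Longrightarrow> f field_differentiable (at x)"
  using smooth_DERIV field_differentiable_def by blast

lemma smooth_affine:
  assumes "smooth f"
  shows "smooth (\<lambda>x. f (c * x + d))"
proof (rule smooth_coinduct[where F = "{\<lambda>x. k * g (c * x + d) | k g. smooth g}"])
  show "(\<lambda>x. f (c * x + d)) \<in> {\<lambda>x. k * g (c * x + d) | k g. smooth g}"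
    using assms by (auto intro!: exI[of _ 1] exI[of _ f])
next
  fix u assume "u \<in> {\<lambda>x. k * g (c * x + d) | k g. smooth g}"
  then obtain k g where u: "u = (\<lambda>x. k * g (c * x + d))" and g: "smooth g" by blast
  have D: "(u has_real_derivative (k * c) * deriv g (c * x + d)) (at x)" for x
    unfolding u
    by (auto intro!: derivative_eq_intros DERIV_chain'[OF _ smooth_DERIV[OF g]])
  then show "u field_differentiable (at x)" for x
    unfolding field_differentiable_def by blast
  have "deriv u = (\<lambda>x. (k * c) * deriv g (c * x + d))"
    using DERIV_imp_deriv[OF D] by blast
  then show "deriv u \<in> {\<lambda>x. k * g (c * x + d) | k g. smooth g}"
    using smooth_deriv[OF g] by blast
qed

text \<open>By the product rule, sums are needed to make the class of products of smooth functions stable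
  under differentiation.\<close>

inductive_set sums_of_products :: "(real \<Rightarrow> real) set" where
  product: "smooth f \<Longrightarrow> smooth g \<Longrightarrow> (\<lambda>x. f x * g x) \<in> sums_of_products"
| sum: "u \<in> sums_of_products \<Longrightarrow> v \<in> sums_of_products \<Longrightarrow> (\<lambda>x. u x + v x) \<in> sums_of_products"

lemma sums_of_products_deriv:
  "u \<in> sums_of_products \<Longrightarrow> \<exists>u'\<in>sums_of_products. \<forall>x. (u has_real_derivative u' x) (at x)"
proof (induction rule: sums_of_products.induct)
  case (product f g)
  let ?D = "\<lambda>x. deriv f x * g x + f x * deriv g x"
  have "?D \<in> sums_of_products"
    using product by (intro sums_of_products.intros smooth_deriv)
  moreover have "((\<lambda>x. f x * g x) has_real_derivative ?D x) (at x)" for x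
    using DERIV_mult[OF smooth_DERIV[OF product(1)] smooth_DERIV[OF product(2)], of x]
    by (simp add: algebra_simps)
  ultimately show ?case by (intro bexI[of _ ?D] allI)
next
  case (sum u v)
  then obtain u' v' where "u' \<in> sums_of_products" "v' \<in> sums_of_products"
      "\<And>x. (u has_real_derivative u' x) (at x)" "\<And>x. (v has_real_derivative v' x) (at x)"
    by blast
  then show ?case
    by (intro bexI[of _ "\<lambda>x. u' x + v' x"] allI DERIV_add sums_of_products.sum)
qed

lemma smooth_mult:
  assumes "smooth f" "smooth g"
  shows "smooth (\<lambda>x. f x * g x)"
proof (rule smooth_coinduct[where F = sums_of_products])
  fix u assume "u \<in> sums_of_products"
  then obtain u' where u': "u' \<in> sums_of_products" "\<And>x. (u has_real_derivative u' x) (at x)"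
    using sums_of_products_deriv by blast
  then show "u field_differentiable (at x)" for x
    unfolding field_differentiable_def by blast
  have "deriv u = u'"
    using DERIV_imp_deriv[OF u'(2)] by blast
  with u' show "deriv u \<in> sums_of_products" by simp
qed (rule sums_of_products.product[OF assms])

text \<open>For \<open>p = 1\<close>, the standard smooth function that is zero up to the origin and positive beyond
  it.  The polynomial factor in \<open>1 / x\<close> makes the class stable under differentiation.\<close>

definition flat_exp :: "real poly \<Rightarrow> real \<Rightarrow> real"
  where "flat_exp p x = (if 0 < x then poly p (1 / x) * exp (- (1 / x)) else 0)"

lemma poly_exp_tendsto_0: "((\<lambda>y. poly p y * exp (- y)) \<longlongrightarrow> (0::real)) at_top"
proof -
  have "((\<lambda>y. \<Sum>i\<le>degree p. coeff p i * (y ^ i / exp y)) \<longlongrightarrow> (\<Sum>i\<le>degree p. coeff p i * 0)) at_top"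
    by (intro tendsto_sum tendsto_mult tendsto_const tendsto_power_div_exp_0)
  then show ?thesis
    by (simp add: poly_altdef sum_distrib_right exp_minus divide_inverse mult.assoc)
qed

lemma flat_exp_DERIV:
  "(flat_exp p has_real_derivative flat_exp ([:0, 0, 1:] * (p - pderiv p)) x) (at x)"
proof -
  consider "0 < x" | "x < 0" | "x = 0" by linarith
  then show ?thesis
  proof cases
    case 1
    have "((\<lambda>x. poly p (1 / x) * exp (- (1 / x))) has_real_derivative
        flat_exp ([:0, 0, 1:] * (p - pderiv p)) x) (at x)"
      using 1 by (auto intro!: derivative_eq_intros DERIV_chain'[OF _ poly_DERIV]
          simp: flat_exp_def field_simps power2_eq_square)
    then show ?thesis
      by (rule has_field_derivative_transform_within_open[where S = "{0<..}"])
        (use 1 in \<open>auto simp: flat_exp_def\<close>)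
  next
    case 2
    have "((\<lambda>x. 0) has_real_derivative 0) (at x)" by simp
    then have "(flat_exp p has_real_derivative 0) (at x)"
      by (rule has_field_derivative_transform_within_open[where S = "{..<0}"])
        (use 2 in \<open>auto simp: flat_exp_def\<close>)
    with 2 show ?thesis by (simp add: flat_exp_def)
  next
    case 3
    have "((\<lambda>h. flat_exp p h / h) \<longlongrightarrow> 0) (at 0)"
    proof (rule filterlim_split_at)
      have "((\<lambda>h. 0) \<longlongrightarrow> (0::real)) (at_left 0)" by simp
      then show "((\<lambda>h. flat_exp p h / h) \<longlongrightarrow> 0) (at_left 0)"
        by (rule Lim_transform_eventually)
          (auto simp: eventually_at_filter flat_exp_def)
      have "((\<lambda>h. poly (pCons 0 p) (inverse h) * exp (- inverse h)) \<longlongrightarrow> 0) (at_right 0)"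
        by (rule filterlim_compose[OF poly_exp_tendsto_0 filterlim_inverse_at_top_right])
      then show "((\<lambda>h. flat_exp p h / h) \<longlongrightarrow> 0) (at_right 0)"
        by (rule Lim_transform_eventually)
          (auto simp: eventually_at_filter flat_exp_def field_simps)
    qed
    then show ?thesis
      using 3 by (simp add: DERIV_def flat_exp_def)
  qed
qed

lemma smooth_flat_exp: "smooth (flat_exp p)"
proof (rule smooth_coinduct[where F = "range flat_exp"])
  fix u assume "u \<in> range flat_exp"
  then obtain q where u: "u = flat_exp q" by blast
  show "u field_differentiable (at x)" for x
    unfolding u field_differentiable_def using flat_exp_DERIV by blast
  have "deriv (flat_exp q) = flat_exp ([:0, 0, 1:] * (q - pderiv q))"
    using DERIV_imp_deriv[OF flat_exp_DERIV] by blast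
  then show "deriv u \<in> range flat_exp"
    unfolding u by blast
qed simp

lemma test_function_iff: "test_function \<phi> \<longleftrightarrow> smooth \<phi> \<and> compact (closure {x. \<phi> x \<noteq> 0})"
  by (simp add: test_function_def smooth_def)

lemma test_function_smooth: "test_function \<phi> \<Longrightarrow> smooth \<phi>"
  by (simp add: test_function_iff)

lemma test_functionI:
  assumes "smooth \<phi>" "\<And>x. R < \<bar>x\<bar> \<Longrightarrow> \<phi> x = 0"
  shows "test_function \<phi>"
proof -
  have "{x. \<phi> x \<noteq> 0} \<subseteq> {-R..R}"
    using assms(2) by (force simp: abs_le_iff not_less[symmetric])
  then have "bounded {x. \<phi> x \<noteq> 0}"
    using bounded_closed_interval bounded_subset by blast
  with assms(1) show ?thesis
    by (simp add: test_function_iff compact_closure)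
qed

lemma test_function_support:
  assumes "test_function \<phi>"
  obtains R where "0 \<le> R" "\<And>x. R < \<bar>x\<bar> \<Longrightarrow> \<phi> x = 0"
proof -
  have "bounded {x. \<phi> x \<noteq> 0}"
    using assms by (simp add: test_function_iff compact_closure)
  then obtain R where "\<And>x. \<phi> x \<noteq> 0 \<Longrightarrow> \<bar>x\<bar> \<le> R"
    by (auto simp: bounded_iff)
  then show ?thesis
    using that[of "max R 0"] by fastforce
qed

lemma test_function_continuous: "test_function \<phi> \<Longrightarrow> continuous_on UNIV \<phi>"
  by (auto simp: test_function_iff intro!: continuous_at_imp_continuous_on
      field_differentiable_imp_continuous_at smooth_differentiable)

lemma test_function_bounded:
  assumes "test_function \<phi>"
  obtains M where "0 \<le> M" "\<And>x. \<bar>\<phi> x\<bar> \<le> M"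
proof -
  obtain R where R: "0 \<le> R" "\<And>x. R < \<bar>x\<bar> \<Longrightarrow> \<phi> x = 0"
    using test_function_support[OF assms] by blast
  have "bounded (\<phi> ` {-R..R})"
    by (intro compact_imp_bounded compact_continuous_image continuous_on_subset[OF test_function_continuous[OF assms]]) auto
  then obtain M where M: "\<And>x. x \<in> {-R..R} \<Longrightarrow> \<bar>\<phi> x\<bar> \<le> M"
    unfolding bounded_iff by (metis imageI real_norm_def)
  have "\<bar>\<phi> x\<bar> \<le> max M 0" for x
  proof (cases "R < \<bar>x\<bar>")
    case False
    then have "x \<in> {-R..R}" by auto
    from M[OF this] show ?thesis by linarith
  qed (simp add: R(2))
  then show ?thesis
    using that[of "max M 0"] by simp
qed

lemma test_function_deriv:
  assumes "test_function \<phi>"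
  shows "test_function (deriv \<phi>)"
proof -
  obtain R where R: "0 \<le> R" "\<And>x. R < \<bar>x\<bar> \<Longrightarrow> \<phi> x = 0"
    using test_function_support[OF assms] by blast
  have "deriv \<phi> x = 0" if "R < \<bar>x\<bar>" for x
  proof (rule DERIV_imp_deriv)
    have "open {x. R < \<bar>x\<bar>}"
      by (intro open_Collect_less continuous_intros)
    with that show "(\<phi> has_real_derivative 0) (at x)"
      using has_field_derivative_transform_within_open[of "\<lambda>_. 0" 0 x "{x. R < \<bar>x\<bar>}" \<phi>] R by simp
  qed
  then show ?thesis
    using assms by (intro test_functionI[of _ R] smooth_deriv) (auto simp: test_function_iff)
qed

lemma test_function_funpow_deriv: "test_function \<phi> \<Longrightarrow> test_function ((deriv ^^ n) \<phi>)"
  by (induction n) (auto intro: test_function_deriv)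

lemma deriv_shift: "deriv (\<lambda>x. f (x - h)) = (\<lambda>x. deriv f (x - h :: real) :: real)"
  using DERIV_shift[of f _ _ "- h"] by (simp add: deriv_def fun_eq_iff)

lemma test_function_shift:
  assumes "test_function \<phi>"
  shows "test_function (\<lambda>x. \<phi> (x - h))"
proof -
  obtain R where R: "0 \<le> R" "\<And>x. R < \<bar>x\<bar> \<Longrightarrow> \<phi> x = 0"
    using test_function_support[OF assms] by blast
  show ?thesis
  proof (rule test_functionI[of _ "R + \<bar>h\<bar>"])
    show "smooth (\<lambda>x. \<phi> (x - h))"
      using smooth_affine[OF test_function_smooth[OF assms], of 1 "- h"] by simp
    show "\<phi> (x - h) = 0" if "R + \<bar>h\<bar> < \<bar>x\<bar>" for x
      using that by (intro R(2)) linarith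
  qed
qed

text \<open>A product of two copies of \<open>exp (- 1 / x)\<close>, one for each end of the interval.  Dilating them makes
  their values tend to one inside the interval.\<close>

lemma test_functions_tendsto_indicator:
  obtains \<psi> where "\<And>n. test_function (\<psi> n)" "\<And>n x. \<bar>\<psi> n x\<bar> \<le> indicator {a<..<b} x"
    "\<And>x. (\<lambda>n. \<psi> n x) \<longlonglongrightarrow> indicator {a<..<b} x"
proof
  define s where "s = flat_exp 1"
  have s: "s x = (if 0 < x then exp (- (1 / x)) else 0)" for x
    by (simp add: s_def flat_exp_def)
  let ?\<psi> = "\<lambda>n x. s (real (Suc n) * (x - a)) * s (real (Suc n) * (b - x))"
  have s01: "0 \<le> s x" "s x \<le> 1" for x
    by (auto simp: s)
  have s0: "s (real (Suc n) * x) = 0" if "x \<le> 0" for n x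
    using that by (auto simp: s zero_less_mult_iff simp del: of_nat_Suc)
  show bound: "\<bar>?\<psi> n x\<bar> \<le> indicator {a<..<b} x" for n x
  proof (cases "x \<in> {a<..<b}")
    case True
    then show ?thesis
      using s01 by (simp add: abs_mult mult_le_one del: of_nat_Suc)
  next
    case False
    then have "x - a \<le> 0 \<or> b - x \<le> 0" by auto
    then show ?thesis
      using s0 by (auto simp del: of_nat_Suc)
  qed
  show "test_function (?\<psi> n)" for n
  proof (rule test_functionI[of _ "\<bar>a\<bar> + \<bar>b\<bar>"])
    have "smooth (\<lambda>x. s (real (Suc n) * x + - real (Suc n) * a) * s (- real (Suc n) * x + real (Suc n) * b))"
      unfolding s_def by (intro smooth_mult smooth_affine smooth_flat_exp)
    then show "smooth (?\<psi> n)"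
      by (simp add: right_diff_distrib del: of_nat_Suc)
    fix x :: real assume "\<bar>a\<bar> + \<bar>b\<bar> < \<bar>x\<bar>"
    then have "x \<notin> {a<..<b}" by auto
    then show "?\<psi> n x = 0"
      using bound[of n x] by (simp del: of_nat_Suc mult_eq_0_iff)
  qed
  have step: "(\<lambda>n. s (real (Suc n) * y)) \<longlonglongrightarrow> (if 0 < y then 1 else 0)" for y
  proof (cases "0 < y")
    case True
    have "(\<lambda>n. exp (- ((1 / real (Suc n)) * (1 / y)))) \<longlonglongrightarrow> exp (- (0 * (1 / y)))"
      by (intro tendsto_intros LIMSEQ_Suc[OF lim_1_over_n])
    with True show ?thesis
      by (simp add: s zero_less_mult_iff del: of_nat_Suc)
  next
    case False
    then have "\<not> 0 < real (Suc n) * y" for n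
      by (simp add: zero_less_mult_iff del: of_nat_Suc)
    with False show ?thesis
      by (simp add: s del: of_nat_Suc)
  qed
  show "(\<lambda>n. ?\<psi> n x) \<longlonglongrightarrow> indicator {a<..<b} x" for x
  proof -
    have "(\<lambda>n. ?\<psi> n x) \<longlonglongrightarrow> (if 0 < x - a then 1 else 0) * (if 0 < b - x then 1 else 0)"
      by (intro tendsto_mult step)
    also have "(if 0 < x - a then 1 else 0) * (if 0 < b - x then 1 else 0) = (indicator {a<..<b} x :: real)"
      by (simp add: indicator_def)
    finally show ?thesis .
  qed
qed


section \<open>Weak derivatives as relations in a Hilbert space\<close>

lemma square_integrable_bounded_support:
  fixes f :: "real \<Rightarrow> 'a::{real_inner,banach,second_countable_topology}"
  assumes [measurable]: "f \<in> borel_measurable lborel"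
    and C: "\<And>x. norm (f x) \<le> C" and R: "0 \<le> R" "\<And>x. R < \<bar>x\<bar> \<Longrightarrow> f x = 0"
  shows "square_integrable f" "(norm (abs_L2 f))\<^sup>2 \<le> C\<^sup>2 * (2 * R)"
proof -
  have bound: "(norm (f x))\<^sup>2 \<le> C\<^sup>2 * indicator {-R..R} x" for x
    using power_mono[OF C[of x], of 2] R(2)[of x] by (cases "R < \<bar>x\<bar>") (auto simp: indicator_def)
  have int: "integrable lborel (\<lambda>x. C\<^sup>2 * indicator {-R..R} x)"
    by (intro integrable_mult_right integrable_real_indicator emeasure_bounded_finite) auto
  show si: "square_integrable f"
    unfolding square_integrable_def
  proof
    show "integrable lborel (\<lambda>x. (norm (f x))\<^sup>2)"
      by (rule Bochner_Integration.integrable_bound[OF int]) (use bound in auto)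
  qed measurable
  have "(norm (abs_L2 f))\<^sup>2 \<le> (\<integral>x. C\<^sup>2 * indicator {-R..R} x \<partial>lborel)"
    unfolding norm_abs_L2[OF si] using si int bound
    by (intro integral_mono) (auto simp: square_integrable_def)
  also have "\<dots> = C\<^sup>2 * (2 * R)"
    using R(1) by simp
  finally show "(norm (abs_L2 f))\<^sup>2 \<le> C\<^sup>2 * (2 * R)" .
qed

definition tensor :: "(real \<Rightarrow> real) \<Rightarrow> 'a \<Rightarrow> 'a::{real_inner,banach,second_countable_topology} L2"
  where "tensor \<phi> e = abs_L2 (\<lambda>x. \<phi> x *\<^sub>R e)"

lemma test_function_measurable: "test_function \<phi> \<Longrightarrow> \<phi> \<in> borel_measurable borel"
  by (intro borel_measurable_continuous_onI test_function_continuous)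

lemma square_integrable_tensor:
  assumes "test_function \<phi>"
  shows "square_integrable (\<lambda>x. \<phi> x *\<^sub>R e)"
proof -
  obtain M where M: "0 \<le> M" "\<And>x. \<bar>\<phi> x\<bar> \<le> M"
    using test_function_bounded[OF assms] by blast
  obtain R where R: "0 \<le> R" "\<And>x. R < \<bar>x\<bar> \<Longrightarrow> \<phi> x = 0"
    using test_function_support[OF assms] by blast
  have [measurable]: "\<phi> \<in> borel_measurable borel"
    using assms by (rule test_function_measurable)
  show ?thesis
    by (rule square_integrable_bounded_support[where C = "M * norm e" and R = R])
      (use M R in \<open>auto intro!: mult_right_mono\<close>)
qed

lemma integrable_test_function_scaleR:
  assumes \<phi>: "test_function \<phi>" and f: "square_integrable f"
  shows "integrable lborel (\<lambda>x. \<phi> x *\<^sub>R f x)"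
proof (rule Bochner_Integration.integrable_bound)
  have [measurable]: "\<phi> \<in> borel_measurable borel" "f \<in> borel_measurable borel"
    using \<phi> f by (auto simp: square_integrable_def intro: test_function_measurable)
  show "(\<lambda>x. \<phi> x *\<^sub>R f x) \<in> borel_measurable lborel" by measurable
  show "integrable lborel (\<lambda>x. (norm (\<phi> x *\<^sub>R (1::real)))\<^sup>2 + (norm (f x))\<^sup>2)"
    using square_integrable_tensor[OF \<phi>, of "1::real"] f by (auto simp: square_integrable_def)
  have "\<bar>\<phi> x\<bar> * norm (f x) \<le> \<bar>\<phi> x\<bar>\<^sup>2 + (norm (f x))\<^sup>2" for x
  proof -
    have "\<bar>\<phi> x\<bar> * norm (f x) \<le> 2 * \<bar>\<phi> x\<bar> * norm (f x)" by simp
    also have "\<dots> \<le> \<bar>\<phi> x\<bar>\<^sup>2 + (norm (f x))\<^sup>2" by (rule sum_squares_bound)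
    finally show ?thesis .
  qed
  then show "AE x in lborel. norm (\<phi> x *\<^sub>R f x) \<le> norm ((norm (\<phi> x *\<^sub>R (1::real)))\<^sup>2 + (norm (f x))\<^sup>2)"
    by simp
qed

lemma inner_tensor:
  assumes \<phi>: "test_function \<phi>" and f: "square_integrable f"
  shows "inner (abs_L2 f) (tensor \<phi> e) = inner (\<integral>x. \<phi> x *\<^sub>R f x \<partial>lborel) e"
proof -
  have "inner (abs_L2 f) (tensor \<phi> e) = (\<integral>x. inner (\<phi> x *\<^sub>R f x) e \<partial>lborel)"
    unfolding tensor_def by (simp add: inner_abs_L2 f square_integrable_tensor[OF \<phi>])
  also have "\<dots> = inner (\<integral>x. \<phi> x *\<^sub>R f x \<partial>lborel) e"
    by (rule integral_inner_left) (rule integrable_test_function_scaleR[OF \<phi> f])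
  finally show ?thesis .
qed

text \<open>Testing against all \<open>e\<close> as well turns the vector-valued integrals into inner products.  From here
  on, weak derivatives are a matter of orthogonality.\<close>

lemma weak_derivative_iff:
  "weak_derivative n u v \<longleftrightarrow> (\<forall>\<phi> e. test_function \<phi> \<longrightarrow>
    inner u (tensor ((deriv ^^ n) \<phi>) e) = (- 1) ^ n * inner v (tensor \<phi> e))"
proof -
  obtain f where f: "square_integrable f" "u = abs_L2 f" by (rule L2_cases)
  obtain g where g: "square_integrable g" "v = abs_L2 g" by (rule L2_cases)
  have "(\<integral>x. (deriv ^^ n) \<phi> x *\<^sub>R f x \<partial>lborel) = (- 1) ^ n *\<^sub>R (\<integral>x. \<phi> x *\<^sub>R g x \<partial>lborel) \<longleftrightarrow>
    (\<forall>e. inner u (tensor ((deriv ^^ n) \<phi>) e) = (- 1) ^ n * inner v (tensor \<phi> e))"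
    if \<phi>: "test_function \<phi>" for \<phi>
    unfolding f(2) g(2) inner_tensor[OF \<phi> g(1)]
      inner_tensor[OF test_function_funpow_deriv[OF \<phi>] f(1)]
      inner_scaleR_left[symmetric] vector_eq_rdot ..
  then show ?thesis
    unfolding f(2) g(2) weak_derivative.abs_eq[OF L2_eq_refl[THEN iffD2, OF f(1)] L2_eq_refl[THEN iffD2, OF g(1)]]
    by blast
qed

text \<open>The fundamental lemma of the calculus of variations.  The integrals over intervals vanish by
  dominated convergence, and the intervals generate the Borel sets.\<close>

lemma eq_zero_if_orthogonal_to_tensors:
  fixes w :: "'a::{real_inner,banach,second_countable_topology} L2"
  assumes orth: "\<And>\<phi> e. test_function \<phi> \<Longrightarrow> inner w (tensor \<phi> e) = 0"
  shows "w = 0"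
proof -
  obtain f where f: "square_integrable f" "w = abs_L2 f" by (rule L2_cases)
  have [measurable]: "f \<in> borel_measurable borel"
    using f(1) by (auto simp: square_integrable_def)
  have test: "(\<integral>x. \<phi> x *\<^sub>R f x \<partial>lborel) = 0" if "test_function \<phi>" for \<phi>
    using orth[OF that] unfolding f(2) inner_tensor[OF that f(1)]
    by (metis inner_eq_zero_iff)
  have int: "integrable lborel (\<lambda>x. indicator {a<..<b} x *\<^sub>R f x)" for a b
  proof (rule Bochner_Integration.integrable_bound)
    show "integrable lborel (\<lambda>x. indicator {a<..<b} x + (norm (f x))\<^sup>2)"
      using f(1) emeasure_bounded_finite[of "{a<..<b}"]
      by (intro Bochner_Integration.integrable_add integrable_real_indicator)
        (auto simp: square_integrable_def bounded_box)
    have "norm (f x) \<le> 1 + (norm (f x))\<^sup>2" for x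
      using sum_squares_bound[of 1 "norm (f x)"] norm_ge_zero[of "f x"]
      unfolding one_power2 mult_1_right by linarith
    then show "AE x in lborel. norm (indicator {a<..<b} x *\<^sub>R f x) \<le> norm (indicator {a<..<b} x + (norm (f x))\<^sup>2)"
      by (auto simp: indicator_def)
  qed measurable
  have interval: "(\<integral>x. indicator {a<..<b} x *\<^sub>R f x \<partial>lborel) = 0" for a b
  proof -
    obtain \<psi> where \<psi>: "\<And>n. test_function (\<psi> n)" "\<And>n x. \<bar>\<psi> n x\<bar> \<le> indicator {a<..<b} x"
      "\<And>x. (\<lambda>n. \<psi> n x) \<longlonglongrightarrow> indicator {a<..<b} x"
      using test_functions_tendsto_indicator[of a b] by blast
    have [measurable]: "\<psi> n \<in> borel_measurable borel" for n
      using \<psi>(1) by (rule test_function_measurable)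
    have "(\<lambda>n. \<integral>x. \<psi> n x *\<^sub>R f x \<partial>lborel) \<longlonglongrightarrow> (\<integral>x. indicator {a<..<b} x *\<^sub>R f x \<partial>lborel)"
    proof (rule integral_dominated_convergence[where w = "\<lambda>x. norm (indicator {a<..<b} x *\<^sub>R f x)"])
      show "AE x in lborel. (\<lambda>n. \<psi> n x *\<^sub>R f x) \<longlonglongrightarrow> indicator {a<..<b} x *\<^sub>R f x"
        by (intro AE_I2 tendsto_scaleR \<psi>(3) tendsto_const)
      show "AE x in lborel. norm (\<psi> n x *\<^sub>R f x) \<le> norm (indicator {a<..<b} x *\<^sub>R f x)" for n
        using \<psi>(2) by (auto intro!: mult_right_mono)
      show "integrable lborel (\<lambda>x. norm (indicator {a<..<b} x *\<^sub>R f x))"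
        by (intro integrable_norm int)
    qed measurable
    then show ?thesis
      by (simp add: test[OF \<psi>(1)] LIMSEQ_const_iff)
  qed
  have "AE x in lborel. indicator {-real n<..<real n} x *\<^sub>R f x = 0" for n
  proof (rule sigma_finite_measure.density_zero[OF lborel.sigma_finite_measure_axioms])
    let ?g = "\<lambda>x. indicator {-real n<..<real n} x *\<^sub>R f x"
    show g: "integrable lborel ?g" by (rule int)
    fix A :: "real set" assume "A \<in> sets lborel"
    moreover have "sets (borel :: real measure) = sigma_sets UNIV (range (\<lambda>(a, b). {a<..<b}))"
      by (subst borel_eq_box) (simp add: case_prod_unfold)
    ultimately have A: "A \<in> sigma_sets UNIV (range (\<lambda>(a, b). {a<..<b}))"
      by simp
    have S: "Int_stable (range (\<lambda>(a, b). {a<..<b::real}))"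
      unfolding Int_stable_def by (auto simp: Int_greaterThanLessThan)
    have "range (\<lambda>(a, b). {a<..<b::real}) \<subseteq> Pow UNIV"
      by simp
    with S have "set_lebesgue_integral lborel A ?g = 0 \<and> A \<in> sets lborel"
      using A
    proof (induction rule: sigma_sets_induct_disjoint)
      case (basic B)
      then obtain a b where B: "B = {a<..<b}" by auto
      have eq: "indicator B x *\<^sub>R ?g x = indicator {max a (- real n)<..<min b (real n)} x *\<^sub>R f x" for x
        by (auto simp: B indicator_def)
      then show ?case
        unfolding set_lebesgue_integral_def eq using interval by (simp add: B)
    next
      case empty
      show ?case by (simp add: set_lebesgue_integral_def)
    next
      case (compl B)
      then have B: "B \<in> sets lborel" "set_lebesgue_integral lborel B ?g = 0" by auto
      have "set_lebesgue_integral lborel (UNIV - B) ?g = (\<integral>x. ?g x - indicator B x *\<^sub>R ?g x \<partial>lborel)"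
        unfolding set_lebesgue_integral_def by (intro Bochner_Integration.integral_cong) (auto simp: indicator_def)
      also have "\<dots> = (\<integral>x. ?g x \<partial>lborel) - (\<integral>x. indicator B x *\<^sub>R ?g x \<partial>lborel)"
        by (rule Bochner_Integration.integral_diff[OF g integrable_mult_indicator[OF B(1) g]])
      also have "\<dots> = 0"
        using B(2) interval by (simp add: set_lebesgue_integral_def)
      finally show ?case using B(1) by auto
    next
      case (union F)
      then have F: "\<And>i. F i \<in> sets lborel" "\<And>i. set_lebesgue_integral lborel (F i) ?g = 0" by auto
      have U: "(\<Union>i. F i) \<in> sets lborel"
        using F(1) by (intro sets.countable_UN) auto
      have "set_lebesgue_integral lborel (\<Union>i. F i) ?g = (\<Sum>i. set_lebesgue_integral lborel (F i) ?g)"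
      proof (rule lebesgue_integral_countable_add)
        show "F i \<inter> F j = {}" if "i \<noteq> j" for i j
          using union(1) that by (auto simp: disjoint_family_on_def)
        show "set_integrable lborel (\<Union>i. F i) ?g"
          unfolding set_integrable_def by (rule integrable_mult_indicator[OF U g])
      qed (rule F)
      with F(2) U show ?case by simp
    qed
    then show "set_lebesgue_integral lborel A ?g = 0" ..
  qed
  then have "AE x in lborel. \<forall>n. indicator {-real n<..<real n} x *\<^sub>R f x = 0"
    unfolding AE_all_countable by blast
  then have "AE x in lborel. f x = 0"
  proof eventually_elim
    case (elim x)
    obtain n where "\<bar>x\<bar> < real n" using reals_Archimedean2 by blast
    then show ?case using elim[rule_format, of n] by (auto simp: indicator_def split: if_splits)
  qed
  then have "abs_L2 f = abs_L2 (\<lambda>x. 0)"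
    by (intro abs_L2_eqI f(1)) auto
  then show ?thesis
    by (simp add: f(2) zero_L2_def)
qed

lemma weak_derivative_unique: "weak_derivative n u v \<Longrightarrow> weak_derivative n u v' \<Longrightarrow> v = v'"
proof -
  assume *: "weak_derivative n u v" "weak_derivative n u v'"
  have "v - v' = 0"
  proof (rule eq_zero_if_orthogonal_to_tensors)
    fix \<phi> and e :: 'a assume "test_function \<phi>"
    then have "(- 1) ^ n * inner v (tensor \<phi> e) = (- 1) ^ n * inner v' (tensor \<phi> e)"
      using * unfolding weak_derivative_iff by metis
    then show "inner (v - v') (tensor \<phi> e) = 0"
      by (simp add: inner_diff_left)
  qed
  then show ?thesis by simp
qed

lemma weak_derivative_add:
  "weak_derivative n u v \<Longrightarrow> weak_derivative n u' v' \<Longrightarrow> weak_derivative n (u + u') (v + v')"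
  and weak_derivative_scaleR: "weak_derivative n u v \<Longrightarrow> weak_derivative n (r *\<^sub>R u) (r *\<^sub>R v)"
  by (auto simp: weak_derivative_iff inner_simps algebra_simps)

lemma weak_derivative_zero: "weak_derivative n 0 0"
  by (simp add: weak_derivative_iff)

lemma weak_derivative_2:
  assumes "weak_derivative 1 u v"
  shows "weak_derivative 2 u w \<longleftrightarrow> weak_derivative 1 v w"
proof -
  have "inner u (tensor (deriv (deriv \<phi>)) e) = - inner v (tensor (deriv \<phi>) e)" if "test_function \<phi>" for \<phi> e
    using assms test_function_deriv[OF that] by (simp add: weak_derivative_iff)
  then show ?thesis
    unfolding weak_derivative_iff by (simp add: numeral_2_eq_2) (metis minus_equation_iff)
qed


section \<open>Integration by parts\<close>

lemma smooth_taylor: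
  assumes \<phi>: "smooth \<phi>" and M: "\<And>x. \<bar>deriv (deriv \<phi>) x\<bar> \<le> M"
  shows "\<bar>\<phi> (y - k) - \<phi> y + k * deriv \<phi> y\<bar> \<le> M * k\<^sup>2"
proof -
  have M0: "0 \<le> M" using M[of 0] by linarith
  have comp: "((\<lambda>t. f (y - t * k)) has_vector_derivative deriv f (y - t * k) * - k) (at t)"
    if "smooth f" for f t y k
    unfolding has_real_derivative_iff_has_vector_derivative[symmetric]
    by (rule DERIV_chain'[OF _ smooth_DERIV[OF that]]) (auto intro!: derivative_eq_intros)
  have first: "\<bar>deriv \<phi> (y - k) - deriv \<phi> y\<bar> \<le> M * \<bar>k\<bar>" for y k
  proof -
    have "norm (deriv \<phi> (y - 1 * k) - deriv \<phi> (y - 0 * k)) \<le> M * \<bar>k\<bar>"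
      by (rule norm_increment_bound[OF comp[OF smooth_deriv[OF \<phi>]]])
        (use M in \<open>auto simp: abs_mult intro!: mult_right_mono\<close>)
    then show ?thesis by simp
  qed
  let ?u = "\<lambda>t. \<phi> (y - t * k) + t * (k * deriv \<phi> y)"
  have "norm (?u 1 - ?u 0) \<le> M * k\<^sup>2"
  proof (rule norm_increment_bound)
    fix t :: real assume t: "0 \<le> t" "t \<le> 1"
    have "((\<lambda>t. t * (k * deriv \<phi> y)) has_vector_derivative k * deriv \<phi> y) (at t)"
      unfolding has_real_derivative_iff_has_vector_derivative[symmetric]
      by (auto intro!: derivative_eq_intros)
    from has_vector_derivative_add[OF comp[OF \<phi>] this]
    show "(?u has_vector_derivative deriv \<phi> (y - t * k) * - k + k * deriv \<phi> y) (at t)" .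
    have "deriv \<phi> (y - t * k) * - k + k * deriv \<phi> y = - (k * (deriv \<phi> (y - t * k) - deriv \<phi> y))"
      by (simp add: algebra_simps)
    then have "norm (deriv \<phi> (y - t * k) * - k + k * deriv \<phi> y) = \<bar>k\<bar> * \<bar>deriv \<phi> (y - t * k) - deriv \<phi> y\<bar>"
      by (simp add: abs_mult)
    also have "\<dots> \<le> \<bar>k\<bar> * (M * \<bar>t * k\<bar>)"
      by (intro mult_left_mono first) simp
    also have "\<dots> = t * (M * k\<^sup>2)"
      using t by (simp add: abs_mult power2_eq_square mult_ac)
    also have "\<dots> \<le> M * k\<^sup>2"
      using t M0 by (intro mult_left_le_one_le) auto
    finally show "norm (deriv \<phi> (y - t * k) * - k + k * deriv \<phi> y) \<le> M * k\<^sup>2" .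
  qed
  then show ?thesis
    by (simp add: algebra_simps)
qed

text \<open>The remainder of the first-order Taylor expansion of \<open>\<phi>\<close> is at most a multiple of \<open>k\<^sup>2\<close> and supported
  in a fixed interval for \<open>\<bar>k\<bar> \<le> 1\<close>, so it is small in the norm of the Bochner space.\<close>

lemma tensor_translate_DERIV:
  assumes \<phi>: "test_function \<phi>"
  shows "((\<lambda>h. inner w (tensor (\<lambda>x. \<phi> (x - h)) e)) has_real_derivative
    - inner w (tensor (\<lambda>x. deriv \<phi> (x - h)) e)) (at h)"
proof -
  let ?g = "\<lambda>h. inner w (tensor (\<lambda>x. \<phi> (x - h)) e)"
  let ?d = "- inner w (tensor (\<lambda>x. deriv \<phi> (x - h)) e)"
  note \<phi>' = test_function_deriv[OF \<phi>]
  obtain M where M: "0 \<le> M" "\<And>x. \<bar>deriv (deriv \<phi>) x\<bar> \<le> M"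
    using test_function_bounded[OF test_function_deriv[OF \<phi>']] by blast
  obtain R1 where R1: "0 \<le> R1" "\<And>x. R1 < \<bar>x\<bar> \<Longrightarrow> \<phi> x = 0"
    using test_function_support[OF \<phi>] by blast
  obtain R2 where R2: "0 \<le> R2" "\<And>x. R2 < \<bar>x\<bar> \<Longrightarrow> deriv \<phi> x = 0"
    using test_function_support[OF \<phi>'] by blast
  define R where "R = R1 + R2 + \<bar>h\<bar> + 1"
  have R: "0 \<le> R" using R1 R2 by (simp add: R_def)
  define K where "K = norm w * (M * norm e * sqrt (2 * R))"
  have bound: "\<bar>(?g (h + k) - ?g h) / k - ?d\<bar> \<le> K * \<bar>k\<bar>" if k: "k \<noteq> 0" "\<bar>k\<bar> \<le> 1" for k
  proof -
    let ?\<psi> = "\<lambda>x. \<phi> (x - h - k) - \<phi> (x - h) + k * deriv \<phi> (x - h)"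
    have [measurable]: "\<phi> \<in> borel_measurable borel" "deriv \<phi> \<in> borel_measurable borel"
      using \<phi> \<phi>' by (auto intro: test_function_measurable)
    have sq: "(norm (abs_L2 (\<lambda>x. ?\<psi> x *\<^sub>R e)))\<^sup>2 \<le> (M * k\<^sup>2 * norm e)\<^sup>2 * (2 * R)"
    proof (rule square_integrable_bounded_support(2))
      show "norm (?\<psi> x *\<^sub>R e) \<le> M * k\<^sup>2 * norm e" for x
        using smooth_taylor[OF test_function_smooth[OF \<phi>] M(2), of "x - h" k]
        by (simp add: mult_right_mono)
      fix x assume x: "R < \<bar>x\<bar>"
      have "\<phi> (x - h - k) = 0" "\<phi> (x - h) = 0" "deriv \<phi> (x - h) = 0"
        using x k R1(1) R2(1) by (auto intro!: R1(2) R2(2) simp: R_def)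
      then show "?\<psi> x *\<^sub>R e = 0" by simp
    qed (use R in auto)
    have "norm (abs_L2 (\<lambda>x. ?\<psi> x *\<^sub>R e)) \<le> M * k\<^sup>2 * norm e * sqrt (2 * R)"
    proof (rule power2_le_imp_le)
      show "(norm (abs_L2 (\<lambda>x. ?\<psi> x *\<^sub>R e)))\<^sup>2 \<le> (M * k\<^sup>2 * norm e * sqrt (2 * R))\<^sup>2"
        using sq R by (simp add: power_mult_distrib)
    qed (use M R in auto)
    moreover have eq: "?g (h + k) - ?g h - k * ?d = inner w (abs_L2 (\<lambda>x. ?\<psi> x *\<^sub>R e))"
    proof -
      have si: "square_integrable (\<lambda>x. \<phi> (x - h) *\<^sub>R e)" "square_integrable (\<lambda>x. \<phi> (x - (h + k)) *\<^sub>R e)"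
        "square_integrable (\<lambda>x. deriv \<phi> (x - h) *\<^sub>R e)"
        by (auto intro!: square_integrable_tensor test_function_shift \<phi> \<phi>')
      moreover from square_integrable_scaleR[OF si(3), of k]
      have "square_integrable (\<lambda>x. (k * deriv \<phi> (x - h)) *\<^sub>R e)" by simp
      ultimately have "abs_L2 (\<lambda>x. ?\<psi> x *\<^sub>R e) = tensor (\<lambda>x. \<phi> (x - (h + k))) e - tensor (\<lambda>x. \<phi> (x - h)) e
          + k *\<^sub>R tensor (\<lambda>x. deriv \<phi> (x - h)) e"
        unfolding tensor_def
        by (simp add: minus_abs_L2 scaleR_abs_L2 plus_abs_L2 square_integrable_diff square_integrable_scaleR
            scaleR_add_left scaleR_diff_left diff_diff_eq)
      then show ?thesis
        by (simp add: inner_simps)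
    qed
    ultimately have "\<bar>?g (h + k) - ?g h - k * ?d\<bar> \<le> norm w * (M * k\<^sup>2 * norm e * sqrt (2 * R))"
      unfolding eq by (meson Cauchy_Schwarz_ineq2 mult_left_mono norm_ge_zero order_trans)
    also have "\<dots> = K * \<bar>k\<bar> * \<bar>k\<bar>"
      by (simp add: K_def power2_eq_square mult_ac)
    finally have "\<bar>?g (h + k) - ?g h - k * ?d\<bar> / \<bar>k\<bar> \<le> K * \<bar>k\<bar>"
      using k by (simp add: divide_le_eq)
    moreover have "(?g (h + k) - ?g h) / k - ?d = (?g (h + k) - ?g h - k * ?d) / k"
      using k by (simp add: field_simps)
    ultimately show ?thesis by simp
  qed
  have "((\<lambda>k. (?g (h + k) - ?g h) / k - ?d) \<longlongrightarrow> 0) (at 0)"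
  proof (rule Lim_null_comparison)
    show "((\<lambda>k. K * \<bar>k\<bar>) \<longlongrightarrow> 0) (at 0)"
      by (auto intro!: tendsto_eq_intros)
    show "\<forall>\<^sub>F k in at 0. norm ((?g (h + k) - ?g h) / k - ?d) \<le> K * \<bar>k\<bar>"
      using bound by (auto simp: eventually_at dist_norm intro!: exI[of _ 1])
  qed
  then show ?thesis
    unfolding DERIV_def by (simp only: LIM_zero_iff)
qed

lemma norm_tensor_translate:
  assumes "test_function \<phi>"
  shows "norm (tensor (\<lambda>x. \<phi> (x - h)) e) = norm (tensor \<phi> e)"
proof -
  have "(norm (tensor (\<lambda>x. \<phi> (x - h)) e))\<^sup>2 = (\<integral>x. (norm (\<phi> (x - h) *\<^sub>R e))\<^sup>2 \<partial>lborel)"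
    unfolding tensor_def by (intro norm_abs_L2 square_integrable_tensor test_function_shift assms)
  also have "\<dots> = (\<integral>x. (norm (\<phi> x *\<^sub>R e))\<^sup>2 \<partial>lborel)"
    using lborel_integral_real_affine[of 1 "\<lambda>x. (norm (\<phi> (x - h) *\<^sub>R e))\<^sup>2" h] by simp
  also have "\<dots> = (norm (tensor \<phi> e))\<^sup>2"
    unfolding tensor_def by (intro norm_abs_L2[symmetric] square_integrable_tensor assms)
  finally show ?thesis
    by (rule power2_eq_imp_eq) simp_all
qed

text \<open>If \<open>w' = c w\<close> then \<open>h \<mapsto> \<langle>w, \<phi> (\<cdot> - h) e\<rangle>\<close> satisfies the same equation, so it is a
  multiple of \<open>h \<mapsto> exp (c h)\<close>.  Being bounded, it vanishes.\<close>

lemma weak_derivative_eigen: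
  assumes c: "c = 1 \<or> c = - 1" and w: "weak_derivative 1 w (c *\<^sub>R w)"
  shows "w = 0"
proof (rule eq_zero_if_orthogonal_to_tensors)
  fix \<phi> and e :: 'a assume \<phi>: "test_function \<phi>"
  define g where "g h = inner w (tensor (\<lambda>x. \<phi> (x - h)) e)" for h
  have cc: "c * c = 1" using c by auto
  have dg: "(g has_real_derivative c * g h) (at h)" for h
  proof -
    have "- inner w (tensor (\<lambda>x. deriv \<phi> (x - h)) e) = c * g h"
      using w[unfolded weak_derivative_iff, rule_format, OF test_function_shift[OF \<phi>, of h], of e]
      by (simp add: g_def deriv_shift)
    then show ?thesis
      using tensor_translate_DERIV[OF \<phi>, of w e h] unfolding g_def by simp
  qed
  have "((\<lambda>h. exp (- c * h) * g h) has_real_derivative 0) (at h)" for h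
    by (auto intro!: derivative_eq_intros dg)
  then have const: "exp (- c * h) * g h = exp (- c * 0) * g 0" for h
    by (intro DERIV_isconst_all) auto
  have growth: "exp t * g 0 = g (c * t)" for t
  proof -
    have "exp (- t) * g (c * t) = g 0"
      using const[of "c * t"] cc by (simp add: mult.assoc[symmetric])
    then show ?thesis
      by (metis exp_minus_inverse mult.assoc mult.left_neutral)
  qed
  have bound: "\<bar>g h\<bar> \<le> norm w * norm (tensor \<phi> e)" for h
    unfolding g_def using Cauchy_Schwarz_ineq2[of w "tensor (\<lambda>x. \<phi> (x - h)) e"]
    by (simp add: norm_tensor_translate[OF \<phi>])
  have "g 0 = 0"
  proof (rule ccontr)
    assume "g 0 \<noteq> 0"
    \<comment> \<open>At this time the exponential growth exceeds the bound.\<close>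
    define t where "t = norm w * norm (tensor \<phi> e) / \<bar>g 0\<bar>"
    have "norm w * norm (tensor \<phi> e) = t * \<bar>g 0\<bar>"
      using \<open>g 0 \<noteq> 0\<close> by (simp add: t_def)
    also have "\<dots> < exp t * \<bar>g 0\<bar>"
      using \<open>g 0 \<noteq> 0\<close> exp_ge_add_one_self[of t] by (intro mult_strict_right_mono) linarith+
    also have "\<dots> = \<bar>g (c * t)\<bar>"
      by (simp add: growth[symmetric] abs_mult)
    also note bound[of "c * t"]
    finally show False by simp
  qed
  then show "inner w (tensor \<phi> e) = 0"
    by (simp add: g_def)
qed

definition H1_graph :: "('a::{real_inner,banach,second_countable_topology} L2 \<times> 'a L2) set"
  where "H1_graph = {(u, v). weak_derivative 1 u v}"

lemma subspace_H1_graph: "subspace H1_graph"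
  by (auto simp: subspace_def H1_graph_def zero_prod_def weak_derivative_zero weak_derivative_add
      weak_derivative_scaleR)

lemma closed_weak_derivative: "closed {(u, v). weak_derivative n u v}"
proof -
  have "{(u, v). weak_derivative n u v} = (\<Inter>\<phi>\<in>Collect test_function. \<Inter>e.
      {p. inner (fst p) (tensor ((deriv ^^ n) \<phi>) e) = (- 1) ^ n * inner (snd p) (tensor \<phi> e)})"
    by (auto simp: weak_derivative_iff)
  also have "closed \<dots>"
    by (intro closed_INT ballI closed_Collect_eq continuous_intros)
  finally show ?thesis .
qed

lemma inner_tensor_translate:
  assumes "test_function \<phi>" "test_function \<psi>"
  shows "inner (tensor (\<lambda>x. \<phi> (x - h)) e) (tensor (\<lambda>x. \<psi> (x - h)) e') = inner (tensor \<phi> e) (tensor \<psi> e')"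
proof -
  have "inner (tensor (\<lambda>x. \<phi> (x - h)) e) (tensor (\<lambda>x. \<psi> (x - h)) e')
      = (\<integral>x. inner (\<phi> (x - h) *\<^sub>R e) (\<psi> (x - h) *\<^sub>R e') \<partial>lborel)"
    unfolding tensor_def by (intro inner_abs_L2 square_integrable_tensor test_function_shift assms)
  also have "\<dots> = (\<integral>x. inner (\<phi> x *\<^sub>R e) (\<psi> x *\<^sub>R e') \<partial>lborel)"
    using lborel_integral_real_affine[of 1 "\<lambda>x. inner (\<phi> (x - h) *\<^sub>R e) (\<psi> (x - h) *\<^sub>R e')" h] by simp
  also have "\<dots> = inner (tensor \<phi> e) (tensor \<psi> e')"
    unfolding tensor_def by (intro inner_abs_L2[symmetric] square_integrable_tensor assms)
  finally show ?thesis .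
qed

text \<open>By translation invariance of the integral, translating one factor of an inner product forwards
  amounts to translating the other one backwards.  Differentiation in the translation parameter gives
  the claim.\<close>

lemma weak_derivative_tensor:
  assumes \<phi>: "test_function \<phi>"
  shows "weak_derivative 1 (tensor \<phi> e) (tensor (deriv \<phi>) e)"
  unfolding weak_derivative_iff
proof (intro allI impI)
  fix \<psi> and e' :: 'a assume \<psi>: "test_function \<psi>"
  have "inner (tensor \<phi> e) (tensor (\<lambda>x. \<psi> (x - h)) e') = inner (tensor \<psi> e') (tensor (\<lambda>x. \<phi> (x - - h)) e)" for h
    using inner_tensor_translate[OF test_function_shift[OF \<phi>, of "- h"] \<psi>, of h e e'] by (simp add: inner_commute)
  moreover have "((\<lambda>h. inner (tensor \<psi> e') (tensor (\<lambda>x. \<phi> (x - - h)) e)) has_real_derivative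
      - (- inner (tensor \<psi> e') (tensor (\<lambda>x. deriv \<phi> (x - - 0)) e))) (at 0)"
    using tensor_translate_DERIV[OF \<phi>, of "tensor \<psi> e'" e "- 0"]
    by (subst DERIV_mirror[symmetric])
  moreover have "((\<lambda>h. inner (tensor \<phi> e) (tensor (\<lambda>x. \<psi> (x - h)) e')) has_real_derivative
      - inner (tensor \<phi> e) (tensor (\<lambda>x. deriv \<psi> (x - 0)) e')) (at 0)"
    by (rule tensor_translate_DERIV[OF \<psi>])
  ultimately have "- inner (tensor \<phi> e) (tensor (deriv \<psi>) e') = inner (tensor \<psi> e') (tensor (deriv \<phi>) e)"
    using DERIV_unique by simp
  then show "inner (tensor \<phi> e) (tensor ((deriv ^^ 1) \<psi>) e') = (- 1) ^ 1 * inner (tensor (deriv \<phi>) e) (tensor \<psi> e')"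
    by (simp add: inner_commute)
qed

text \<open>Integration by parts says that \<open>(v', v)\<close> is orthogonal to the graph of the derivative.  By
  definition it is orthogonal to the part of the graph over the tensors, and so is its projection
  \<open>(a, b)\<close> to the graph.  Hence \<open>b' = a\<close> as well as \<open>a' = b\<close>, and both \<open>a + b\<close> and \<open>a - b\<close>
  vanish.\<close>

lemma weak_derivative_by_parts:
  fixes u v :: "'a::{real_inner,banach,second_countable_topology} L2"
  assumes u: "weak_derivative 1 u u'" and v: "weak_derivative 1 v v'"
  shows "inner u' v = - inner u v'"
proof -
  have "closed (H1_graph :: ('a L2 \<times> 'a L2) set)"
    unfolding H1_graph_def by (rule closed_weak_derivative)
  from orthogonal_projection_exists[OF subspace_H1_graph this, of "(v', v)"]
  obtain a b where ab: "weak_derivative 1 a b"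
    and orth: "\<And>s. s \<in> H1_graph \<Longrightarrow> inner ((v', v) - (a, b)) s = 0"
    by (auto simp: H1_graph_def)
  have "weak_derivative 1 b a"
    unfolding weak_derivative_iff
  proof (intro allI impI)
    fix \<phi> and e :: 'a assume \<phi>: "test_function \<phi>"
    have "(tensor \<phi> e, tensor (deriv \<phi>) e) \<in> H1_graph"
      using weak_derivative_tensor[OF \<phi>] by (simp add: H1_graph_def)
    from orth[OF this] show "inner b (tensor ((deriv ^^ 1) \<phi>) e) = (- 1) ^ 1 * inner a (tensor \<phi> e)"
      using v[unfolded weak_derivative_iff, rule_format, OF \<phi>, of e] by (simp add: inner_diff_left)
  qed
  with ab have "weak_derivative 1 (a + b) (1 *\<^sub>R (a + b))" "weak_derivative 1 (a - b) ((- 1) *\<^sub>R (a - b))"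
    using weak_derivative_add[OF ab, of b a] weak_derivative_add[OF ab weak_derivative_scaleR[of 1 b a "- 1"]]
    by (auto simp: add.commute)
  then have "a + b = 0" "a - b = 0"
    using weak_derivative_eigen by blast+
  then have "b = 0" "a = 0"
    using scaleR_2[of b] by (auto simp: algebra_simps)
  then have "inner (v', v) (u, u') = 0"
    using orth[of "(u, u')"] u by (simp add: H1_graph_def zero_prod_def[symmetric])
  then show ?thesis
    by (simp add: inner_commute)
qed


section \<open>The negative second derivative\<close>

definition laplace :: "'a::{real_inner,banach,second_countable_topology} L2 \<Rightarrow> 'a L2"
  where "laplace u = - (THE v. weak_derivative 2 u v)"

lemma laplaceI: "weak_derivative 2 u w \<Longrightarrow> laplace u = - w"
  unfolding laplace_def using weak_derivative_unique by (metis the_equality)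

lemma H2_iff: "u \<in> H2 \<longleftrightarrow> (\<exists>v w. weak_derivative 1 u v \<and> weak_derivative 1 v w)"
  unfolding H2_def using weak_derivative_2 by blast

lemma H2_D:
  assumes "u \<in> H2"
  shows "\<exists>v. weak_derivative 1 u v \<and> weak_derivative 1 v (- laplace u)"
proof -
  obtain v w where vw: "weak_derivative 1 u v" "weak_derivative 1 v w"
    using assms H2_iff by blast
  then have "laplace u = - w"
    using laplaceI weak_derivative_2 by blast
  with vw show ?thesis by auto
qed

lemma laplace_eqI: "weak_derivative 1 u v \<Longrightarrow> weak_derivative 1 v w \<Longrightarrow> u \<in> H2 \<and> laplace u = - w"
  using laplaceI weak_derivative_2 H2_iff by blast

text \<open>Integration by parts turns \<open>\<langle>L u, v\<rangle>\<close> into \<open>\<langle>u', v'\<rangle>\<close>, which gives symmetry and positivity.\<close>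

lemma positive_selfadjoint_laplace:
  "positive_selfadjoint (H2 :: 'a::{real_inner,banach,second_countable_topology} L2 set) laplace"
proof (rule positive_selfadjointI)
  have add: "u + v \<in> H2 \<and> laplace (u + v) = laplace u + laplace v"
    if uv: "u \<in> H2" "v \<in> H2" for u v :: "'a L2"
  proof -
    obtain u' v' where "weak_derivative 1 u u'" "weak_derivative 1 u' (- laplace u)"
      "weak_derivative 1 v v'" "weak_derivative 1 v' (- laplace v)"
      using H2_D[OF uv(1)] H2_D[OF uv(2)] by blast
    from laplace_eqI[OF weak_derivative_add[OF this(1,3)] weak_derivative_add[OF this(2,4)]]
    show ?thesis by simp
  qed
  moreover have scale: "r *\<^sub>R u \<in> H2 \<and> laplace (r *\<^sub>R u) = r *\<^sub>R laplace u" if u: "u \<in> H2" for r and u :: "'a L2"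
  proof -
    obtain u' where "weak_derivative 1 u u'" "weak_derivative 1 u' (- laplace u)"
      using H2_D[OF u] by blast
    from laplace_eqI[OF weak_derivative_scaleR[OF this(1)] weak_derivative_scaleR[OF this(2)], of r]
    show ?thesis by simp
  qed
  moreover have "(0 :: 'a L2) \<in> H2"
    using H2_iff weak_derivative_zero by blast
  ultimately show "linear_operator scaleR (H2 :: 'a L2 set) laplace"
    by (auto simp: linear_operator_scaleR_iff subspace_def)
  have parts: "inner (laplace u) v = inner u' v'"
    if "weak_derivative 1 u u'" "weak_derivative 1 u' (- laplace u)" "weak_derivative 1 v v'" for u v u' v' :: "'a L2"
    using weak_derivative_by_parts[OF that(2,3)] by simp
  show "inner (laplace u) v = inner u (laplace v)" if "u \<in> H2" "v \<in> H2" for u v :: "'a L2"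
    using H2_D[OF that(1)] H2_D[OF that(2)] parts by (metis inner_commute)
  show "0 \<le> inner (laplace u) u" if "u \<in> H2" for u :: "'a L2"
    using H2_D[OF that] parts by (metis inner_ge_zero)
  \<comment> \<open>The projection \<open>(u, v)\<close> of \<open>(f, 0)\<close> to the graph of the derivative satisfies \<open>u - v' = f\<close>.\<close>
  show "\<exists>u\<in>H2. u + laplace u = f" for f :: "'a L2"
  proof -
    have "closed (H1_graph :: ('a L2 \<times> 'a L2) set)"
      unfolding H1_graph_def by (rule closed_weak_derivative)
    from orthogonal_projection_exists[OF subspace_H1_graph this, of "(f, 0)"]
    obtain u v where uv: "weak_derivative 1 u v"
      and orth: "\<And>s. s \<in> H1_graph \<Longrightarrow> inner ((f, 0) - (u, v)) s = 0"
      by (auto simp: H1_graph_def)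
    have "weak_derivative 1 v (u - f)"
      unfolding weak_derivative_iff
    proof (intro allI impI)
      fix \<phi> and e :: 'a assume \<phi>: "test_function \<phi>"
      have "(tensor \<phi> e, tensor (deriv \<phi>) e) \<in> H1_graph"
        using weak_derivative_tensor[OF \<phi>] by (simp add: H1_graph_def)
      from orth[OF this] show "inner v (tensor ((deriv ^^ 1) \<phi>) e) = (- 1) ^ 1 * inner (u - f) (tensor \<phi> e)"
        by (simp add: inner_diff_left)
    qed
    from laplace_eqI[OF uv this] show ?thesis
      by (intro bexI[of _ u]) auto
  qed
qed


section \<open>Pointwise action of operators\<close>

lift_definition map_L2 :: "('a \<Rightarrow>\<^sub>L 'a) \<Rightarrow> 'a::{real_inner,banach,second_countable_topology} L2 \<Rightarrow> 'a L2"
  is "\<lambda>T f x. blinfun_apply T (f x)"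
  by (auto simp: L2_eq_def intro: square_integrable_bounded_linear[OF blinfun.bounded_linear_right])

lemma map_abs_L2: "square_integrable f \<Longrightarrow> map_L2 T (abs_L2 f) = abs_L2 (\<lambda>x. blinfun_apply T (f x))"
  by (simp add: map_L2.abs_eq L2_eq_refl)

lemma weak_derivative_map_L2:
  assumes "weak_derivative n u v"
  shows "weak_derivative n (map_L2 T u) (map_L2 T v)"
proof -
  obtain f where f: "square_integrable f" "u = abs_L2 f" by (rule L2_cases)
  obtain g where g: "square_integrable g" "v = abs_L2 g" by (rule L2_cases)
  have si: "square_integrable (\<lambda>x. blinfun_apply T (h x))" if "square_integrable h" for h
    using that by (rule square_integrable_bounded_linear[OF blinfun.bounded_linear_right])
  have pull: "(\<integral>x. \<phi> x *\<^sub>R blinfun_apply T (h x) \<partial>lborel) = blinfun_apply T (\<integral>x. \<phi> x *\<^sub>R h x \<partial>lborel)"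
    if "test_function \<phi>" "square_integrable h" for \<phi> h
    using integral_bounded_linear[OF blinfun.bounded_linear_right integrable_test_function_scaleR[OF that]]
    by (simp add: blinfun.scaleR_right)
  note iff = weak_derivative.abs_eq[OF L2_eq_refl[THEN iffD2] L2_eq_refl[THEN iffD2]]
  show ?thesis
    using assms unfolding f(2) g(2) map_abs_L2[OF f(1)] map_abs_L2[OF g(1)] iff[OF f(1) g(1)]
      iff[OF si[OF f(1)] si[OF g(1)]]
    by (simp add: pull f g test_function_funpow_deriv blinfun.scaleR_right)
qed

lemma pointwise_image_abs_L2:
  "square_integrable f \<Longrightarrow> square_integrable g \<Longrightarrow>
    pointwise_image D B (abs_L2 f) (abs_L2 g) \<longleftrightarrow> (AE x in lborel. f x \<in> D \<and> g x = B (f x))"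
  by (simp add: pointwise_image.abs_eq L2_eq_refl)

lemma in_L2_domain_abs_L2:
  "square_integrable f \<Longrightarrow> in_L2_domain D B (abs_L2 f) \<longleftrightarrow>
    (\<exists>h. (AE x in lborel. h x = f x) \<and> graph_strongly_measurable D B h \<and>
      integrable lborel (\<lambda>x. (graph_norm B (h x))\<^sup>2))"
  by (simp add: in_L2_domain.abs_eq L2_eq_refl)

lemma pointwise_imageE:
  assumes "pointwise_image D B u w"
  obtains f g where "square_integrable f" "u = abs_L2 f" "square_integrable g" "w = abs_L2 g"
    "AE x in lborel. f x \<in> D \<and> g x = B (f x)"
proof -
  obtain f g where "square_integrable f" "u = abs_L2 f" "square_integrable g" "w = abs_L2 g"
    using L2_cases by metis
  then show ?thesis
    using that assms by (simp add: pointwise_image_abs_L2)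
qed

lemma pointwise_image_unique:
  assumes "pointwise_image D B u w" "pointwise_image D B u w'"
  shows "w = w'"
proof -
  from assms(1) obtain f g where f: "square_integrable f" "u = abs_L2 f"
    and g: "square_integrable g" "w = abs_L2 g" and 1: "AE x in lborel. f x \<in> D \<and> g x = B (f x)"
    by (rule pointwise_imageE)
  obtain g' where g': "square_integrable g'" "w' = abs_L2 g'" by (rule L2_cases)
  have "AE x in lborel. f x \<in> D \<and> g' x = B (f x)"
    using assms(2) by (simp add: f g' pointwise_image_abs_L2)
  with 1 have "AE x in lborel. g x = g' x"
    by eventually_elim simp
  then show ?thesis
    by (simp add: g g' abs_L2_eqI)
qed

definition pointwise_op :: "'a set \<Rightarrow> ('a \<Rightarrow> 'a) \<Rightarrow> 'a::{real_inner,banach,second_countable_topology} L2 \<Rightarrow> 'a L2"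
  where "pointwise_op D B u = (THE w. pointwise_image D B u w)"

lemma pointwise_op_eqI: "pointwise_image D B u w \<Longrightarrow> pointwise_op D B u = w"
  unfolding pointwise_op_def using pointwise_image_unique by (metis the_equality)

locale pointwise_positive_selfadjoint = positive_selfadjoint D B
  for D :: "'a::{real_inner,banach,second_countable_topology} set" and B
begin

definition res :: "real \<Rightarrow> 'a \<Rightarrow>\<^sub>L 'a"
  where "res l = Blinfun (resolvent l)"

lemma res: "0 < l \<Longrightarrow> blinfun_apply (res l) = resolvent l"
  by (simp add: res_def bounded_linear_Blinfun_apply bounded_linear_resolvent)

lemma square_integrable_resolvent:
  "0 < l \<Longrightarrow> square_integrable f \<Longrightarrow> square_integrable (\<lambda>x. resolvent l (f x))"
  by (rule square_integrable_bounded_linear[OF bounded_linear_resolvent])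

text \<open>A resolvent is bounded from the space to the domain with its graph norm.  So it turns simple
  functions that approximate \<open>u\<close> into simple functions that approximate the image in the graph norm.\<close>

lemma map_res_in_L2_domain:
  assumes l: "0 < l"
  shows "in_L2_domain D B (map_L2 (res l) u) \<and>
    pointwise_image D B (map_L2 (res l) u) (u - l *\<^sub>R map_L2 (res l) u)"
proof -
  obtain f where f: "square_integrable f" "u = abs_L2 f" by (rule L2_cases)
  define h where "h x = resolvent l (f x)" for x
  have h: "square_integrable h"
    unfolding h_def using l f(1) by (rule square_integrable_resolvent)
  have map: "map_L2 (res l) u = abs_L2 h"
    unfolding h_def by (simp add: f map_abs_L2 res[OF l])
  have hD: "h x \<in> D" and Bh: "B (h x) = f x - l *\<^sub>R h x" for x
    by (simp_all add: h_def resolvent_in_D A_resolvent l)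
  have "f \<in> borel_measurable lborel"
    using f(1) by (simp add: square_integrable_def)
  from borel_measurable_implies_sequence_metric[OF this, of 0] obtain F where
    F: "\<And>n. simple_function lborel (F n)" "\<And>x. (\<lambda>n. F n x) \<longlonglongrightarrow> f x"
    by auto
  define s where "s n = resolvent l \<circ> F n" for n
  have "graph_strongly_measurable D B h"
    unfolding graph_strongly_measurable_def
  proof (intro conjI allI exI[of _ s])
    show "h x \<in> D" for x by (rule hD)
    show "simple_function lborel (s n)" for n
      unfolding s_def by (rule simple_function_compose[OF F(1)])
    show "range (s n) \<subseteq> D" for n
      by (auto simp: s_def resolvent_in_D l)
    fix x
    have d: "(\<lambda>n. F n x - f x) \<longlonglongrightarrow> 0"
      using F(2) by (simp add: LIM_zero)
    from bounded_linear.tendsto[OF bounded_linear_resolvent[OF l] this]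
    have r: "(\<lambda>n. resolvent l (F n x - f x)) \<longlonglongrightarrow> 0"
      using bounded_linear_resolvent[OF l] by (simp add: linear_simps)
    have eq: "s n x - h x = resolvent l (F n x - f x)" for n
      using bounded_linear_resolvent[OF l] by (simp add: s_def h_def linear_simps)
    have "(\<lambda>n. sqrt ((norm (resolvent l (F n x - f x)))\<^sup>2
        + (norm ((F n x - f x) - l *\<^sub>R resolvent l (F n x - f x)))\<^sup>2)) \<longlonglongrightarrow> sqrt ((norm (0 :: 'a))\<^sup>2 + (norm (0 - l *\<^sub>R 0 :: 'a))\<^sup>2)"
      by (intro tendsto_intros d r)
    then show "(\<lambda>n. graph_norm B (s n x - h x)) \<longlonglongrightarrow> 0"
      unfolding eq by (simp add: graph_norm_def A_resolvent l)
  qed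
  moreover have "integrable lborel (\<lambda>x. (graph_norm B (h x))\<^sup>2)"
    using h square_integrable_diff[OF f(1) square_integrable_scaleR[OF h, of l]]
    by (simp add: graph_norm_def Bh square_integrable_def)
  ultimately have "in_L2_domain D B (abs_L2 h)"
    unfolding in_L2_domain_abs_L2[OF h] by blast
  moreover have "pointwise_image D B (abs_L2 h) (u - l *\<^sub>R abs_L2 h)"
    using f h by (simp add: scaleR_abs_L2 minus_abs_L2 square_integrable_scaleR pointwise_image_abs_L2
        square_integrable_diff hD Bh)
  ultimately show ?thesis
    by (simp add: map)
qed

text \<open>The graph norm dominates \<open>\<parallel>B y\<parallel>\<close>.  So for a representative \<open>h\<close> with values in the
  domain, \<open>B \<circ> h\<close> is a limit of simple functions and square-integrable.\<close>

lemma pointwise_image_exists: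
  assumes "in_L2_domain D B u"
  shows "\<exists>w. pointwise_image D B u w"
proof -
  obtain f where f: "square_integrable f" "u = abs_L2 f" by (rule L2_cases)
  obtain h where h: "AE x in lborel. h x = f x" "graph_strongly_measurable D B h"
      "integrable lborel (\<lambda>x. (graph_norm B (h x))\<^sup>2)"
    using assms unfolding f(2) in_L2_domain_abs_L2[OF f(1)] by blast
  then obtain s where hD: "\<And>x. h x \<in> D" and s: "\<And>n. simple_function lborel (s n)" "\<And>n x. s n x \<in> D"
      "\<And>x. (\<lambda>n. graph_norm B (s n x - h x)) \<longlonglongrightarrow> 0"
    unfolding graph_strongly_measurable_def by blast
  have norm_B: "norm (B y) \<le> graph_norm B y" for y
    unfolding graph_norm_def by (rule real_le_rsqrt) simp
  have [measurable]: "(\<lambda>x. B (h x)) \<in> borel_measurable lborel"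
  proof (rule borel_measurable_LIMSEQ_metric)
    show "(\<lambda>x. B (s n x)) \<in> borel_measurable lborel" for n
      using borel_measurable_simple_function[OF simple_function_compose[OF s(1), of B n]]
      by (simp add: o_def)
    fix x
    have "(\<lambda>n. B (s n x) - B (h x)) \<longlonglongrightarrow> 0"
      by (rule Lim_null_comparison[OF always_eventually s(3)[of x]])
        (auto simp: diff[symmetric] s hD norm_B)
    then show "(\<lambda>n. B (s n x)) \<longlonglongrightarrow> B (h x)"
      by (simp add: LIM_zero_iff)
  qed
  have Bh: "square_integrable (\<lambda>x. B (h x))"
    unfolding square_integrable_def
  proof
    show "integrable lborel (\<lambda>x. (norm (B (h x)))\<^sup>2)"
      by (rule Bochner_Integration.integrable_bound[OF h(3)]) (auto intro!: power_mono norm_B)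
  qed measurable
  have "pointwise_image D B u (abs_L2 (\<lambda>x. B (h x)))"
    unfolding f(2) pointwise_image_abs_L2[OF f(1) Bh]
    using h(1) by eventually_elim (metis hD)
  then show ?thesis ..
qed

lemma pointwise_image_map_res:
  assumes l: "0 < l" and uw: "pointwise_image D B u w"
  shows "map_L2 (res l) (l *\<^sub>R u + w) = u"
proof -
  from uw obtain f g where f: "square_integrable f" "u = abs_L2 f"
    and g: "square_integrable g" "w = abs_L2 g" and ae: "AE x in lborel. f x \<in> D \<and> g x = B (f x)"
    by (rule pointwise_imageE)
  have si: "square_integrable (\<lambda>x. l *\<^sub>R f x + g x)"
    by (intro square_integrable_add square_integrable_scaleR f g)
  from ae have "AE x in lborel. resolvent l (l *\<^sub>R f x + g x) = f x"
    by eventually_elim (auto intro: resolvent_eqI[OF l])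
  then show ?thesis
    using f g si
    by (simp add: scaleR_abs_L2 plus_abs_L2 square_integrable_scaleR map_abs_L2 res[OF l])
      (intro abs_L2_eqI square_integrable_resolvent[OF l])
qed

abbreviation L2_domain :: "'a L2 set"
  where "L2_domain \<equiv> {u. in_L2_domain D B u}"

lemma pointwise_opI:
  assumes "pointwise_image D B u w"
  shows "u \<in> L2_domain \<and> pointwise_op D B u = w"
  using map_res_in_L2_domain[of 1 "1 *\<^sub>R u + w"] pointwise_image_map_res[OF _ assms, of 1]
    pointwise_op_eqI[OF assms] by simp

lemma pointwise_image_op: "u \<in> L2_domain \<Longrightarrow> pointwise_image D B u (pointwise_op D B u)"
  using pointwise_image_exists[of u] pointwise_op_eqI by auto

lemma pointwise_image_add:
  assumes "pointwise_image D B u w" "pointwise_image D B u' w'"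
  shows "pointwise_image D B (u + u') (w + w')"
proof -
  from assms(1) obtain f g where f: "square_integrable f" "u = abs_L2 f"
    and g: "square_integrable g" "w = abs_L2 g" and 1: "AE x in lborel. f x \<in> D \<and> g x = B (f x)"
    by (rule pointwise_imageE)
  from assms(2) obtain f' g' where f': "square_integrable f'" "u' = abs_L2 f'"
    and g': "square_integrable g'" "w' = abs_L2 g'" and 2: "AE x in lborel. f' x \<in> D \<and> g' x = B (f' x)"
    by (rule pointwise_imageE)
  from 1 2 have "AE x in lborel. f x + f' x \<in> D \<and> g x + g' x = B (f x + f' x)"
    by eventually_elim (auto simp: add subspace_add[OF subspace_D])
  then show ?thesis
    by (simp add: f g f' g' plus_abs_L2 pointwise_image_abs_L2 square_integrable_add)
qed

lemma pointwise_image_scaleR: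
  assumes "pointwise_image D B u w"
  shows "pointwise_image D B (r *\<^sub>R u) (r *\<^sub>R w)"
proof -
  from assms obtain f g where f: "square_integrable f" "u = abs_L2 f"
    and g: "square_integrable g" "w = abs_L2 g" and "AE x in lborel. f x \<in> D \<and> g x = B (f x)"
    by (rule pointwise_imageE)
  from this(5) have "AE x in lborel. r *\<^sub>R f x \<in> D \<and> r *\<^sub>R g x = B (r *\<^sub>R f x)"
    by eventually_elim (auto simp: scale subspace_scale[OF subspace_D])
  then show ?thesis
    by (simp add: f g scaleR_abs_L2 pointwise_image_abs_L2 square_integrable_scaleR)
qed

lemma pointwise_image_symmetric:
  assumes "pointwise_image D B u w" "pointwise_image D B u' w'"
  shows "inner w u' = inner u w'"
proof -
  from assms(1) obtain f g where f: "square_integrable f" "u = abs_L2 f"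
    and g: "square_integrable g" "w = abs_L2 g" and 1: "AE x in lborel. f x \<in> D \<and> g x = B (f x)"
    by (rule pointwise_imageE)
  from assms(2) obtain f' g' where f': "square_integrable f'" "u' = abs_L2 f'"
    and g': "square_integrable g'" "w' = abs_L2 g'" and 2: "AE x in lborel. f' x \<in> D \<and> g' x = B (f' x)"
    by (rule pointwise_imageE)
  from 1 2 have "AE x in lborel. inner (g x) (f' x) = inner (f x) (g' x)"
    by eventually_elim (simp add: symmetric)
  then have "(\<integral>x. inner (g x) (f' x) \<partial>lborel) = (\<integral>x. inner (f x) (g' x) \<partial>lborel)"
    using integrable_inner[OF g(1) f'(1)] integrable_inner[OF f(1) g'(1)]
    by (intro integral_cong_AE) auto
  then show ?thesis
    by (simp add: f g f' g' inner_abs_L2)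
qed

lemma pointwise_image_positive:
  assumes "pointwise_image D B u w"
  shows "0 \<le> inner w u"
proof -
  from assms obtain f g where f: "square_integrable f" "u = abs_L2 f"
    and g: "square_integrable g" "w = abs_L2 g" and "AE x in lborel. f x \<in> D \<and> g x = B (f x)"
    by (rule pointwise_imageE)
  from this(5) have "AE x in lborel. 0 \<le> inner (g x) (f x)"
    by eventually_elim (simp add: positive)
  then show ?thesis
    by (simp add: f g inner_abs_L2 integral_nonneg_AE)
qed

lemma positive_selfadjoint_pointwise: "positive_selfadjoint L2_domain (pointwise_op D B)"
proof (rule positive_selfadjointI)
  have "pointwise_image D B 0 0"
    using pointwise_image_scaleR[OF conjunct2[OF map_res_in_L2_domain[of 1 0]], of 0] by simp
  then have "0 \<in> L2_domain"
    using pointwise_opI by blast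
  moreover have "u + v \<in> L2_domain \<and> pointwise_op D B (u + v) = pointwise_op D B u + pointwise_op D B v"
    if "u \<in> L2_domain" "v \<in> L2_domain" for u v
    by (intro pointwise_opI pointwise_image_add pointwise_image_op that)
  moreover have "r *\<^sub>R u \<in> L2_domain \<and> pointwise_op D B (r *\<^sub>R u) = r *\<^sub>R pointwise_op D B u"
    if "u \<in> L2_domain" for r u
    by (intro pointwise_opI pointwise_image_scaleR pointwise_image_op that)
  ultimately show "linear_operator scaleR L2_domain (pointwise_op D B)"
    unfolding linear_operator_scaleR_iff subspace_def by blast
  show "inner (pointwise_op D B u) v = inner u (pointwise_op D B v)"
    if "u \<in> L2_domain" "v \<in> L2_domain" for u v
    by (intro pointwise_image_symmetric pointwise_image_op that)
  show "0 \<le> inner (pointwise_op D B u) u" if "u \<in> L2_domain" for u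
    by (intro pointwise_image_positive pointwise_image_op that)
  show "\<exists>u\<in>L2_domain. u + pointwise_op D B u = y" for y
    using pointwise_opI[OF conjunct2[OF map_res_in_L2_domain[of 1 y]]]
    by (intro bexI[of _ "map_L2 (res 1) y"]) auto
qed

sublocale pw: positive_selfadjoint L2_domain "pointwise_op D B"
  by (rule positive_selfadjoint_pointwise)

lemma resolvent_pointwise:
  assumes l: "0 < l"
  shows "pw.resolvent l y = map_L2 (res l) y"
  using pointwise_opI[OF conjunct2[OF map_res_in_L2_domain[OF l, of y]]]
  by (intro pw.resolvent_eqI l) auto

text \<open>The resolvents of the pointwise operator act on the values only, hence they commute with
  differentiation.\<close>

lemma weak_derivative_approx_id:
  assumes "weak_derivative k u v"
  shows "weak_derivative k (pw.approx_id n u) (pw.approx_id n v)"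
  unfolding pw.approx_id_def
  by (simp only: resolvent_pointwise of_nat_0_less_iff zero_less_Suc)
    (intro weak_derivative_scaleR weak_derivative_map_L2 assms)

lemma weak_derivative_yosida:
  assumes "weak_derivative k u v"
  shows "weak_derivative k (pw.yosida n u) (pw.yosida n v)"
  unfolding pw.yosida_def
  using weak_derivative_scaleR[OF weak_derivative_add[OF assms
    weak_derivative_scaleR[OF weak_derivative_approx_id[OF assms], of "- 1"]]] by simp

lemma A_operator_eq: "A_operator D B = (\<lambda>u. laplace u + pointwise_op D B u)"
  by (simp add: A_operator_def laplace_def pointwise_op_def fun_eq_iff)

lemma A_domain_eq: "A_domain D B = H2 \<inter> L2_domain"
  by (simp add: A_domain_def)

lemma A_well_defined: "A_well_defined D B"
  unfolding A_well_defined_def A_domain_eq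
proof (intro ballI conjI)
  fix u assume u: "u \<in> H2 \<inter> L2_domain"
  then show "\<exists>!v. weak_derivative 2 u v"
    using weak_derivative_unique by (auto simp: H2_def)
  show "\<exists>!w. pointwise_image D B u w"
    using u pointwise_image_op pointwise_image_unique by blast
qed

text \<open>The hypotheses of the theorem on sums hold because the resolvents of the pointwise operator commute
  with differentiation.  In particular \<open>\<langle>L u, M\<^sub>n u\<rangle> = \<langle>u', M\<^sub>n u'\<rangle>\<close>.\<close>

theorem positive_selfadjoint_A: "positive_selfadjoint (A_domain D B) (A_operator D B)"
  unfolding A_domain_eq A_operator_eq
proof (rule positive_selfadjoint_sum[OF positive_selfadjoint_laplace positive_selfadjoint_pointwise])
  fix n and u :: "'a L2" assume u: "u \<in> H2"
  then obtain v where v: "weak_derivative 1 u v" "weak_derivative 1 v (- laplace u)"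
    using H2_D by blast
  have "pw.approx_id n (- laplace u) = - pw.approx_id n (laplace u)"
    using pw.bounded_linear_approx_id[of n] by (simp add: linear_simps)
  with laplace_eqI[OF weak_derivative_approx_id[OF v(1), of n] weak_derivative_approx_id[OF v(2), of n]]
  show "pw.approx_id n u \<in> H2 \<and> laplace (pw.approx_id n u) = pw.approx_id n (laplace u)"
    by simp
  have "inner (laplace u) (pw.yosida n u) = inner v (pw.yosida n v)"
    using weak_derivative_by_parts[OF v(2) weak_derivative_yosida[OF v(1), of n]] by simp
  then show "0 \<le> inner (laplace u) (pw.yosida n u)"
    using pw.yosida_positive[of n v] by (simp add: inner_commute)
qed

end


section \<open>Real and complex scalars\<close>

text \<open>At real times the semigroup of the complexified operator commutes with the projection
  \<open>(x, y) \<mapsto> (x, 0)\<close>, so it comes from a semigroup on the real space.\<close>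

lemma (in positive_selfadjoint) generates_analytic_semigroup_real:
  "generates_analytic_semigroup_real D (\<lambda>x. - A x)"
proof -
  define J where "J = (\<lambda>(x :: 'h, y :: 'h). (- y, x))"
  define AA where "AA = complexified_operator A"
  have AA: "AA (x, y) = (A x, A y)" for x y
    by (simp add: AA_def complexified_operator_def)
  have J: "J (x, y) = (- y, x)" for x y
    by (simp add: J_def)
  interpret P: positive_selfadjoint "D \<times> D" AA
  proof (rule positive_selfadjointI)
    show "linear_operator scaleR (D \<times> D) AA"
      using subspace_D by (auto simp: linear_operator_scaleR_iff subspace_def AA add scale zero_prod_def)
    show "inner (AA p) q = inner p (AA q)" if "p \<in> D \<times> D" "q \<in> D \<times> D" for p q
      using that by (auto simp: AA symmetric)
    show "0 \<le> inner (AA p) p" if "p \<in> D \<times> D" for p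
      using that by (auto simp: AA positive)
    show "\<exists>p\<in>D \<times> D. p + AA p = q" for q
    proof -
      obtain x y where "x \<in> D" "y \<in> D" "x + A x = fst q" "y + A y = snd q"
        using shift_surj[of 1 "fst q"] shift_surj[of 1 "snd q"] by auto
      then show ?thesis
        by (intro bexI[of _ "(x, y)"]) (auto simp: AA)
    qed
  qed
  interpret S: positive_selfadjoint_complex J "D \<times> D" AA
  proof (intro positive_selfadjoint_complex.intro complex_structure.intro P.positive_selfadjoint_axioms
      positive_selfadjoint_complex_axioms.intro)
    show "linear J"
      by (rule linearI) (auto simp: J_def)
    show "J (J p) = - p" "inner (J p) (J q) = inner p q" for p q
      by (auto simp: J_def split: prod.splits)
    show "J p \<in> D \<times> D \<and> AA (J p) = J (AA p)" if "p \<in> D \<times> D" for p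
      using that subspace_neg[OF subspace_D] scale[of _ "- 1"] by (auto simp: J AA)
  qed
  have sc: "S.sc = complexified_scale"
    by (auto simp: fun_eq_iff S.sc_def complexified_scale_def J)
  let ?T = "\<lambda>t. S.semigroup (of_real t)"
  define R where "R t x = fst (?T t (x, 0))" for t x
  have T0: "?T t (x, 0) = (R t x, 0)" if "0 \<le> t" for t x
  proof -
    let ?P = "\<lambda>p :: 'h \<times> 'h. (fst p, 0 :: 'h)"
    have "bounded_linear ?P"
      by (intro bounded_linear_Pair bounded_linear_fst bounded_linear_zero)
    moreover have "?P p \<in> D \<times> D \<and> AA (?P p) = ?P (AA p)" if "p \<in> D \<times> D" for p
      using that zero subspace_0[OF subspace_D] by (auto simp: AA)
    moreover have "?P (S.sc ((- of_real t) ^ n / fact n) p) = S.sc ((- of_real t) ^ n / fact n) (?P p)" for n p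
      using S.sc_of_real[of "(- t) ^ n / fact n"] by simp
    ultimately have "?P (?T t (x, 0)) = ?T t (?P (x, 0))"
      using that by (intro S.semigroup_commute) auto
    then show ?thesis by (simp add: R_def)
  qed
  have T: "?T t = complexified_operator (R t)" if t: "0 \<le> t" for t
  proof
    fix p :: "'h \<times> 'h"
    obtain x y where p: "p = (x, y)" by (cases p)
    have TJ: "?T t (J q) = J (?T t q)" for q
      using t S.semigroup_sc[of "of_real t" \<i> q] by (simp add: S.sc_def)
    have "?T t (x, y) = ?T t ((x, 0) + J (y, 0))"
      by (simp add: J)
    also have "\<dots> = ?T t (x, 0) + J (?T t (y, 0))"
      using t TJ linear_add[OF bounded_linear.linear[OF S.bounded_linear_semigroup[of "of_real t"]]]
      by simp
    also have "\<dots> = (R t x, R t y)"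
      by (simp add: T0[OF t] J)
    finally show "?T t p = complexified_operator (R t) p"
      by (simp add: p complexified_operator_def)
  qed
  have gen: "is_generator ?T (D \<times> D) (complexified_operator (\<lambda>x. - A x))"
  proof -
    have "complexified_operator (\<lambda>x. - A x) = (\<lambda>p. - AA p)"
      by (auto simp: fun_eq_iff AA complexified_operator_def)
    then show ?thesis
      using S.semigroup_generator by simp
  qed
  have "C0_semigroup R"
    unfolding C0_semigroup_def
  proof (intro conjI allI impI)
    show "bounded_linear (R t)" if "0 \<le> t" for t
      unfolding R_def using that
      by (intro bounded_linear_compose[OF bounded_linear_fst]
          bounded_linear_compose[OF S.bounded_linear_semigroup] bounded_linear_Pair
          bounded_linear_ident bounded_linear_zero) simp
    show "R 0 = id"
      by (simp add: R_def fun_eq_iff)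
    show "R (s + t) = R s \<circ> R t" if "0 \<le> s" "0 \<le> t" for s t
    proof
      fix x
      have "?T (s + t) (x, 0) = ?T s (?T t (x, 0))"
        using that S.semigroup_add[of "of_real s" "of_real t"] by simp
      then show "R (s + t) x = (R s \<circ> R t) x"
        using that T0[of "s + t" x] by (simp add: T0)
    qed
    fix x
    have "filterlim of_real (at 0 within {z. 0 \<le> Re z}) (at_right (0::real))"
      unfolding filterlim_at
      by (auto simp: eventually_at_filter intro!: tendsto_eq_intros)
    from filterlim_compose[OF S.semigroup_tendsto_zero this]
    have "((\<lambda>t. ?T t (x, 0)) \<longlongrightarrow> (x, 0)) (at_right 0)" .
    from tendsto_fst[OF this] show "((\<lambda>t. R t x) \<longlongrightarrow> x) (at_right 0)"
      by (simp add: R_def)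
  qed
  moreover have "is_generator R D (\<lambda>x. - A x)"
    unfolding is_generator_def
  proof (intro allI)
    fix x y
    have ev: "\<forall>\<^sub>F t in at_right 0. (?T t (x, 0) - (x, 0)) /\<^sub>R t = ((R t x - x) /\<^sub>R t, 0)"
      using eventually_at_right_less[of "0::real"] by eventually_elim (simp add: T0)
    have "((\<lambda>t. (R t x - x) /\<^sub>R t) \<longlongrightarrow> y) (at_right 0) \<longleftrightarrow>
        ((\<lambda>t. ((R t x - x) /\<^sub>R t, 0 :: 'h)) \<longlongrightarrow> (y, 0)) (at_right 0)"
      using tendsto_fst tendsto_Pair[OF _ tendsto_const] by fastforce
    also have "\<dots> \<longleftrightarrow> ((\<lambda>t. (?T t (x, 0) - (x, 0)) /\<^sub>R t) \<longlongrightarrow> (y, 0)) (at_right 0)"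
      using tendsto_cong[OF ev] by simp
    also have "\<dots> \<longleftrightarrow> (x, 0) \<in> D \<times> D \<and> (y, 0) = complexified_operator (\<lambda>x. - A x) (x, 0)"
      using gen unfolding is_generator_def by blast
    also have "\<dots> \<longleftrightarrow> x \<in> D \<and> y = - A x"
      using subspace_0[OF subspace_D] zero by (auto simp: complexified_operator_def)
    finally show "((\<lambda>t. (R t x - x) /\<^sub>R t) \<longlongrightarrow> y) (at_right 0) \<longleftrightarrow> x \<in> D \<and> y = - A x" .
  qed
  moreover have "\<exists>\<delta> T. 0 < \<delta> \<and> \<delta> \<le> pi / 2 \<and> analytic_semigroup complexified_scale \<delta> T \<and>
        (\<forall>t\<ge>0. T (of_real t) = complexified_operator (R t)) \<and>
        is_generator (\<lambda>t. T (of_real t)) (D \<times> D) (complexified_operator (\<lambda>x. - A x))"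
    using S.analytic_semigroup T gen by (intro exI[of _ "pi / 2"] exI[of _ S.semigroup]) (simp add: sc)
  ultimately show ?thesis
    unfolding generates_analytic_semigroup_real_def by blast
qed

lemma module_scaleC: "module (scaleC :: complex \<Rightarrow> 'a \<Rightarrow> 'a::complex_inner)"
  by standard (simp_all add: scaleC_add_right scaleC_add_left scaleC_scaleC
      scaleC_of_real[of 1, simplified])

lemma inner_ii_left: "inner (\<i> *\<^sub>C x) y = - inner x (\<i> *\<^sub>C (y :: 'a::complex_inner))"
  using arg_cong[OF cinner_scaleC_left[of \<i> x y], of Re]
    arg_cong[OF cinner_scaleC_right[of x \<i> y], of Re]
  by (simp add: Re_cinner[symmetric])

text \<open>The complex adjoint and the real one agree: the imaginary part of the complex inner product is
  recovered from the real inner product by testing with \<open>\<i> x\<close> in place of \<open>x\<close>.\<close>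

lemma self_adjoint_cinner_iff:
  fixes D :: "'a::complex_inner set"
  shows "self_adjoint scaleC cinner D A \<longleftrightarrow>
    self_adjoint scaleR inner D A \<and> (\<forall>x\<in>D. \<i> *\<^sub>C x \<in> D \<and> A (\<i> *\<^sub>C x) = \<i> *\<^sub>C A x)"
proof -
  have lin: "linear_operator scaleC D A \<longleftrightarrow>
    linear_operator scaleR D A \<and> (\<forall>x\<in>D. \<i> *\<^sub>C x \<in> D \<and> A (\<i> *\<^sub>C x) = \<i> *\<^sub>C A x)" (is "?C \<longleftrightarrow> ?R")
  proof
    assume ?C
    then have "\<forall>c. \<forall>x\<in>D. complex_of_real c *\<^sub>C x \<in> D \<and> A (complex_of_real c *\<^sub>C x) = complex_of_real c *\<^sub>C A x"
      by (auto simp: linear_operator_def module.subspace_def[OF module_scaleC])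
    with \<open>?C\<close> show ?R
      by (simp add: linear_operator_def module.subspace_def[OF module_scaleC] subspace_def
          scaleC_of_real flip: subspace_raw_def)
  next
    assume ?R
    then have D: "subspace D" and add: "\<And>x y. x \<in> D \<Longrightarrow> y \<in> D \<Longrightarrow> A (x + y) = A x + A y"
      and scale: "\<And>c x. x \<in> D \<Longrightarrow> A (c *\<^sub>R x) = c *\<^sub>R A x"
      and i: "\<And>x. x \<in> D \<Longrightarrow> \<i> *\<^sub>C x \<in> D" "\<And>x. x \<in> D \<Longrightarrow> A (\<i> *\<^sub>C x) = \<i> *\<^sub>C A x"
      by (auto simp: linear_operator_scaleR_iff)
    have "c *\<^sub>C x \<in> D \<and> A (c *\<^sub>C x) = c *\<^sub>C A x" if "x \<in> D" for c x
      unfolding scaleC_eq[of c x] scaleC_eq[of c "A x"]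
      using that by (simp add: add scale i subspace_add[OF D] subspace_scale[OF D])
    with D add show ?C
      by (simp add: linear_operator_def module.subspace_def[OF module_scaleC] subspace_def)
  qed
  have adj: "adjoint_graph cinner D A = adjoint_graph inner D A"
    if i: "\<And>x. x \<in> D \<Longrightarrow> \<i> *\<^sub>C x \<in> D \<and> A (\<i> *\<^sub>C x) = \<i> *\<^sub>C A x"
  proof -
    have "(\<forall>x\<in>D. cinner (A x) y = cinner x z) \<longleftrightarrow> (\<forall>x\<in>D. inner (A x) y = inner x z)" for y z
    proof (intro iffI ballI)
      fix x assume "\<forall>x\<in>D. cinner (A x) y = cinner x z" "x \<in> D"
      then show "inner (A x) y = inner x z"
        by (metis Re_cinner)
    next
      fix x assume *: "\<forall>x\<in>D. inner (A x) y = inner x z" "x \<in> D"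
      then have "inner (\<i> *\<^sub>C A x) y = inner (\<i> *\<^sub>C x) z"
        using i by metis
      then have "inner (A x) (\<i> *\<^sub>C y) = inner x (\<i> *\<^sub>C z)"
        by (simp add: inner_ii_left)
      with * show "cinner (A x) y = cinner x z"
        by (simp add: cinner_eq)
    qed
    then show ?thesis
      by (simp add: adjoint_graph_def)
  qed
  show ?thesis
    unfolding self_adjoint_def lin using adj by auto
qed

lemma complex_structure_ii: "complex_structure (\<lambda>x :: 'a::{complex_inner,banach}. \<i> *\<^sub>C x)"
proof (rule complex_structure.intro)
  show "linear (\<lambda>x :: 'a. \<i> *\<^sub>C x)"
    by (rule bounded_linear.linear[OF bounded_linear_ii_scaleC])
  show "\<i> *\<^sub>C \<i> *\<^sub>C x = - x" for x :: 'a
    using scaleC_of_real[of "- 1" x] by (simp add: scaleC_scaleC)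
  then show "inner (\<i> *\<^sub>C x) (\<i> *\<^sub>C y) = inner x y" for x y :: 'a
    by (simp add: inner_ii_left)
qed

lemma generates_analytic_semigroup_complex:
  fixes D :: "'h::{complex_inner,banach} set"
  assumes A: "positive_selfadjoint D A" and i: "\<And>x. x \<in> D \<Longrightarrow> \<i> *\<^sub>C x \<in> D \<and> A (\<i> *\<^sub>C x) = \<i> *\<^sub>C A x"
  shows "generates_analytic_semigroup_complex D (\<lambda>x. - A x)"
proof -
  interpret A: positive_selfadjoint D A by (rule A)
  interpret J: complex_structure "\<lambda>x :: 'h. \<i> *\<^sub>C x" by (rule complex_structure_ii)
  interpret S: positive_selfadjoint_complex "\<lambda>x :: 'h. \<i> *\<^sub>C x" D A
    by unfold_locales (rule i)
  have "J.sc = scaleC"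
    by (intro ext) (simp add: J.sc_def scaleC_eq[symmetric])
  with S.analytic_semigroup S.semigroup_generator show ?thesis
    unfolding generates_analytic_semigroup_complex_def
    by (intro exI[of _ "pi / 2"] exI[of _ S.semigroup]) simp
qed

lemma ii_scaleC_L2: "\<i> *\<^sub>C u = map_L2 (Blinfun (\<lambda>x :: 'a::{complex_inner,banach,second_countable_topology}. \<i> *\<^sub>C x)) u"
proof -
  obtain f where f: "square_integrable f" "u = abs_L2 f" by (rule L2_cases)
  then show ?thesis
    by (simp add: map_abs_L2 bounded_linear_Blinfun_apply[OF bounded_linear_ii_scaleC] scaleC_L2.abs_eq L2_eq_refl)
qed

text \<open>Multiplication by \<open>\<i>\<close> acts on the values, so it commutes with differentiation, and it commutes with
  \<open>B\<close> by hypothesis.\<close>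

lemma A_operator_ii:
  fixes D :: "'a::{complex_inner,banach,second_countable_topology} set"
  assumes B: "positive_selfadjoint D B" and i: "\<And>x. x \<in> D \<Longrightarrow> \<i> *\<^sub>C x \<in> D \<and> B (\<i> *\<^sub>C x) = \<i> *\<^sub>C B x"
    and u: "u \<in> A_domain D B"
  shows "\<i> *\<^sub>C u \<in> A_domain D B \<and> A_operator D B (\<i> *\<^sub>C u) = \<i> *\<^sub>C A_operator D B u"
proof -
  interpret pointwise_positive_selfadjoint D B
    using B by (rule pointwise_positive_selfadjoint.intro)
  have u': "u \<in> H2" "u \<in> L2_domain"
    using u by (auto simp: A_domain_eq)
  obtain v where v: "weak_derivative 1 u v" "weak_derivative 1 v (- laplace u)"
    using H2_D[OF u'(1)] by blast
  have 1: "\<i> *\<^sub>C u \<in> H2 \<and> laplace (\<i> *\<^sub>C u) = - (\<i> *\<^sub>C - laplace u)"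
    unfolding ii_scaleC_L2
    by (rule laplace_eqI[OF weak_derivative_map_L2[OF v(1)] weak_derivative_map_L2[OF v(2)]])
  from pointwise_image_op[OF u'(2)] obtain f g where f: "square_integrable f" "u = abs_L2 f"
    and g: "square_integrable g" "pointwise_op D B u = abs_L2 g"
    and "AE x in lborel. f x \<in> D \<and> g x = B (f x)"
    by (rule pointwise_imageE)
  from this(5) have "AE x in lborel. \<i> *\<^sub>C f x \<in> D \<and> \<i> *\<^sub>C g x = B (\<i> *\<^sub>C f x)"
    by eventually_elim (use i in auto)
  then have "pointwise_image D B (\<i> *\<^sub>C u) (\<i> *\<^sub>C pointwise_op D B u)"
    unfolding f(2) g(2)[unfolded f(2)]
    by (simp add: f(1) g(1) scaleC_L2.abs_eq L2_eq_refl pointwise_image_abs_L2 square_integrable_scaleC)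
  note 2 = pointwise_opI[OF this]
  have "\<i> *\<^sub>C - w = - (\<i> *\<^sub>C w)" for w :: "'a L2"
    using linear_neg[OF bounded_linear.linear[OF bounded_linear_ii_scaleC]] .
  with 1 2 show ?thesis
    by (simp add: A_domain_eq A_operator_eq scaleC_add_right)
qed

theorem proposition1p1:
  fixes D\<^sub>R :: "'a::{real_inner,banach,second_countable_topology} set" and B\<^sub>R :: "'a \<Rightarrow> 'a"
    and D\<^sub>C :: "'b::{complex_inner,banach,second_countable_topology} set" and B\<^sub>C :: "'b \<Rightarrow> 'b"
  shows
    "(self_adjoint scaleR inner D\<^sub>R B\<^sub>R \<and> positive_operator inner D\<^sub>R B\<^sub>R \<longrightarrow>
        A_well_defined D\<^sub>R B\<^sub>R \<and>
        self_adjoint scaleR inner (A_domain D\<^sub>R B\<^sub>R) (A_operator D\<^sub>R B\<^sub>R) \<and>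
        generates_analytic_semigroup_real (A_domain D\<^sub>R B\<^sub>R) (\<lambda>u. - A_operator D\<^sub>R B\<^sub>R u)) \<and>
     (self_adjoint scaleC cinner D\<^sub>C B\<^sub>C \<and> positive_operator cinner D\<^sub>C B\<^sub>C \<longrightarrow>
        A_well_defined D\<^sub>C B\<^sub>C \<and>
        self_adjoint scaleC cinner (A_domain D\<^sub>C B\<^sub>C) (A_operator D\<^sub>C B\<^sub>C) \<and>
        generates_analytic_semigroup_complex (A_domain D\<^sub>C B\<^sub>C) (\<lambda>u. - A_operator D\<^sub>C B\<^sub>C u))"
proof (intro conjI impI; elim conjE)
  assume "self_adjoint scaleR inner D\<^sub>R B\<^sub>R" "positive_operator inner D\<^sub>R B\<^sub>R"
  then interpret pointwise_positive_selfadjoint D\<^sub>R B\<^sub>R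
    using nonneg_Reals_of_real_iff[where 'a = real]
    by unfold_locales (auto simp: positive_operator_def)
  interpret A: positive_selfadjoint "A_domain D\<^sub>R B\<^sub>R" "A_operator D\<^sub>R B\<^sub>R"
    by (rule positive_selfadjoint_A)
  show "A_well_defined D\<^sub>R B\<^sub>R" by (rule A_well_defined)
  show "self_adjoint scaleR inner (A_domain D\<^sub>R B\<^sub>R) (A_operator D\<^sub>R B\<^sub>R)" by (rule A.selfadjoint)
  show "generates_analytic_semigroup_real (A_domain D\<^sub>R B\<^sub>R) (\<lambda>u. - A_operator D\<^sub>R B\<^sub>R u)"
    by (rule A.generates_analytic_semigroup_real)
next
  assume sa: "self_adjoint scaleC cinner D\<^sub>C B\<^sub>C" and pos: "positive_operator cinner D\<^sub>C B\<^sub>C"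
  have B: "positive_selfadjoint D\<^sub>C B\<^sub>C"
  proof
    show "self_adjoint scaleR inner D\<^sub>C B\<^sub>C"
      using sa by (simp add: self_adjoint_cinner_iff)
    show "0 \<le> inner (B\<^sub>C x) x" if "x \<in> D\<^sub>C" for x
      using pos that by (auto simp: positive_operator_def Re_cinner[symmetric] complex_nonneg_Reals_iff)
  qed
  then interpret pointwise_positive_selfadjoint D\<^sub>C B\<^sub>C
    by (rule pointwise_positive_selfadjoint.intro)
  interpret A: positive_selfadjoint "A_domain D\<^sub>C B\<^sub>C" "A_operator D\<^sub>C B\<^sub>C"
    by (rule positive_selfadjoint_A)
  have ii: "\<i> *\<^sub>C u \<in> A_domain D\<^sub>C B\<^sub>C \<and> A_operator D\<^sub>C B\<^sub>C (\<i> *\<^sub>C u) = \<i> *\<^sub>C A_operator D\<^sub>C B\<^sub>C u"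
    if "u \<in> A_domain D\<^sub>C B\<^sub>C" for u
    using sa that by (intro A_operator_ii[OF B]) (auto simp: self_adjoint_cinner_iff)
  show "A_well_defined D\<^sub>C B\<^sub>C" by (rule A_well_defined)
  show "self_adjoint scaleC cinner (A_domain D\<^sub>C B\<^sub>C) (A_operator D\<^sub>C B\<^sub>C)"
    using A.selfadjoint ii by (simp add: self_adjoint_cinner_iff)
  show "generates_analytic_semigroup_complex (A_domain D\<^sub>C B\<^sub>C) (\<lambda>u. - A_operator D\<^sub>C B\<^sub>C u)"
    by (rule generates_analytic_semigroup_complex[OF A.positive_selfadjoint_axioms ii])
qed

end
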